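(* Let $G$ be an abelian group and let $\mathcal{B}$ be a $G$-graded algebra that is graded-central-simple over $\mathbb{R}$. Let $H$ be the support of the centroid $C(\mathcal{B})$ and let $\pi:G\to\overline{G}=G/H$ be the natural homomorphism. Then, for some character $\chi:G\to U\subset\mathbb{C}^\times$, there exist a central simple algebra $\mathcal{A}$ over $\mathbb{R}$ and a $\overline{G}$-grading on $\mathcal{A}$ such that $\mathcal{B}\cong L_\pi^\chi(\mathcal{A})$ as $G$-graded algebras. Moreover, one can take any character $\chi:G\to U$ satisfying $L_\pi^\chi(\mathbb{R})\cong C(\mathcal{B})$ (as $G$-graded algebras).
   Context: Algebras are not assumed associative, unital or finite-dimensional. A $G$-grading on an algebra $\mathcal{B}$ is a vector space decomposition $\mathcal{B}=\bigoplus_{g\in G}\mathcal{B}_g$ with $\mathcal{B}_g\mathcal{B}_h\subset\mathcal{B}_{gh}$; its support is $\{g:\mathcal{B}_g\neq 0\}$. Isomorphisms of $G$-graded algebras are algebra isomorphisms preserving degrees. $\mathcal{B}$ is graded-simple if $\mathcal{B}^2\neq 0$ and $\mathcal{B}$ has no graded ideals other than $0$ and $\mathcal{B}$. The centroid $C(\mathcal{B})$ is the set of linear operators on $\mathcal{B}$ commuting with all left and right multiplications; $C(\mathcal{B})_g$ is the set of $c\in C(\mathcal{B})$ with $c(\mathcal{B}_h)\subset\mathcal{B}_{gh}$ for all $h\in G$. If $\mathcal{B}$ is graded-simple, then $C(\mathcal{B})=\bigoplus_{g\in G}C(\mathcal{B})_g$ is a commutative associative $G$-graded algebra in which every nonzero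 homogeneous element is invertible, and its support is a subgroup of $G$. $\mathcal{B}$ is graded-central if $C(\mathcal{B})_e$ consists of the scalar operators only; graded-central-simple means graded-central and graded-simple. Central simple means simple with centroid equal to the scalar operators. Let $U=\{z\in\mathbb{C}:|z|=1\}$. Let $\pi:G\to\overline{G}$ be an epimorphism of abelian groups with kernel $H$, let $\chi:G\to U$ be a character, and let $\mathcal{A}$ be a $\overline{G}$-graded algebra over $\mathbb{R}$. For each $g\in G$ choose $z_g\in U$ with $z_g^2=\chi(g)$ and put $u_g=z_g\otimes g\in\mathbb{C}\otimes_{\mathbb{R}}\mathbb{R}G=\mathbb{C}G$. The (twisted) loop algebra is $$L_\pi^\chi(\mathcal{A})=\bigoplus_{g\in G}\mathcal{A}_{\pi(g)}\otimes u_g\subset\mathcal{A}\otimes_{\mathbb{R}}\mathbb{C}G,$$ which is an $\mathbb{R}$-subalgebra (independent of the choice of the $z_g$), $G$-graded with $L_\pi^\chi(\mathcal{A})_g=\mathcal{A}_{\pi(g)}\otimes u_g$. In particular, with $\mathbb{R}$ trivially graded, $L_\pi^\chi(\mathbb{R})=\bigoplus_{h\in H}\mathbb{R}u_h$. *)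

theory Defs
  imports
    "HOL-Algebra.Coset"
    "HOL-Analysis.Product_Vector"
    "HOL-Library.Function_Algebras"
begin

section \<open>Nonassociative real algebras\<close>

text \<open>
  Operators on an algebra and elements of \<open>A \<otimes> \<complex>G\<close> are functions, hence the pointwise
  real vector space structure on function types.
\<close>

instantiation "fun" :: (type, real_vector) real_vector
begin

definition scaleR_fun :: "real \<Rightarrow> ('a \<Rightarrow> 'b) \<Rightarrow> 'a \<Rightarrow> 'b"
  where "scaleR_fun r f = (\<lambda>x. r *\<^sub>R f x)"

instance
  by standard (simp_all add: scaleR_fun_def fun_eq_iff scaleR_add_right scaleR_add_left)

end

lemma scaleR_fun_apply [simp]: "(r *\<^sub>R f) x = r *\<^sub>R f x"
  by (simp add: scaleR_fun_def)

text \<open>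
  An algebra consists of a linear subspace of an ambient real vector space, which provides the
  vector space operations, and of a product. The product is only meaningful on the carrier.
\<close>

record 'a alg = "'a partial_object" +
  aprod :: "'a \<Rightarrow> 'a \<Rightarrow> 'a" (infixl \<open>\<star>\<index>\<close> 70)

locale real_algebra =
  fixes A :: "('a::real_vector, 'm) alg_scheme" (structure)
  assumes subspace_carrier: "subspace (carrier A)"
    and prod_closed: "\<lbrakk>x \<in> carrier A; y \<in> carrier A\<rbrakk> \<Longrightarrow> x \<star> y \<in> carrier A"
    and prod_add_left: "\<lbrakk>x \<in> carrier A; y \<in> carrier A; z \<in> carrier A\<rbrakk> \<Longrightarrow> (x + y) \<star> z = x \<star> z + y \<star> z"
    and prod_add_right: "\<lbrakk>x \<in> carrier A; y \<in> carrier A; z \<in> carrier A\<rbrakk> \<Longrightarrow> x \<star> (y + z) = x \<star> y + x \<star> z"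
    and prod_scale_left: "\<lbrakk>x \<in> carrier A; y \<in> carrier A\<rbrakk> \<Longrightarrow> (r *\<^sub>R x) \<star> y = r *\<^sub>R (x \<star> y)"
    and prod_scale_right: "\<lbrakk>x \<in> carrier A; y \<in> carrier A\<rbrakk> \<Longrightarrow> x \<star> (r *\<^sub>R y) = r *\<^sub>R (x \<star> y)"

definition real_line :: "real alg"
  where "real_line = \<lparr>carrier = UNIV, aprod = (*)\<rparr>"

definition lin_on :: "'a::real_vector set \<Rightarrow> ('a \<Rightarrow> 'b::real_vector) \<Rightarrow> bool"
  where "lin_on V f \<longleftrightarrow>
    (\<forall>x\<in>V. \<forall>y\<in>V. f (x + y) = f x + f y) \<and> (\<forall>r. \<forall>x\<in>V. f (r *\<^sub>R x) = r *\<^sub>R f x)"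

definition ideal_of :: "('a::real_vector, 'm) alg_scheme \<Rightarrow> 'a set \<Rightarrow> bool"
  where "ideal_of A I \<longleftrightarrow> subspace I \<and> I \<subseteq> carrier A \<and>
    (\<forall>a\<in>carrier A. \<forall>x\<in>I. a \<star>\<^bsub>A\<^esub> x \<in> I \<and> x \<star>\<^bsub>A\<^esub> a \<in> I)"

definition nonzero_product :: "('a::real_vector, 'm) alg_scheme \<Rightarrow> bool"
  where "nonzero_product A \<longleftrightarrow> (\<exists>x\<in>carrier A. \<exists>y\<in>carrier A. x \<star>\<^bsub>A\<^esub> y \<noteq> 0)"

definition simple_alg :: "('a::real_vector, 'm) alg_scheme \<Rightarrow> bool"
  where "simple_alg A \<longleftrightarrow>
    nonzero_product A \<and> (\<forall>I. ideal_of A I \<longrightarrow> I = {0} \<or> I = carrier A)"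

text \<open>
  A linear operator on the carrier is represented by its extension by zero to the ambient type,
  so that equal operators are equal functions and the operators form a subspace.
\<close>

definition operators :: "('a::real_vector, 'm) alg_scheme \<Rightarrow> ('a \<Rightarrow> 'a) set"
  where "operators A =
    {c. c \<in> carrier A \<rightarrow> carrier A \<and> lin_on (carrier A) c \<and> (\<forall>x. x \<notin> carrier A \<longrightarrow> c x = 0)}"

definition scalar_operators :: "('a::real_vector, 'm) alg_scheme \<Rightarrow> ('a \<Rightarrow> 'a) set"
  where "scalar_operators A = range (\<lambda>r x. if x \<in> carrier A then r *\<^sub>R x else 0)"

definition centroid :: "('a::real_vector, 'm) alg_scheme \<Rightarrow> ('a \<Rightarrow> 'a) alg"
  where "centroid A =
    \<lparr>carrier = {c \<in> operators A. \<forall>x\<in>carrier A. \<forall>y\<in>carrier A.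
        c (x \<star>\<^bsub>A\<^esub> y) = x \<star>\<^bsub>A\<^esub> c y \<and> c (x \<star>\<^bsub>A\<^esub> y) = c x \<star>\<^bsub>A\<^esub> y},
     aprod = (\<circ>)\<rparr>"

definition central_simple :: "('a::real_vector, 'm) alg_scheme \<Rightarrow> bool"
  where "central_simple A \<longleftrightarrow> simple_alg A \<and> carrier (centroid A) = scalar_operators A"


section \<open>Gradings\<close>

text \<open>
  The values of a family of components \<open>\<Gamma>\<close> outside \<open>carrier G\<close> are irrelevant. The directness
  of the decomposition is the uniqueness of the finitely supported family \<open>c\<close>.
\<close>

definition grading ::
    "('g, 'n) monoid_scheme \<Rightarrow> ('a::real_vector, 'm) alg_scheme \<Rightarrow> ('g \<Rightarrow> 'a set) \<Rightarrow> bool"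
  where "grading G A \<Gamma> \<longleftrightarrow>
    (\<forall>g\<in>carrier G. subspace (\<Gamma> g) \<and> \<Gamma> g \<subseteq> carrier A) \<and>
    (\<forall>x\<in>carrier A. \<exists>!c. finite {g. c g \<noteq> 0} \<and> {g. c g \<noteq> 0} \<subseteq> carrier G \<and>
        (\<forall>g\<in>carrier G. c g \<in> \<Gamma> g) \<and> x = (\<Sum>g | c g \<noteq> 0. c g)) \<and>
    (\<forall>g\<in>carrier G. \<forall>h\<in>carrier G. \<forall>x\<in>\<Gamma> g. \<forall>y\<in>\<Gamma> h. x \<star>\<^bsub>A\<^esub> y \<in> \<Gamma> (g \<otimes>\<^bsub>G\<^esub> h))"

definition grading_support :: "('g, 'n) monoid_scheme \<Rightarrow> ('g \<Rightarrow> 'a::real_vector set) \<Rightarrow> 'g set"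
  where "grading_support G \<Gamma> = {g \<in> carrier G. \<Gamma> g \<noteq> {0}}"

definition trivial_grading ::
    "('g, 'n) monoid_scheme \<Rightarrow> ('a::real_vector, 'm) alg_scheme \<Rightarrow> 'g \<Rightarrow> 'a set"
  where "trivial_grading G A g = (if g = \<one>\<^bsub>G\<^esub> then carrier A else {0})"

definition graded_ideal ::
    "('g, 'n) monoid_scheme \<Rightarrow> ('a::real_vector, 'm) alg_scheme \<Rightarrow> ('g \<Rightarrow> 'a set) \<Rightarrow> 'a set \<Rightarrow> bool"
  where "graded_ideal G A \<Gamma> I \<longleftrightarrow> ideal_of A I \<and> I = span (\<Union>g\<in>carrier G. I \<inter> \<Gamma> g)"

definition graded_simple ::
    "('g, 'n) monoid_scheme \<Rightarrow> ('a::real_vector, 'm) alg_scheme \<Rightarrow> ('g \<Rightarrow> 'a set) \<Rightarrow> bool"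
  where "graded_simple G A \<Gamma> \<longleftrightarrow>
    nonzero_product A \<and> (\<forall>I. graded_ideal G A \<Gamma> I \<longrightarrow> I = {0} \<or> I = carrier A)"

definition centroid_comp ::
    "('g, 'n) monoid_scheme \<Rightarrow> ('a::real_vector, 'm) alg_scheme \<Rightarrow> ('g \<Rightarrow> 'a set) \<Rightarrow> 'g \<Rightarrow> ('a \<Rightarrow> 'a) set"
  where "centroid_comp G A \<Gamma> g =
    {c \<in> carrier (centroid A). \<forall>h\<in>carrier G. c ` \<Gamma> h \<subseteq> \<Gamma> (g \<otimes>\<^bsub>G\<^esub> h)}"

definition graded_central ::
    "('g, 'n) monoid_scheme \<Rightarrow> ('a::real_vector, 'm) alg_scheme \<Rightarrow> ('g \<Rightarrow> 'a set) \<Rightarrow> bool"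
  where "graded_central G A \<Gamma> \<longleftrightarrow> centroid_comp G A \<Gamma> \<one>\<^bsub>G\<^esub> = scalar_operators A"

definition graded_isomorphic ::
    "('g, 'n) monoid_scheme \<Rightarrow> ('a::real_vector, 'm) alg_scheme \<Rightarrow> ('g \<Rightarrow> 'a set) \<Rightarrow>
      ('b::real_vector, 'k) alg_scheme \<Rightarrow> ('g \<Rightarrow> 'b set) \<Rightarrow> bool"
  where "graded_isomorphic G A \<Gamma> B \<Delta> \<longleftrightarrow>
    (\<exists>\<phi>. bij_betw \<phi> (carrier A) (carrier B) \<and> lin_on (carrier A) \<phi> \<and>
      (\<forall>x\<in>carrier A. \<forall>y\<in>carrier A. \<phi> (x \<star>\<^bsub>A\<^esub> y) = \<phi> x \<star>\<^bsub>B\<^esub> \<phi> y) \<and>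
      (\<forall>g\<in>carrier G. \<phi> ` \<Gamma> g = \<Delta> g))"


section \<open>Twisted loop algebras\<close>

definition unit_circle :: "complex monoid"
  where "unit_circle = \<lparr>carrier = {z. cmod z = 1}, monoid.mult = (*), one = 1\<rparr>"

definition convolution ::
    "('g, 'n) monoid_scheme \<Rightarrow> ('a \<Rightarrow> 'a \<Rightarrow> 'a) \<Rightarrow> ('g \<Rightarrow> 'a) \<Rightarrow> ('g \<Rightarrow> 'a) \<Rightarrow> 'g \<Rightarrow> 'a::real_vector"
  where "convolution G m x y k =
    (\<Sum>(g, h) \<in> {(g, h). x g \<noteq> 0 \<and> y h \<noteq> 0 \<and> g \<otimes>\<^bsub>G\<^esub> h = k}. m (x g) (y h))"

definition group_algebra :: "('g, 'n) monoid_scheme \<Rightarrow> ('g \<Rightarrow> complex) alg"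
  where "group_algebra G =
    \<lparr>carrier = {v. finite {g. v g \<noteq> 0} \<and> {g. v g \<noteq> 0} \<subseteq> carrier G},
     aprod = convolution G (*)\<rparr>"

definition monomial :: "complex \<Rightarrow> 'g \<Rightarrow> 'g \<Rightarrow> complex"
  where "monomial z g = (\<lambda>h. if h = g then z else 0)"

text \<open>
  The real tensor product of \<open>A\<close> with \<open>\<complex>G\<close>, written with respect to the real basis
  \<open>{g, \<i>g | g \<in> G}\<close> of \<open>\<complex>G\<close>: the finitely supported function \<open>x\<close> with \<open>x g = (a\<^sub>g, b\<^sub>g)\<close> is the
  tensor \<open>\<Sum>\<^sub>g (a\<^sub>g \<otimes> g + b\<^sub>g \<otimes> \<i>g)\<close>, and \<open>pure_tensor a v\<close> is \<open>a \<otimes> v\<close>. The product is the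
  convolution over the complexification of \<open>A\<close>.
\<close>

definition complexified_prod ::
    "('a::real_vector, 'm) alg_scheme \<Rightarrow> 'a \<times> 'a \<Rightarrow> 'a \<times> 'a \<Rightarrow> 'a \<times> 'a"
  where "complexified_prod A p q =
    (fst p \<star>\<^bsub>A\<^esub> fst q - snd p \<star>\<^bsub>A\<^esub> snd q, fst p \<star>\<^bsub>A\<^esub> snd q + snd p \<star>\<^bsub>A\<^esub> fst q)"

definition tensor_group_algebra ::
    "('g, 'n) monoid_scheme \<Rightarrow> ('a::real_vector, 'm) alg_scheme \<Rightarrow> ('g \<Rightarrow> 'a \<times> 'a) alg"
  where "tensor_group_algebra G A =
    \<lparr>carrier = {x. finite {g. x g \<noteq> 0} \<and> {g. x g \<noteq> 0} \<subseteq> carrier G \<and>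
        (\<forall>g. x g \<in> carrier A \<times> carrier A)},
     aprod = convolution G (complexified_prod A)\<rparr>"

definition pure_tensor :: "'a::real_vector \<Rightarrow> ('g \<Rightarrow> complex) \<Rightarrow> 'g \<Rightarrow> 'a \<times> 'a"
  where "pure_tensor a v = (\<lambda>g. (Re (v g) *\<^sub>R a, Im (v g) *\<^sub>R a))"

text \<open>
  The square root of \<open>\<chi> g\<close> in \<open>u\<^sub>g\<close> is chosen to be the principal one. The other choice gives the
  same components, see \<open>loop_comp_root\<close> below.
\<close>

definition loop_unit :: "('g \<Rightarrow> complex) \<Rightarrow> 'g \<Rightarrow> 'g \<Rightarrow> complex"
  where "loop_unit \<chi> g = monomial (csqrt (\<chi> g)) g"

definition loop_comp ::
    "('g \<Rightarrow> 'q) \<Rightarrow> ('g \<Rightarrow> complex) \<Rightarrow> ('q \<Rightarrow> 'a::real_vector set) \<Rightarrow> 'g \<Rightarrow> ('g \<Rightarrow> 'a \<times> 'a) set"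
  where "loop_comp \<pi> \<chi> \<Delta> g = (\<lambda>a. pure_tensor a (loop_unit \<chi> g)) ` \<Delta> (\<pi> g)"

definition loop_algebra ::
    "('g, 'n) monoid_scheme \<Rightarrow> ('g \<Rightarrow> 'q) \<Rightarrow> ('g \<Rightarrow> complex) \<Rightarrow>
      ('a::real_vector, 'm) alg_scheme \<Rightarrow> ('q \<Rightarrow> 'a set) \<Rightarrow> ('g \<Rightarrow> 'a \<times> 'a) alg"
  where "loop_algebra G \<pi> \<chi> A \<Delta> =
    \<lparr>carrier = span (\<Union>g\<in>carrier G. loop_comp \<pi> \<chi> \<Delta> g),
     aprod = aprod (tensor_group_algebra G A)\<rparr>"

lemma loop_comp_root:
  fixes \<Delta> :: "'q \<Rightarrow> 'a::real_vector set"
  assumes "subspace (\<Delta> (\<pi> g))" and "z\<^sup>2 = \<chi> g"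
  shows "loop_comp \<pi> \<chi> \<Delta> g = (\<lambda>a. pure_tensor a (monomial z g)) ` \<Delta> (\<pi> g)"
proof -
  have "z = csqrt (\<chi> g) \<or> z = - csqrt (\<chi> g)"
    using assms(2) by (metis power2_csqrt power2_eq_iff)
  then show ?thesis
  proof
    assume "z = csqrt (\<chi> g)"
    then show ?thesis by (simp add: loop_comp_def loop_unit_def)
  next
    assume z: "z = - csqrt (\<chi> g)"
    have eq: "pure_tensor (- a) (monomial z g) = pure_tensor a (loop_unit \<chi> g)" for a :: 'a
      by (auto simp: z pure_tensor_def monomial_def loop_unit_def fun_eq_iff)
    have "uminus ` \<Delta> (\<pi> g) = \<Delta> (\<pi> g)"
    proof -
      have "- a \<in> \<Delta> (\<pi> g)" if "a \<in> \<Delta> (\<pi> g)" for a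
        using assms(1) that by (rule subspace_neg)
      then show ?thesis by force
    qed
    then have "(\<lambda>a. pure_tensor a (monomial z g)) ` \<Delta> (\<pi> g)
        = (\<lambda>a. pure_tensor a (monomial z g)) ` uminus ` \<Delta> (\<pi> g)"
      by simp
    then show ?thesis by (simp add: loop_comp_def image_image eq)
  qed
qed

lemma (in real_algebra) prod_zero:
  assumes "x \<in> carrier A"
  shows "x \<star> 0 = 0" and "0 \<star> x = 0"
  using prod_scale_right[of x x 0] prod_scale_left[of x x 0] assms by simp_all

lemma (in real_algebra) pure_tensor_prod:
  assumes a: "a \<in> carrier A" and b: "b \<in> carrier A"
    and v: "v \<in> carrier (group_algebra G)" and w: "w \<in> carrier (group_algebra G)"
  shows "pure_tensor a v \<star>\<^bsub>tensor_group_algebra G A\<^esub> pure_tensor b w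
    = pure_tensor (a \<star> b) (v \<star>\<^bsub>group_algebra G\<^esub> w)"
proof
  fix k
  let ?S = "{(g, h). v g \<noteq> 0 \<and> w h \<noteq> 0 \<and> g \<otimes>\<^bsub>G\<^esub> h = k}"
  let ?T = "{(g, h). pure_tensor a v g \<noteq> 0 \<and> pure_tensor b w h \<noteq> 0 \<and> g \<otimes>\<^bsub>G\<^esub> h = k}"
  have fin: "finite ?S"
    by (rule finite_subset[of _ "{g. v g \<noteq> 0} \<times> {g. w g \<noteq> 0}"])
      (use v w in \<open>auto simp: group_algebra_def\<close>)
  have sub: "?T \<subseteq> ?S"
    by (auto simp: pure_tensor_def prod_eq_iff)
  have mem: "r *\<^sub>R a \<in> carrier A" "r *\<^sub>R b \<in> carrier A" "0 \<in> carrier A" for r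
    using a b subspace_carrier by (auto simp: subspace_scale subspace_0)
  have prod_eq: "complexified_prod A (pure_tensor a v g) (pure_tensor b w h)
      = (Re (v g * w h) *\<^sub>R (a \<star> b), Im (v g * w h) *\<^sub>R (a \<star> b))" for g h
    using a b mem
    by (simp add: complexified_prod_def pure_tensor_def prod_scale_left prod_scale_right
        scaleR_diff_left scaleR_add_left mult.commute)
  have "(pure_tensor a v \<star>\<^bsub>tensor_group_algebra G A\<^esub> pure_tensor b w) k
      = (\<Sum>(g, h)\<in>?T. complexified_prod A (pure_tensor a v g) (pure_tensor b w h))"
    by (simp add: tensor_group_algebra_def convolution_def)
  also have "\<dots> = (\<Sum>(g, h)\<in>?S. complexified_prod A (pure_tensor a v g) (pure_tensor b w h))"
  proof (rule sum.mono_neutral_left[OF fin sub], rule ballI)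
    fix p
    assume "p \<in> ?S - ?T"
    moreover obtain g h where p: "p = (g, h)" by (cases p)
    ultimately have zero: "pure_tensor a v g = 0 \<or> pure_tensor b w h = 0" by auto
    have "fst (pure_tensor a v g) \<in> carrier A" "snd (pure_tensor a v g) \<in> carrier A"
      "fst (pure_tensor b w h) \<in> carrier A" "snd (pure_tensor b w h) \<in> carrier A"
      using mem by (auto simp: pure_tensor_def)
    with zero have "complexified_prod A (pure_tensor a v g) (pure_tensor b w h) = 0"
      by (elim disjE) (simp_all add: complexified_prod_def prod_zero zero_prod_def)
    then show "(case p of (g, h) \<Rightarrow>
        complexified_prod A (pure_tensor a v g) (pure_tensor b w h)) = 0"
      by (simp add: p)
  qed
  also have "\<dots> = (\<Sum>(g, h)\<in>?S. (Re (v g * w h) *\<^sub>R (a \<star> b), Im (v g * w h) *\<^sub>R (a \<star> b)))"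
    by (simp only: prod_eq)
  also have "\<dots> = pure_tensor (a \<star> b) (v \<star>\<^bsub>group_algebra G\<^esub> w) k"
    by (simp add: pure_tensor_def group_algebra_def convolution_def prod_eq_iff
        fst_sum snd_sum Re_sum Im_sum scaleR_sum_left case_prod_beta del: times_complex.sel)
  finally show "(pure_tensor a v \<star>\<^bsub>tensor_group_algebra G A\<^esub> pure_tensor b w) k
      = pure_tensor (a \<star> b) (v \<star>\<^bsub>group_algebra G\<^esub> w) k" .
qed

end

theory Submission
  imports Defs
begin

text \<open>
  If \<open>c\<^sub>h\<close> (\<open>h \<in> H\<close>) are nonzero elements of the centroid of degree \<open>h\<close> that multiply like the
  \<open>u\<^sub>h\<close>, then \<open>A\<close> is the specialisation of \<open>B\<close> in which every \<open>c\<^sub>h\<close> acts as \<open>u\<^sub>h\<close>. Twisting the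
  product of \<open>B\<close> by the signs \<open>z\<^sub>g z\<^sub>h / z\<^sub>g\<^sub>h\<close> reduces to the case of trivial \<open>\<chi>\<close>, where the
  (twisted) \<open>c\<^sub>h\<close> form a group of operators, and \<open>A\<close> is the algebra of coinvariants. Graded ideals
  and homogeneous centroid elements of \<open>A\<close> lift to \<open>B\<close>, so \<open>A\<close> is graded-simple with
  scalar centroid. An ideal of \<open>A\<close> then contains everything, because an element of minimal
  support in it defines an element of the centroid. A suitable \<open>\<chi>\<close> exists because \<open>\<complex>\<^sup>\<times>\<close>
  is divisible: the identity character of the real scalars extends to all homogeneous units of the
  centroid.
\<close>

section \<open>Homogeneous components\<close>

text \<open>The obstacle is that the reals lack roots: a central operator of degree \<open>h\<close>
  may square to a negative scalar, so the centroid need not map onto the reals and \<open>B\<close>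
  cannot simply be specialised at a real point. The phases in \<open>u\<^sub>h\<close> absorb this
  up to sign: as \<chi> is multiplicative, \<open>z\<^sub>g z\<^sub>h / z\<^sub>g\<^sub>h\<close>
  squares to 1. The signs form a symmetric cocycle, a coboundary over the complex numbers but in
  general not over the reals. Twisting by it changes homogeneous products by nonzero factors only,
  so graded ideals survive; a central operator of degree \<open>k\<close> survives once it gets the
  sign of \<open>(k, g)\<close> on degree \<open>g\<close>. The same sign returns when
  \<open>u\<^sub>g\<close> and \<open>u\<^sub>h\<close> are multiplied, so the two cancel in the
  final isomorphism. The quotient is modelled inside \<open>B\<close>, on one component per coset of
  \<open>H\<close>, which keeps the type of \<open>B\<close> and makes the quotient map bijective on
  each component. For the existence of \<chi>, divisibility is used twice: on the units of the
  centroid and to extend a character from \<open>H\<close> to \<open>G\<close>. A square stands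
  between, because a unit is determined by its degree only up to a real factor.\<close>

lemma lin_on_add: "lin_on V f \<Longrightarrow> x \<in> V \<Longrightarrow> y \<in> V \<Longrightarrow> f (x + y) = f x + f y"
  and lin_on_scale: "lin_on V f \<Longrightarrow> x \<in> V \<Longrightarrow> f (r *\<^sub>R x) = r *\<^sub>R f x"
  by (auto simp: lin_on_def)

lemma lin_on_zero: "lin_on V f \<Longrightarrow> subspace V \<Longrightarrow> f 0 = 0"
  using lin_on_scale[of V f 0 0] by (simp add: subspace_0)

lemma lin_on_diff:
  assumes "lin_on V f" "subspace V" "x \<in> V" "y \<in> V"
  shows "f (x - y) = f x - f y"
proof -
  have "(-1) *\<^sub>R y \<in> V" using assms subspace_scale by blast
  then have "f (x + (-1) *\<^sub>R y) = f x + (-1) *\<^sub>R f y"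
    by (simp only: lin_on_add[OF assms(1,3)] lin_on_scale[OF assms(1,4)])
  then show ?thesis by simp
qed

lemma lin_on_sum:
  assumes "lin_on V f" "subspace V" "finite S" "\<And>i. i \<in> S \<Longrightarrow> x i \<in> V"
  shows "f (\<Sum>i\<in>S. x i) = (\<Sum>i\<in>S. f (x i))"
  using assms(3,4)
  by (induction S) (auto simp: lin_on_zero[OF assms(1,2)] lin_on_add[OF assms(1)] subspace_sum[OF assms(2)])

lemma lin_on_subset: "lin_on V f \<Longrightarrow> W \<subseteq> V \<Longrightarrow> lin_on W f"
  unfolding lin_on_def by blast

lemma lin_on_comp: "lin_on V f \<Longrightarrow> lin_on W g \<Longrightarrow> f ` V \<subseteq> W \<Longrightarrow> lin_on V (\<lambda>x. g (f x))"
  by (auto simp: lin_on_def image_subset_iff)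

lemma lin_on_scaled: "lin_on V f \<Longrightarrow> lin_on V (\<lambda>x. r *\<^sub>R f x)"
  by (auto simp: lin_on_def scaleR_add_right)

lemma subspace_lin_image:
  assumes "lin_on V f" "subspace V"
  shows "subspace (f ` V)"
proof (rule subspaceI)
  show "0 \<in> f ` V" using lin_on_zero[OF assms] assms(2) by (metis image_eqI subspace_0)
qed (use assms in \<open>auto simp: lin_on_def subspace_def image_iff\<close>, metis+)

locale graded_real_algebra = real_algebra A + comm_group G
  for A :: "('a::real_vector, 'm) alg_scheme" and G :: "('g, 'n) monoid_scheme" (structure)
    and \<Gamma> :: "'g \<Rightarrow> 'a set" +
  assumes grading: "grading G A \<Gamma>"
begin

abbreviation amul (infixl \<open>\<cdot>\<close> 70) where "x \<cdot> y \<equiv> x \<star>\<^bsub>A\<^esub> y"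

lemma subspace_comp: "g \<in> carrier G \<Longrightarrow> subspace (\<Gamma> g)"
  and comp_subset: "g \<in> carrier G \<Longrightarrow> \<Gamma> g \<subseteq> carrier A"
  and comp_mult: "g \<in> carrier G \<Longrightarrow> h \<in> carrier G \<Longrightarrow> x \<in> \<Gamma> g \<Longrightarrow> y \<in> \<Gamma> h \<Longrightarrow> x \<cdot> y \<in> \<Gamma> (g \<otimes> h)"
  using grading by (auto simp: grading_def)

lemma comp_closed: "g \<in> carrier G \<Longrightarrow> x \<in> \<Gamma> g \<Longrightarrow> x \<in> carrier A"
  using comp_subset by blast

text \<open>The projection to degree \<open>g\<close>. The value 0 outside the carrier makes
  \<open>finite_hcomp\<close>, \<open>hcomp_in\<close> and \<open>hcomp_closed\<close> hold for
  every argument.\<close>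

definition hcomp :: "'g \<Rightarrow> 'a \<Rightarrow> 'a" where
  "hcomp g x = (if x \<in> carrier A then
     (THE c. finite {g. c g \<noteq> 0} \<and> {g. c g \<noteq> 0} \<subseteq> carrier G \<and>
        (\<forall>g\<in>carrier G. c g \<in> \<Gamma> g) \<and> x = (\<Sum>g | c g \<noteq> 0. c g)) g else 0)"

lemma hcomp_family:
  assumes "x \<in> carrier A"
  shows "finite {g. hcomp g x \<noteq> 0} \<and> {g. hcomp g x \<noteq> 0} \<subseteq> carrier G \<and>
        (\<forall>g\<in>carrier G. hcomp g x \<in> \<Gamma> g) \<and> x = (\<Sum>g | hcomp g x \<noteq> 0. hcomp g x)"
proof -
  have "\<exists>!c. finite {g. c g \<noteq> 0} \<and> {g. c g \<noteq> 0} \<subseteq> carrier G \<and>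
        (\<forall>g\<in>carrier G. c g \<in> \<Gamma> g) \<and> x = (\<Sum>g | c g \<noteq> 0. c g)"
    using assms grading by (auto simp: grading_def)
  from theI'[OF this] assms show ?thesis by (simp add: hcomp_def)
qed

lemma hcomp_unique:
  assumes "x \<in> carrier A" "finite S" "S \<subseteq> carrier G" "\<And>g. g \<in> S \<Longrightarrow> c g \<in> \<Gamma> g" "x = (\<Sum>g\<in>S. c g)"
  shows "hcomp g x = (if g \<in> S then c g else 0)"
proof -
  let ?P = "\<lambda>c. finite {g. c g \<noteq> 0} \<and> {g. c g \<noteq> 0} \<subseteq> carrier G \<and>
        (\<forall>g\<in>carrier G. c g \<in> \<Gamma> g) \<and> x = (\<Sum>g | c g \<noteq> 0. c g)"
  let ?c = "\<lambda>g. if g \<in> S then c g else 0"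
  have ex: "\<exists>!c. ?P c" using assms grading by (auto simp: grading_def)
  have sub: "{g. ?c g \<noteq> 0} \<subseteq> S" by auto
  have "(\<Sum>g | ?c g \<noteq> 0. ?c g) = (\<Sum>g\<in>S. ?c g)"
    by (rule sum.mono_neutral_left) (use assms(2) in auto)
  then have P: "?P ?c" using assms sub finite_subset[OF sub] subspace_0[OF subspace_comp] by auto
  have "(THE c. ?P c) = ?c" by (rule the1_equality[of ?P ?c, OF ex P])
  then show ?thesis unfolding hcomp_def by (simp only: assms(1) if_True)
qed

lemma finite_hcomp: "finite {g. hcomp g x \<noteq> 0}"
  by (cases "x \<in> carrier A") (use hcomp_family in blast, simp add: hcomp_def)

lemma hcomp_outside: "g \<notin> carrier G \<Longrightarrow> hcomp g x = 0"
  using hcomp_family[of x] by (cases "x \<in> carrier A") (auto simp: hcomp_def)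

lemma hcomp_in: "g \<in> carrier G \<Longrightarrow> hcomp g x \<in> \<Gamma> g"
  using hcomp_family[of x] subspace_0[OF subspace_comp]
  by (cases "x \<in> carrier A") (auto simp: hcomp_def)

lemma hcomp_closed: "hcomp g x \<in> carrier A"
  by (cases "g \<in> carrier G") (auto simp: hcomp_outside subspace_0[OF subspace_carrier] intro: comp_closed hcomp_in)

lemma sum_hcomp: "x \<in> carrier A \<Longrightarrow> (\<Sum>g | hcomp g x \<noteq> 0. hcomp g x) = x"
  using hcomp_family[of x] by simp

lemma sum_hcomp_superset:
  assumes "x \<in> carrier A" "finite S" "{g. hcomp g x \<noteq> 0} \<subseteq> S"
  shows "(\<Sum>g\<in>S. hcomp g x) = x"
  using sum.mono_neutral_left[OF assms(2,3), of "\<lambda>g. hcomp g x"] sum_hcomp[OF assms(1)] by auto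

lemma hcomp_homogeneous:
  assumes "g \<in> carrier G" "x \<in> \<Gamma> g"
  shows "hcomp h x = (if h = g then x else 0)"
  using hcomp_unique[of x "{g}" "\<lambda>_. x" h] assms comp_closed by auto

lemma hcomp_add:
  assumes "x \<in> carrier A" "y \<in> carrier A"
  shows "hcomp g (x + y) = hcomp g x + hcomp g y"
proof -
  let ?S = "{g. hcomp g x \<noteq> 0} \<union> {g. hcomp g y \<noteq> 0}"
  have f: "finite ?S" by (simp add: finite_hcomp)
  have G: "?S \<subseteq> carrier G" using hcomp_outside by auto
  have "hcomp g (x + y) = (if g \<in> ?S then hcomp g x + hcomp g y else 0)"
    by (rule hcomp_unique[OF _ f G])
      (use assms G in \<open>auto simp: sum.distrib sum_hcomp_superset[OF _ f] intro!: subspace_add subspace_carrier subspace_comp hcomp_in\<close>)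
  then show ?thesis by auto
qed

lemma hcomp_scale:
  assumes "x \<in> carrier A"
  shows "hcomp g (r *\<^sub>R x) = r *\<^sub>R hcomp g x"
proof -
  have "hcomp g (r *\<^sub>R x) = (if g \<in> {g. hcomp g x \<noteq> 0} then r *\<^sub>R hcomp g x else 0)"
    by (rule hcomp_unique[OF _ finite_hcomp])
      (use assms hcomp_outside in \<open>auto simp: scaleR_sum_right[symmetric] sum_hcomp intro!: subspace_scale subspace_carrier subspace_comp hcomp_in\<close>)
  then show ?thesis by auto
qed

lemma lin_on_hcomp: "lin_on (carrier A) (hcomp g)"
  by (simp add: lin_on_def hcomp_add hcomp_scale)

lemma hcomp_zero: "hcomp g 0 = 0"
  using lin_on_zero[OF lin_on_hcomp subspace_carrier] .

text \<open>Zero and scalars get no case of their own: zero lies in the component of degree \<one>,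
  and each component is already closed under scaling.\<close>

lemma homogeneous_induct [consumes 1, case_names homogeneous add]:
  assumes "x \<in> carrier A"
    and hom: "\<And>g x. g \<in> carrier G \<Longrightarrow> x \<in> \<Gamma> g \<Longrightarrow> P x"
    and add: "\<And>x y. x \<in> carrier A \<Longrightarrow> y \<in> carrier A \<Longrightarrow> P x \<Longrightarrow> P y \<Longrightarrow> P (x + y)"
  shows "P x"
proof -
  have "P (\<Sum>g\<in>S. hcomp g x) \<and> (\<Sum>g\<in>S. hcomp g x) \<in> carrier A"
    if "finite S" "S \<subseteq> carrier G" for S
    using that
  proof (induction S)
    case empty
    show ?case
      using hom[OF one_closed subspace_0[OF subspace_comp[OF one_closed]]] subspace_0[OF subspace_carrier]
      by simp
  next
    case (insert g S)
    then show ?case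
      using add[OF hcomp_closed] hom[OF _ hcomp_in] hcomp_closed
      by (simp add: subspace_add[OF subspace_carrier])
  qed
  from this[OF finite_hcomp[of x]] hcomp_outside sum_hcomp[OF assms(1)] show ?thesis by auto
qed

lemma hcomp_ext:
  assumes "x \<in> carrier A" "y \<in> carrier A" "\<And>g. g \<in> carrier G \<Longrightarrow> hcomp g x = hcomp g y"
  shows "x = y"
proof -
  have eq: "hcomp g x = hcomp g y" for g using assms(3) hcomp_outside by (cases "g \<in> carrier G") auto
  show ?thesis using sum_hcomp[OF assms(1), unfolded eq] sum_hcomp[OF assms(2)] by (rule trans[OF sym])
qed

text \<open>Translation of degrees by \<open>h\<close> is injective, so no other component of
  \<open>x\<close> can reach degree \<open>h \<otimes> g\<close>.\<close>

lemma hcomp_mult_left: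
  assumes "a \<in> \<Gamma> h" "h \<in> carrier G" "g \<in> carrier G" "x \<in> carrier A"
  shows "hcomp (h \<otimes> g) (a \<cdot> x) = a \<cdot> hcomp g x"
  using assms(4)
proof (induction x rule: homogeneous_induct)
  case (homogeneous k x)
  have a: "a \<in> carrier A" using assms comp_closed by blast
  have "hcomp (h \<otimes> g) (a \<cdot> x) = (if h \<otimes> g = h \<otimes> k then a \<cdot> x else 0)"
    using assms homogeneous by (intro hcomp_homogeneous comp_mult) auto
  moreover have "h \<otimes> g = h \<otimes> k \<longleftrightarrow> g = k" using assms homogeneous by simp
  ultimately show ?case by (simp add: hcomp_homogeneous[OF homogeneous] prod_zero[OF a])
next
  case (add x y)
  then show ?case using assms comp_closed[of h a]
    by (simp add: prod_add_right hcomp_add prod_closed hcomp_closed)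
qed

lemma hcomp_mult_right:
  assumes "a \<in> \<Gamma> h" "h \<in> carrier G" "g \<in> carrier G" "x \<in> carrier A"
  shows "hcomp (h \<otimes> g) (x \<cdot> a) = hcomp g x \<cdot> a"
  using assms(4)
proof (induction x rule: homogeneous_induct)
  case (homogeneous k x)
  have a: "a \<in> carrier A" using assms comp_closed by blast
  have "hcomp (h \<otimes> g) (x \<cdot> a) = (if h \<otimes> g = k \<otimes> h then x \<cdot> a else 0)"
    using assms homogeneous by (intro hcomp_homogeneous comp_mult) auto
  moreover have "h \<otimes> g = k \<otimes> h \<longleftrightarrow> g = k" using assms homogeneous by (simp add: m_comm[of k h])
  ultimately show ?case by (simp add: hcomp_homogeneous[OF homogeneous] prod_zero[OF a])
next
  case (add x y)
  then show ?case using assms comp_closed[of h a]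
    by (simp add: prod_add_left hcomp_add prod_closed hcomp_closed)
qed

text \<open>The value outside the carrier is \<open>0\<close>, as for \<^const>\<open>operators\<close>.\<close>

definition lin_ext :: "('g \<Rightarrow> 'a \<Rightarrow> 'c::real_vector) \<Rightarrow> 'a \<Rightarrow> 'c" where
  "lin_ext F x = (\<Sum>g | hcomp g x \<noteq> 0. F g (hcomp g x))"

lemma lin_ext_superset:
  assumes "\<And>g. g \<in> carrier G \<Longrightarrow> lin_on (\<Gamma> g) (F g)" "finite S" "{g. hcomp g x \<noteq> 0} \<subseteq> S" "S \<subseteq> carrier G"
  shows "lin_ext F x = (\<Sum>g\<in>S. F g (hcomp g x))"
  unfolding lin_ext_def
  by (rule sum.mono_neutral_left[OF assms(2,3)])
    (use assms lin_on_zero[OF assms(1) subspace_comp] in auto)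

lemma lin_ext_homogeneous:
  assumes "\<And>g. g \<in> carrier G \<Longrightarrow> lin_on (\<Gamma> g) (F g)" "g \<in> carrier G" "x \<in> \<Gamma> g"
  shows "lin_ext F x = F g x"
proof -
  have "{h. hcomp h x \<noteq> 0} \<subseteq> {g}" by (auto simp: hcomp_homogeneous[OF assms(2,3)])
  with lin_ext_superset[OF assms(1), where S="{g}" and x=x] assms(2)
  show ?thesis by (simp add: hcomp_homogeneous[OF assms(2,3)])
qed

lemma lin_on_lin_ext:
  assumes "\<And>g. g \<in> carrier G \<Longrightarrow> lin_on (\<Gamma> g) (F g)"
  shows "lin_on (carrier A) (lin_ext F)"
proof -
  have "lin_ext F (x + y) = lin_ext F x + lin_ext F y" if "x \<in> carrier A" "y \<in> carrier A" for x y
  proof -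
    let ?S = "{g. hcomp g x \<noteq> 0} \<union> {g. hcomp g y \<noteq> 0}"
    have f: "finite ?S" by (simp add: finite_hcomp)
    have G: "?S \<subseteq> carrier G" using hcomp_outside by auto
    have *: "lin_ext F z = (\<Sum>g\<in>?S. F g (hcomp g z))" if "{g. hcomp g z \<noteq> 0} \<subseteq> ?S" for z
      using lin_ext_superset[OF assms f that G] .
    have "lin_ext F (x + y) = (\<Sum>g\<in>?S. F g (hcomp g x) + F g (hcomp g y))"
      using G that by (subst *) (auto simp: hcomp_add intro!: sum.cong lin_on_add[OF assms] hcomp_in)
    also have "\<dots> = lin_ext F x + lin_ext F y"
      by (simp add: sum.distrib *)
    finally show ?thesis .
  qed
  moreover have "lin_ext F (r *\<^sub>R x) = r *\<^sub>R lin_ext F x" if "x \<in> carrier A" for r x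
  proof -
    let ?S = "{g. hcomp g x \<noteq> 0}"
    have G: "?S \<subseteq> carrier G" using hcomp_outside by auto
    have *: "lin_ext F z = (\<Sum>g\<in>?S. F g (hcomp g z))" if "{g. hcomp g z \<noteq> 0} \<subseteq> ?S" for z
      using lin_ext_superset[OF assms finite_hcomp that G] .
    show ?thesis using G that
      by (subst (1 2) *) (auto simp: hcomp_scale scaleR_sum_right intro!: sum.cong lin_on_scale[OF assms] hcomp_in)
  qed
  ultimately show ?thesis by (simp add: lin_on_def)
qed

lemma lin_ext_outside: "x \<notin> carrier A \<Longrightarrow> lin_ext F x = 0"
  by (simp add: lin_ext_def hcomp_def)

lemma lin_ext_in:
  assumes "subspace V" "\<And>g x. g \<in> carrier G \<Longrightarrow> x \<in> \<Gamma> g \<Longrightarrow> F g x \<in> V"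
  shows "lin_ext F x \<in> V"
  unfolding lin_ext_def
  by (rule subspace_sum[OF assms(1)]) (use assms(2) hcomp_in hcomp_outside in blast)

lemma lin_on_eq:
  assumes "lin_on (carrier A) f" "lin_on (carrier A) f'" "x \<in> carrier A"
    "\<And>g x. g \<in> carrier G \<Longrightarrow> x \<in> \<Gamma> g \<Longrightarrow> f x = f' x"
  shows "f x = f' x"
  using assms(3)
  by (induction x rule: homogeneous_induct) (use assms in \<open>auto simp: lin_on_add\<close>)

lemma lin_on_mult_left: "a \<in> carrier A \<Longrightarrow> lin_on (carrier A) (\<lambda>x. a \<cdot> x)"
  and lin_on_mult_right: "a \<in> carrier A \<Longrightarrow> lin_on (carrier A) (\<lambda>x. x \<cdot> a)"
  by (simp_all add: lin_on_def prod_add_left prod_add_right prod_scale_left prod_scale_right)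

section \<open>Central operators and graded ideals, tested on homogeneous elements\<close>

lemma centroidI:
  assumes c: "c \<in> operators A"
    and l: "\<And>g h x y. g \<in> carrier G \<Longrightarrow> h \<in> carrier G \<Longrightarrow> x \<in> \<Gamma> g \<Longrightarrow> y \<in> \<Gamma> h \<Longrightarrow> c (x \<cdot> y) = x \<cdot> c y"
    and r: "\<And>g h x y. g \<in> carrier G \<Longrightarrow> h \<in> carrier G \<Longrightarrow> x \<in> \<Gamma> g \<Longrightarrow> y \<in> \<Gamma> h \<Longrightarrow> c (x \<cdot> y) = c x \<cdot> y"
  shows "c \<in> carrier (centroid A)"
proof -
  have lin: "lin_on (carrier A) c" and cl: "c \<in> carrier A \<rightarrow> carrier A"
    using c by (auto simp: operators_def)
  have *: "c (x \<cdot> y) = x \<cdot> c y \<and> c (x \<cdot> y) = c x \<cdot> y" if x: "x \<in> carrier A" and y: "y \<in> carrier A" for x y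
    using x
  proof (induction x rule: homogeneous_induct)
    case (homogeneous g x)
    show ?case using y
    proof (induction y rule: homogeneous_induct)
      case (homogeneous h y)
      then show ?case using l r \<open>g \<in> carrier G\<close> \<open>x \<in> \<Gamma> g\<close> by blast
    next
      case (add y z)
      have x: "x \<in> carrier A" using homogeneous comp_closed by blast
      have "c (x \<cdot> (y + z)) = c (x \<cdot> y) + c (x \<cdot> z)" "x \<cdot> c (y + z) = x \<cdot> c y + x \<cdot> c z"
        "c x \<cdot> (y + z) = c x \<cdot> y + c x \<cdot> z"
        using x add(1,2) cl by (simp_all add: prod_add_right lin_on_add[OF lin] prod_closed Pi_iff)
      then show ?case using add(3,4) by metis
    qed
  next
    case (add x z)
    have "c ((x + z) \<cdot> y) = c (x \<cdot> y) + c (z \<cdot> y)" "(x + z) \<cdot> c y = x \<cdot> c y + z \<cdot> c y"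
      "c (x + z) \<cdot> y = c x \<cdot> y + c z \<cdot> y"
      using y add(1,2) cl by (simp_all add: prod_add_left lin_on_add[OF lin] prod_closed Pi_iff)
    then show ?case using add(3,4) by metis
  qed
  then have "\<forall>x\<in>carrier A. \<forall>y\<in>carrier A. c (x \<cdot> y) = x \<cdot> c y \<and> c (x \<cdot> y) = c x \<cdot> y" by blast
  with c show ?thesis by (simp only: centroid_def partial_object.select_convs mem_Collect_eq simp_thms)
qed

lemma centroid_compI:
  assumes "k \<in> carrier G" "lin_on (carrier A) c" "\<And>x. x \<notin> carrier A \<Longrightarrow> c x = 0"
    and deg: "\<And>g x. g \<in> carrier G \<Longrightarrow> x \<in> \<Gamma> g \<Longrightarrow> c x \<in> \<Gamma> (k \<otimes> g)"
    and "\<And>g h x y. g \<in> carrier G \<Longrightarrow> h \<in> carrier G \<Longrightarrow> x \<in> \<Gamma> g \<Longrightarrow> y \<in> \<Gamma> h \<Longrightarrow> c (x \<cdot> y) = x \<cdot> c y"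
    and "\<And>g h x y. g \<in> carrier G \<Longrightarrow> h \<in> carrier G \<Longrightarrow> x \<in> \<Gamma> g \<Longrightarrow> y \<in> \<Gamma> h \<Longrightarrow> c (x \<cdot> y) = c x \<cdot> y"
  shows "c \<in> centroid_comp G A \<Gamma> k"
proof -
  have "c x \<in> carrier A" if "x \<in> carrier A" for x
    using that
  proof (induction x rule: homogeneous_induct)
    case (homogeneous g x)
    then show ?case using deg comp_closed[of "k \<otimes> g"] assms(1) by auto
  next
    case (add x y)
    then show ?case by (simp add: lin_on_add[OF assms(2)] subspace_add[OF subspace_carrier])
  qed
  then have "c \<in> operators A" using assms(2,3) by (auto simp: operators_def)
  then have "c \<in> carrier (centroid A)" using assms(5,6) by (rule centroidI)
  then show ?thesis using deg by (auto simp: centroid_comp_def)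
qed

lemma centroidD:
  assumes "c \<in> carrier (centroid A)"
  shows "lin_on (carrier A) c" "x \<in> carrier A \<Longrightarrow> c x \<in> carrier A" "x \<notin> carrier A \<Longrightarrow> c x = 0"
    "x \<in> carrier A \<Longrightarrow> y \<in> carrier A \<Longrightarrow> c (x \<cdot> y) = x \<cdot> c y"
    "x \<in> carrier A \<Longrightarrow> y \<in> carrier A \<Longrightarrow> c (x \<cdot> y) = c x \<cdot> y"
  using assms unfolding centroid_def operators_def by fastforce+

lemma centroid_compD:
  assumes "c \<in> centroid_comp G A \<Gamma> k"
  shows "c \<in> carrier (centroid A)" "g \<in> carrier G \<Longrightarrow> x \<in> \<Gamma> g \<Longrightarrow> c x \<in> \<Gamma> (k \<otimes> g)"
  using assms by (auto simp: centroid_comp_def)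

text \<open>Closure under \<open>hcomp\<close> stands in for the spanning condition of
  \<open>graded_ideal\<close>; together with bilinearity it reduces the ideal property to
  homogeneous pairs. The converse for \<open>hcomp\<close> is
  \<open>graded_ideal_hcomp\<close>.\<close>

lemma graded_idealI:
  assumes I: "subspace I" "I \<subseteq> carrier A"
    and hc: "\<And>g x. g \<in> carrier G \<Longrightarrow> x \<in> I \<Longrightarrow> hcomp g x \<in> I"
    and l: "\<And>g h a x. g \<in> carrier G \<Longrightarrow> h \<in> carrier G \<Longrightarrow> a \<in> \<Gamma> g \<Longrightarrow> x \<in> \<Gamma> h \<Longrightarrow> x \<in> I \<Longrightarrow> a \<cdot> x \<in> I"
    and r: "\<And>g h a x. g \<in> carrier G \<Longrightarrow> h \<in> carrier G \<Longrightarrow> a \<in> \<Gamma> g \<Longrightarrow> x \<in> \<Gamma> h \<Longrightarrow> x \<in> I \<Longrightarrow> x \<cdot> a \<in> I"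
  shows "graded_ideal G A \<Gamma> I"
proof -
  have decomp: "x = (\<Sum>g | hcomp g x \<noteq> 0. hcomp g x)" if "x \<in> I" for x
    using sum_hcomp[of x] that I by auto
  have hcm: "\<And>g x. x \<in> I \<Longrightarrow> hcomp g x \<in> I" 
    using hc hcomp_outside subspace_0[OF I(1)] by metis
  have *: "a \<cdot> x \<in> I \<and> x \<cdot> a \<in> I" if "a \<in> carrier A" "x \<in> I" for a x
    using that(1)
  proof (induction a rule: homogeneous_induct)
    case (homogeneous g a)
    have a: "a \<in> carrier A" using homogeneous comp_closed by blast
    have "a \<cdot> x = (\<Sum>g | hcomp g x \<noteq> 0. a \<cdot> hcomp g x)"
      by (subst decomp[OF that(2)]) (rule lin_on_sum[OF lin_on_mult_left[OF a] subspace_carrier finite_hcomp hcomp_closed])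
    moreover have "x \<cdot> a = (\<Sum>g | hcomp g x \<noteq> 0. hcomp g x \<cdot> a)"
      by (subst decomp[OF that(2)]) (rule lin_on_sum[OF lin_on_mult_right[OF a] subspace_carrier finite_hcomp hcomp_closed])
    moreover have "a \<cdot> hcomp h x \<in> I" "hcomp h x \<cdot> a \<in> I" if "hcomp h x \<noteq> 0" for h
    proof -
      have h: "h \<in> carrier G" using hcomp_outside that by blast
      show "a \<cdot> hcomp h x \<in> I" "hcomp h x \<cdot> a \<in> I"
        using l[OF homogeneous(1) h homogeneous(2) hcomp_in[OF h] hcm[OF \<open>x \<in> I\<close>]]
          r[OF homogeneous(1) h homogeneous(2) hcomp_in[OF h] hcm[OF \<open>x \<in> I\<close>]] by auto
    qed
    ultimately show ?case using subspace_sum[OF I(1), of "{g. hcomp g x \<noteq> 0}"] by auto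
  next
    case (add a b)
    then show ?case using that I
      by (simp add: prod_add_left prod_add_right subset_eq subspace_add)
  qed
  have "I \<subseteq> span (\<Union>g\<in>carrier G. I \<inter> \<Gamma> g)"
  proof
    fix x assume x: "x \<in> I"
    have "hcomp g x \<in> span (\<Union>g\<in>carrier G. I \<inter> \<Gamma> g)" if "hcomp g x \<noteq> 0" for g
      using that hcomp_outside[of g x] hcm[OF x, of g] hcomp_in[of g x] by (intro span_base) blast
    then show "x \<in> span (\<Union>g\<in>carrier G. I \<inter> \<Gamma> g)"
      by (subst decomp[OF x]) (intro span_sum, auto)
  qed
  moreover have "span (\<Union>g\<in>carrier G. I \<inter> \<Gamma> g) \<subseteq> I"
    by (rule span_minimal[OF _ I(1)]) auto
  ultimately show ?thesis using I * by (auto simp: graded_ideal_def ideal_of_def)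
qed

lemma graded_ideal_hcomp:
  assumes "graded_ideal G A \<Gamma> I" "x \<in> I"
  shows "hcomp g x \<in> I"
proof -
  have I: "subspace I" "I \<subseteq> carrier A" and s: "I = span (\<Union>g\<in>carrier G. I \<inter> \<Gamma> g)"
    using assms(1) by (auto simp: graded_ideal_def ideal_of_def)
  have "x \<in> span (\<Union>g\<in>carrier G. I \<inter> \<Gamma> g)" using s assms(2) by simp
  then have "x \<in> I \<and> (\<forall>g. hcomp g x \<in> I)"
  proof (induction rule: span_induct_alt)
    case base
    then show ?case by (simp add: hcomp_zero subspace_0[OF I(1)])
  next
    case (step c x y)
    then obtain k where k: "k \<in> carrier G" "x \<in> I" "x \<in> \<Gamma> k" by auto
    then have "hcomp g x \<in> I" for g by (simp add: hcomp_homogeneous subspace_0[OF I(1)])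
    then show ?case using step I k
      by (simp add: subset_eq hcomp_add hcomp_scale subspace_add subspace_scale subspace_scale[OF subspace_carrier])
  qed
  then show ?thesis by simp
qed

end

section \<open>From graded-simple to simple\<close>

context graded_real_algebra
begin

lemma lin_ext_centroid_comp:
  assumes k: "k \<in> carrier G"
    and lin: "\<And>g. g \<in> carrier G \<Longrightarrow> lin_on (\<Gamma> g) (F g)"
    and deg: "\<And>g x. g \<in> carrier G \<Longrightarrow> x \<in> \<Gamma> g \<Longrightarrow> F g x \<in> \<Gamma> (k \<otimes> g)"
    and "\<And>g h x y. g \<in> carrier G \<Longrightarrow> h \<in> carrier G \<Longrightarrow> x \<in> \<Gamma> g \<Longrightarrow> y \<in> \<Gamma> h \<Longrightarrow> F (g \<otimes> h) (x \<cdot> y) = x \<cdot> F h y"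
    and "\<And>g h x y. g \<in> carrier G \<Longrightarrow> h \<in> carrier G \<Longrightarrow> x \<in> \<Gamma> g \<Longrightarrow> y \<in> \<Gamma> h \<Longrightarrow> F (g \<otimes> h) (x \<cdot> y) = F g x \<cdot> y"
  shows "lin_ext F \<in> centroid_comp G A \<Gamma> k"
proof (rule centroid_compI[OF k lin_on_lin_ext[OF lin] lin_ext_outside])
  have hom: "lin_ext F x = F g x" if "g \<in> carrier G" "x \<in> \<Gamma> g" for g x
    using lin that by (rule lin_ext_homogeneous)
  show "lin_ext F x \<in> \<Gamma> (k \<otimes> g)" if "g \<in> carrier G" "x \<in> \<Gamma> g" for g x
    using deg that hom by simp
  fix g h x y assume *: "g \<in> carrier G" "h \<in> carrier G" "x \<in> \<Gamma> g" "y \<in> \<Gamma> h"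
  show "lin_ext F (x \<cdot> y) = x \<cdot> lin_ext F y" "lin_ext F (x \<cdot> y) = lin_ext F x \<cdot> y"
    using hom[OF _ comp_mult[OF *]] hom[OF *(1,3)] hom[OF *(2,4)] assms(4,5)[OF *] *(1,2) by simp_all
qed

lemma scalar_operators_centroid: "scalar_operators A \<subseteq> carrier (centroid A)"
  using subspace_carrier
  by (auto simp: scalar_operators_def centroid_def operators_def lin_on_def subspace_def
      scaleR_add_right prod_scale_left prod_scale_right prod_closed mult.commute)

text \<open>The part of degree \<open>d\<close> of a central operator is again central:
  multiplication by a homogeneous element translates components, and commutativity of
  \<open>G\<close> lets \<open>d \<otimes> (g \<otimes> h)\<close> be regrouped around either
  factor.\<close>

lemma centroid_hcomp:
  assumes c: "c \<in> carrier (centroid A)" and d: "d \<in> carrier G"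
  shows "lin_ext (\<lambda>k x. hcomp (d \<otimes> k) (c x)) \<in> centroid_comp G A \<Gamma> d"
proof (rule lin_ext_centroid_comp[OF d])
  note cD = centroidD[OF c]
  show "lin_on (\<Gamma> g) (\<lambda>x. hcomp (d \<otimes> g) (c x))" if "g \<in> carrier G" for g
    by (rule lin_on_subset[OF lin_on_comp[OF cD(1) lin_on_hcomp] comp_subset[OF that]])
      (use cD(2) in auto)
  show "hcomp (d \<otimes> g) (c x) \<in> \<Gamma> (d \<otimes> g)" if "g \<in> carrier G" for g x
    using hcomp_in d that by simp
  fix g h x y assume gh: "g \<in> carrier G" "h \<in> carrier G" "x \<in> \<Gamma> g" "y \<in> \<Gamma> h"
  then have xy: "x \<in> carrier A" "y \<in> carrier A" using comp_closed by auto
  have "d \<otimes> (g \<otimes> h) = g \<otimes> (d \<otimes> h)" "d \<otimes> (g \<otimes> h) = h \<otimes> (d \<otimes> g)"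
    using d gh by (simp_all add: m_ac)
  then show "hcomp (d \<otimes> (g \<otimes> h)) (c (x \<cdot> y)) = x \<cdot> hcomp (d \<otimes> h) (c y)"
    "hcomp (d \<otimes> (g \<otimes> h)) (c (x \<cdot> y)) = hcomp (d \<otimes> g) (c x) \<cdot> y"
    using hcomp_mult_left[OF gh(3,1), of "d \<otimes> h" "c y"] hcomp_mult_right[OF gh(4,2), of "d \<otimes> g" "c x"] d gh cD(2)[OF xy(1)]
      cD(2)[OF xy(2)] cD(4)[OF xy] cD(5)[OF xy] by (metis m_closed)+
qed

text \<open>The argument is pointwise, since a priori a central operator may have infinitely many
  nonzero homogeneous parts. For \<open>x\<close> of degree \<open>g\<close>, the component of
  \<open>c x\<close> in degree \<open>h\<close> is the value at \<open>x\<close> of the part of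
  degree \<open>h \<otimes> inv g\<close>, which vanishes for \<open>h \<noteq> g\<close>. So
  \<open>c\<close> preserves degrees.\<close>

lemma central_of_homogeneous:
  assumes triv: "\<And>g. g \<in> carrier G \<Longrightarrow> g \<noteq> \<one> \<Longrightarrow> centroid_comp G A \<Gamma> g \<subseteq> {0}"
    and scal: "centroid_comp G A \<Gamma> \<one> \<subseteq> scalar_operators A"
  shows "carrier (centroid A) = scalar_operators A"
proof
  show "carrier (centroid A) \<subseteq> scalar_operators A"
  proof
    fix c assume c: "c \<in> carrier (centroid A)"
    note cD = centroidD[OF c]
    have "c x \<in> \<Gamma> g" if gx: "g \<in> carrier G" "x \<in> \<Gamma> g" for g x
    proof -
      have x: "x \<in> carrier A" using gx comp_closed by blast
      have "hcomp h (c x) = hcomp h (hcomp g (c x))" if h: "h \<in> carrier G" for h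
      proof (cases "h = g")
        case True
        then show ?thesis using hcomp_homogeneous[OF h hcomp_in[OF h]] by simp
      next
        case False
        define d where "d = h \<otimes> inv g"
        have d: "d \<in> carrier G" "d \<noteq> \<one>" "d \<otimes> g = h"
          using False h gx by (auto simp: d_def m_assoc) (metis inv_closed inv_inv inv_equality)
        have lin: "lin_on (\<Gamma> k) (\<lambda>x. hcomp (d \<otimes> k) (c x))" if "k \<in> carrier G" for k
          by (rule lin_on_subset[OF lin_on_comp[OF cD(1) lin_on_hcomp] comp_subset[OF that]])
            (use cD(2) in auto)
        have "lin_ext (\<lambda>k x. hcomp (d \<otimes> k) (c x)) = 0"
          using centroid_hcomp[OF c d(1)] triv[OF d(1,2)] by blast
        then have "hcomp h (c x) = 0"
          using lin_ext_homogeneous[of "\<lambda>k x. hcomp (d \<otimes> k) (c x)", OF lin gx] d(3) by simp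
        then show ?thesis using hcomp_homogeneous[OF gx(1) hcomp_in[OF gx(1)]] False by simp
      qed
      then have "c x = hcomp g (c x)" using hcomp_ext[OF cD(2)[OF x] hcomp_closed] by blast
      then show ?thesis using hcomp_in[OF gx(1)] by metis
    qed
    then have "c \<in> centroid_comp G A \<Gamma> \<one>" using c by (auto simp: centroid_comp_def)
    then show "c \<in> scalar_operators A" using scal by blast
  qed
qed (rule scalar_operators_centroid)

text \<open>
  A nonzero element of minimal support of an ideal determines, by uniqueness of elements of the
  ideal with translated support and prescribed leading component, an element of the centroid.
\<close>

lemma simple_of_graded_simple:
  assumes gs: "graded_simple G A \<Gamma>" and central: "carrier (centroid A) = scalar_operators A"
  shows "simple_alg A"
proof -
  have "I = carrier A" if I: "ideal_of A I" and nz: "I \<noteq> {0}" for I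
  proof -
    have sI: "subspace I" and IA: "I \<subseteq> carrier A"
      and Il: "\<And>a x. a \<in> carrier A \<Longrightarrow> x \<in> I \<Longrightarrow> a \<cdot> x \<in> I"
      and Ir: "\<And>a x. a \<in> carrier A \<Longrightarrow> x \<in> I \<Longrightarrow> x \<cdot> a \<in> I"
      using I by (auto simp: ideal_of_def)
    define supp where "supp x = {g. hcomp g x \<noteq> 0}" for x
    obtain x0 where x0: "x0 \<in> I" "x0 \<noteq> 0" using nz subspace_0[OF sI] by blast
    obtain x where x: "x \<in> I" "x \<noteq> 0" and min: "\<And>y. y \<in> I \<Longrightarrow> y \<noteq> 0 \<Longrightarrow> card (supp x) \<le> card (supp y)"
      using exists_least_iff[of "\<lambda>n. \<exists>y\<in>I. y \<noteq> 0 \<and> card (supp y) = n"] x0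
      by (metis not_le_imp_less)
    have "\<exists>g1. hcomp g1 x \<noteq> 0"
      using x IA hcomp_ext[of x 0] by (auto simp: hcomp_zero subspace_0[OF subspace_carrier])
    then obtain g1 where g1: "hcomp g1 x \<noteq> 0" "g1 \<in> carrier G" using hcomp_outside by blast
    \<comment> \<open>Translates of the minimal element: \<open>k\<close> plays the part of
      \<open>g1\<close>, the support of \<open>y\<close> may not leave the correspondingly
      translated support of \<open>x\<close>, and \<open>p\<close> is the prescribed leading
      component.\<close>
    define Y where "Y k p y \<longleftrightarrow> y \<in> I \<and> (\<forall>g. hcomp g y \<noteq> 0 \<longrightarrow> hcomp (g1 \<otimes> inv k \<otimes> g) x \<noteq> 0) \<and> hcomp k y = p"
      for k p y
    \<comment> \<open>With leading component zero the translated support of \<open>y\<close> misses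
      \<open>g1\<close>, so it is strictly smaller than that of \<open>x\<close> and minimality
      forces \<open>y = 0\<close>. By linearity this yields \<open>Y_unique\<close>.\<close>
    have Y_zero: "y = 0" if k: "k \<in> carrier G" and Y: "Y k 0 y" for k y
    proof (rule ccontr)
      assume nz: "y \<noteq> 0"
      have yI: "y \<in> I" using Y by (simp add: Y_def)
      let ?f = "\<lambda>g. g1 \<otimes> inv k \<otimes> g"
      have suppG: "supp y \<subseteq> carrier G" using hcomp_outside by (auto simp: supp_def)
      have "?f ` supp y \<subseteq> supp x - {g1}"
      proof
        fix h assume "h \<in> ?f ` supp y"
        then obtain g where g: "g \<in> supp y" "h = ?f g" by blast
        then have "hcomp h x \<noteq> 0" using Y by (simp add: Y_def supp_def)
        moreover have "h \<noteq> g1"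
        proof
          assume "h = g1"
          then have "g1 \<otimes> (inv k \<otimes> g) = g1 \<otimes> \<one>" using g suppG k g1 by (auto simp: m_assoc)
          then have "inv k \<otimes> g = \<one>"
            using Units_l_cancel[of g1 "inv k \<otimes> g" \<one>] g suppG k g1 by (auto simp: Units_eq)
          then have "k \<otimes> (inv k \<otimes> g) = k" using k by simp
          then have "g = k" using g suppG k by (auto simp: m_assoc[symmetric])
          then show False using g Y by (simp add: Y_def supp_def)
        qed
        ultimately show "h \<in> supp x - {g1}" by (simp add: supp_def)
      qed
      moreover have "inj_on ?f (supp y)"
      proof (rule inj_onI)
        fix g h assume "g \<in> supp y" "h \<in> supp y" "?f g = ?f h"
        then show "g = h" using Units_l_cancel[of "g1 \<otimes> inv k" g h] suppG k g1 by (auto simp: Units_eq)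
      qed
      moreover have "finite (supp x)" by (simp add: supp_def finite_hcomp)
      ultimately have "card (supp y) \<le> card (supp x - {g1})"
        by (metis card_image card_mono finite_Diff)
      also have "\<dots> < card (supp x)"
        using g1 \<open>finite (supp x)\<close> by (intro card_Diff1_less) (auto simp: supp_def)
      finally show False using min[OF yI nz] by simp
    qed
    have mem: "y \<in> carrier A" if "y \<in> I" for y using that IA by blast
    have Y_lin: "Y k (r *\<^sub>R p + q) (r *\<^sub>R y + z)" if "Y k p y" "Y k q z" for k p q r y z
    proof -
      have "y \<in> I" "z \<in> I" using that by (auto simp: Y_def)
      then have *: "hcomp g (r *\<^sub>R y + z) = r *\<^sub>R hcomp g y + hcomp g z" for g
        by (simp add: hcomp_add hcomp_scale mem subspace_scale[OF subspace_carrier])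
      have "r *\<^sub>R y + z \<in> I" using \<open>y \<in> I\<close> \<open>z \<in> I\<close> sI by (simp add: subspace_add subspace_scale)
      then show ?thesis using that unfolding Y_def * by (intro conjI allI impI) (blast, metis add_0 scaleR_zero_right, simp)
    qed
    have Y_unique: "y = z" if "k \<in> carrier G" "Y k p y" "Y k p z" for k p y z
      using Y_zero[OF that(1), of "(-1) *\<^sub>R y + z"] Y_lin[OF that(2,3), of "-1"] by (simp add: eq_neg_iff_add_eq_0)
    have Y_mult: "Y (h \<otimes> k) (a \<cdot> p) (a \<cdot> y)" "Y (h \<otimes> k) (p \<cdot> a) (y \<cdot> a)"
      if "h \<in> carrier G" "k \<in> carrier G" "a \<in> \<Gamma> h" "Y k p y" for h k a p y
    proof -
      have y: "y \<in> I" and p: "hcomp k y = p" using that by (auto simp: Y_def)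
      have a: "a \<in> carrier A" using that comp_closed by blast
      have shift: "hcomp (g1 \<otimes> inv (h \<otimes> k) \<otimes> g) x \<noteq> 0"
        if g: "g \<in> carrier G" "hcomp (inv h \<otimes> g) y \<noteq> 0" for g
      proof -
        have "g1 \<otimes> inv (h \<otimes> k) \<otimes> g = g1 \<otimes> inv k \<otimes> (inv h \<otimes> g)"
          using \<open>h \<in> carrier G\<close> \<open>k \<in> carrier G\<close> g g1 by (simp add: inv_mult_group m_ac)
        then show ?thesis using \<open>Y k p y\<close> g by (simp add: Y_def)
      qed
      have *: "hcomp g (a \<cdot> y) = a \<cdot> hcomp (inv h \<otimes> g) y" "hcomp g (y \<cdot> a) = hcomp (inv h \<otimes> g) y \<cdot> a"
        if "g \<in> carrier G" for g
        using hcomp_mult_left[OF \<open>a \<in> \<Gamma> h\<close> \<open>h \<in> carrier G\<close>, of "inv h \<otimes> g" y]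
          hcomp_mult_right[OF \<open>a \<in> \<Gamma> h\<close> \<open>h \<in> carrier G\<close>, of "inv h \<otimes> g" y] that \<open>h \<in> carrier G\<close> mem[OF y]
        by (auto simp: m_assoc[symmetric])
      have "hcomp (g1 \<otimes> inv (h \<otimes> k) \<otimes> g) x \<noteq> 0"
        if "hcomp g (a \<cdot> y) \<noteq> 0 \<or> hcomp g (y \<cdot> a) \<noteq> 0" for g
      proof -
        have g: "g \<in> carrier G" using that hcomp_outside by blast
        moreover have "hcomp (inv h \<otimes> g) y \<noteq> 0" using that *[OF g] prod_zero[OF a] by auto
        ultimately show ?thesis by (rule shift)
      qed
      then show "Y (h \<otimes> k) (a \<cdot> p) (a \<cdot> y)" "Y (h \<otimes> k) (p \<cdot> a) (y \<cdot> a)"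
        using Il[OF a y] Ir[OF a y] hcomp_mult_left[OF that(3,1,2) mem[OF y]]
          hcomp_mult_right[OF that(3,1,2) mem[OF y]] p by (auto simp: Y_def)
    qed
    have Y0: "Y k 0 0" for k using subspace_0[OF sI] by (simp add: Y_def hcomp_zero)
    \<comment> \<open>\<open>D\<close> collects the elements all of whose components occur as
      leading components. \<open>Y_mult\<close> makes it a graded ideal and it contains
      \<open>hcomp g1 x\<close>, so graded simplicity makes it the whole carrier.\<close>
    define D where "D = {p \<in> carrier A. \<forall>k\<in>carrier G. \<exists>y. Y k (hcomp k p) y}"
    have D_hom: "p \<in> D \<longleftrightarrow> (\<exists>y. Y k p y)" if "k \<in> carrier G" "p \<in> \<Gamma> k" for k p
      using that Y0 comp_closed[OF that] by (auto simp: D_def hcomp_homogeneous[OF that])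
    have "graded_ideal G A \<Gamma> D"
    proof (rule graded_idealI)
      show "subspace D"
      proof (rule subspaceI)
        show "0 \<in> D" using Y0 subspace_0[OF subspace_carrier] by (auto simp: D_def hcomp_zero)
        show "p + q \<in> D" if "p \<in> D" "q \<in> D" for p q
          using that Y_lin[of _ _ _ _ _ 1] subspace_add[OF subspace_carrier]
          by (simp add: D_def hcomp_add) metis
        show "r *\<^sub>R p \<in> D" if "p \<in> D" for r p
          using that Y_lin[of _ _ _ 0 0 r, OF _ Y0] subspace_scale[OF subspace_carrier]
          by (simp add: D_def hcomp_scale) metis
      qed
      show "D \<subseteq> carrier A" by (auto simp: D_def)
      show "hcomp g p \<in> D" if "g \<in> carrier G" "p \<in> D" for g p
        using that D_hom[OF that(1) hcomp_in[OF that(1)]] by (auto simp: D_def)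
      fix g h a p assume *: "g \<in> carrier G" "h \<in> carrier G" "a \<in> \<Gamma> g" "p \<in> \<Gamma> h" "p \<in> D"
      then obtain y where "Y h p y" using D_hom by blast
      with * show "a \<cdot> p \<in> D" "p \<cdot> a \<in> D"
        using D_hom[of "g \<otimes> h"] Y_mult comp_mult[OF *(1-4)] comp_mult[OF *(2,1,4,3)]
        by (metis m_closed m_comm)+
    qed
    moreover have "D \<noteq> {0}"
    proof -
      have "Y g1 (hcomp g1 x) x" using x g1 by (auto simp: Y_def) (metis l_one hcomp_outside)
      then have "hcomp g1 x \<in> D" using D_hom[OF g1(2) hcomp_in[OF g1(2)]] by blast
      then show ?thesis using g1 by auto
    qed
    ultimately have DA: "D = carrier A" using gs by (auto simp: graded_simple_def)
    \<comment> \<open>The choice is unique by \<open>Y_unique\<close>, so \<open>E\<close> inherits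
      linearity and compatibility with products from \<open>Y_lin\<close> and \<open>Y_mult\<close>;
      its linear extension is the central operator sought.\<close>
    define E where "E k p = (SOME y. Y k p y)" for k p
    have E: "Y k p (E k p)" if "k \<in> carrier G" "p \<in> \<Gamma> k" for k p
      unfolding E_def by (rule someI_ex) (use that D_hom DA comp_closed in blast)
    have E_eq: "E k p = y" if "k \<in> carrier G" "p \<in> \<Gamma> k" "Y k p y" for k p y
      using Y_unique[OF that(1) E[OF that(1,2)] that(3)] .
    have E_lin: "lin_on (\<Gamma> k) (E k)" if k: "k \<in> carrier G" for k
      unfolding lin_on_def
    proof (intro conjI ballI allI)
      show "E k (p + q) = E k p + E k q" if "p \<in> \<Gamma> k" "q \<in> \<Gamma> k" for p q
        using E_eq[OF k subspace_add[OF subspace_comp[OF k] that]]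
          Y_lin[OF E[OF k that(1)] E[OF k that(2)], of 1] by simp
      show "E k (r *\<^sub>R p) = r *\<^sub>R E k p" if "p \<in> \<Gamma> k" for r p
        using E_eq[OF k subspace_scale[OF subspace_comp[OF k] that]]
          Y_lin[OF E[OF k that(1)] Y0, of r] by simp
    qed
    have E_I: "E k p \<in> I" if "k \<in> carrier G" "p \<in> \<Gamma> k" for k p
      using E[OF that] by (simp add: Y_def)
    let ?e = "lin_ext E"
    have E_hom: "?e p = E k p" if "k \<in> carrier G" "p \<in> \<Gamma> k" for k p
      using E_lin that by (rule lin_ext_homogeneous)
    have "?e \<in> carrier (centroid A)"
    proof (rule centroidI)
      show "?e \<in> operators A"
        using lin_on_lin_ext[OF E_lin] lin_ext_outside[of _ E] lin_ext_in[OF subspace_carrier, of E] E_I mem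
        by (auto simp: operators_def)
      fix g h a p assume *: "g \<in> carrier G" "h \<in> carrier G" "a \<in> \<Gamma> g" "p \<in> \<Gamma> h"
      have "E (g \<otimes> h) (a \<cdot> p) = a \<cdot> E h p"
        by (rule E_eq[OF _ comp_mult[OF *] Y_mult(1)[OF *(1,2,3) E[OF *(2,4)]]]) (use * in simp)
      then show "?e (a \<cdot> p) = a \<cdot> ?e p"
        using E_hom[OF _ comp_mult[OF *]] E_hom[OF *(2,4)] * by simp
      have "E (g \<otimes> h) (a \<cdot> p) = E g a \<cdot> p"
        using E_eq[OF _ comp_mult[OF *]] Y_mult(2)[OF *(2,1,4) E[OF *(1,3)]] * by (metis m_closed m_comm)
      then show "?e (a \<cdot> p) = ?e a \<cdot> p"
        using E_hom[OF _ comp_mult[OF *]] E_hom[OF *(1,3)] * by simp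
    qed
    \<comment> \<open>\<open>E k p = r *\<^sub>R p\<close> has component \<open>p\<close> in degree
      \<open>k\<close>, so \<open>r *\<^sub>R p = p\<close>, and \<open>p\<close> itself is the
      element \<open>E k p\<close> of \<open>I\<close>.\<close>
    then obtain r where r: "?e = (\<lambda>x. if x \<in> carrier A then r *\<^sub>R x else 0)"
      using central by (auto simp: scalar_operators_def)
    have "p \<in> I" if "p \<in> carrier A" for p
      using that
    proof (induction p rule: homogeneous_induct)
      case (homogeneous k p)
      have pA: "p \<in> carrier A" using homogeneous comp_closed by blast
      have e: "E k p = r *\<^sub>R p" using E_hom[OF homogeneous] pA by (simp add: r)
      have "hcomp k (E k p) = p" using E[OF homogeneous] by (simp add: Y_def)
      then have "r *\<^sub>R p = p" using e hcomp_scale[OF pA] hcomp_homogeneous[OF homogeneous] by simp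
      then show ?case using E_I[OF homogeneous] e by simp
    qed (use subspace_add[OF sI] in blast)
    then show ?thesis using IA by blast
  qed
  then show ?thesis using gs by (auto simp: simple_alg_def graded_simple_def)
qed

end

section \<open>Specialisation along a split centroid\<close>

text \<open>Linear projections give the uniqueness of decompositions: applying \<open>p h\<close> to
  any decomposition of \<open>x\<close> isolates its entry at \<open>h\<close>.\<close>

lemma gradingI:
  assumes sub: "subspace (carrier B)"
    and comp: "\<And>g. g \<in> carrier G \<Longrightarrow> subspace (\<Delta> g)" "\<And>g. g \<in> carrier G \<Longrightarrow> \<Delta> g \<subseteq> carrier B"
    and mult: "\<And>g h x y. g \<in> carrier G \<Longrightarrow> h \<in> carrier G \<Longrightarrow> x \<in> \<Delta> g \<Longrightarrow> y \<in> \<Delta> h \<Longrightarrow> x \<star>\<^bsub>B\<^esub> y \<in> \<Delta> (g \<otimes>\<^bsub>G\<^esub> h)"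
    and lin: "\<And>g. g \<in> carrier G \<Longrightarrow> lin_on (carrier B) (p g)"
    and fin: "\<And>x. x \<in> carrier B \<Longrightarrow> finite {g. p g x \<noteq> 0}"
    and out: "\<And>g x. g \<notin> carrier G \<Longrightarrow> p g x = 0"
    and mem: "\<And>g x. g \<in> carrier G \<Longrightarrow> x \<in> carrier B \<Longrightarrow> p g x \<in> \<Delta> g"
    and sum: "\<And>x. x \<in> carrier B \<Longrightarrow> (\<Sum>g | p g x \<noteq> 0. p g x) = x"
    and hom: "\<And>g h x. g \<in> carrier G \<Longrightarrow> h \<in> carrier G \<Longrightarrow> x \<in> \<Delta> g \<Longrightarrow> p h x = (if h = g then x else 0)"
  shows "grading G B \<Delta>"
proof -
  have "\<exists>!c. finite {g. c g \<noteq> 0} \<and> {g. c g \<noteq> 0} \<subseteq> carrier G \<and>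
        (\<forall>g\<in>carrier G. c g \<in> \<Delta> g) \<and> x = (\<Sum>g | c g \<noteq> 0. c g)" (is "\<exists>!c. ?P c")
    if x: "x \<in> carrier B" for x
  proof (rule ex1I[of ?P "\<lambda>g. p g x"])
    show "?P (\<lambda>g. p g x)" using fin[OF x] out mem[OF _ x] sum[OF x] by auto
    fix c assume c: "?P c"
    show "c = (\<lambda>g. p g x)"
    proof
      fix h show "c h = p h x"
      proof (cases "h \<in> carrier G")
        case False
        then show ?thesis using out c by fastforce
      next
        case True
        have "p h (\<Sum>g | c g \<noteq> 0. c g) = (\<Sum>g | c g \<noteq> 0. p h (c g))"
          by (rule lin_on_sum[OF lin[OF True] sub]) (use c comp(2) in blast)+
        also have "\<dots> = (\<Sum>g | c g \<noteq> 0. if h = g then c g else 0)"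
          by (rule sum.cong) (use c hom[OF _ True] in auto)
        also have "\<dots> = c h" using c by (simp add: sum.delta)
        finally show ?thesis using c by metis
      qed
    qed
  qed
  then show ?thesis using comp mult by (simp add: grading_def)
qed

text \<open>The untwisted case. The \<open>d h\<close> multiply like the elements of
  \<open>H\<close> and span the homogeneous central operators, which thus amount to a copy of the
  real group algebra of \<open>H\<close>; sending every \<open>d h\<close> to the identity is a
  specialisation over the reals.\<close>

locale split_centroid = graded_real_algebra A G \<Gamma>
  for A :: "('a::real_vector, 'm) alg_scheme" and G :: "('g, 'n) monoid_scheme" (structure)
    and \<Gamma> :: "'g \<Rightarrow> 'a set" +
  fixes H :: "'g set" and d :: "'g \<Rightarrow> 'a \<Rightarrow> 'a"
  assumes gr_simple: "graded_simple G A \<Gamma>"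
    and subgroup_H: "subgroup H G"
    and d_comp: "h \<in> H \<Longrightarrow> d h \<in> centroid_comp G A \<Gamma> h"
    and d_mult: "h \<in> H \<Longrightarrow> k \<in> H \<Longrightarrow> x \<in> carrier A \<Longrightarrow> d h (d k x) = d (h \<otimes> k) x"
    and d_one: "x \<in> carrier A \<Longrightarrow> d \<one> x = x"
    and centroid_d: "k \<in> carrier G \<Longrightarrow> c \<in> centroid_comp G A \<Gamma> k \<Longrightarrow> c \<noteq> 0 \<Longrightarrow>
      k \<in> H \<and> (\<exists>r. \<forall>x\<in>carrier A. c x = r *\<^sub>R d k x)"
begin

section \<open>Coset representatives and the quotient map\<close>

lemma normal_H: "H \<lhd> G"
  using subgroup_H by (simp add: normal_iff_subgroup)

lemma H_carrier: "h \<in> H \<Longrightarrow> h \<in> carrier G"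
  using subgroup_H subgroup.subset by blast

lemmas d_centroid = centroid_compD(1)[OF d_comp]

lemma d_closed: "h \<in> H \<Longrightarrow> x \<in> carrier A \<Longrightarrow> d h x \<in> carrier A"
  using d_centroid centroidD(2) by blast

definition rep :: "'g set \<Rightarrow> 'g" where "rep q = (SOME g. g \<in> q)"

definition sec :: "'g \<Rightarrow> 'g" where "sec g = rep (H #> g)"

lemma rep_in:
  assumes "q \<in> rcosets H"
  shows "rep q \<in> q" "rep q \<in> carrier G" "H #> rep q = q" "sec (rep q) = rep q"
proof -
  obtain g where g: "g \<in> carrier G" "q = H #> g" using assms by (auto simp: RCOSETS_def)
  have "g \<in> q" using g rcos_self subgroup_H by blast
  then show 1: "rep q \<in> q" unfolding rep_def by (rule someI)
  show "rep q \<in> carrier G" using 1 g subgroup_H by (metis r_coset_subset_G subgroup.subset subsetD)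
  show 2: "H #> rep q = q" using 1 g repr_independence[OF _ _ subgroup_H] by metis
  show "sec (rep q) = rep q" by (simp add: sec_def 2)
qed

lemma sec_facts:
  assumes "g \<in> carrier G"
  shows "sec g \<in> carrier G" "H #> sec g = H #> g" "sec (sec g) = sec g" "sec g \<otimes> inv g \<in> H"
proof -
  have q: "H #> g \<in> rcosets H" using assms by (rule rcosetsI[OF subgroup.subset[OF subgroup_H]])
  show "sec g \<in> carrier G" "H #> sec g = H #> g" "sec (sec g) = sec g"
    using rep_in[OF q] by (simp_all add: sec_def)
  have "sec g \<in> H #> g" using rep_in(1)[OF q] by (simp add: sec_def)
  then show "sec g \<otimes> inv g \<in> H" using subgroup.rcos_module_imp[OF subgroup_H is_group assms] by blast
qed

lemma sec_mult:
  assumes "h \<in> H" "g \<in> carrier G"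
  shows "sec (h \<otimes> g) = sec g"
proof -
  have "H #> (h \<otimes> g) = H #> h #> g"
    using assms H_carrier coset_mult_assoc[OF subgroup.subset[OF subgroup_H]] by simp
  also have "H #> h = H" using subgroup.rcos_const[OF subgroup_H is_group assms(1)] .
  finally show ?thesis by (simp add: sec_def)
qed

text \<open>The quotient map by the relations \<open>d h x = x\<close>: the component of degree
  \<open>g\<close> is moved to the representative of its coset by the only \<open>d h\<close> that
  shifts \<open>g\<close> there.\<close>

definition lam :: "'a \<Rightarrow> 'a" where "lam = lin_ext (\<lambda>g. d (sec g \<otimes> inv g))"

lemma d_lin: "h \<in> H \<Longrightarrow> lin_on (carrier A) (d h)"
  using d_centroid centroidD(1) by blast

lemma sec_d_lin: "g \<in> carrier G \<Longrightarrow> lin_on (\<Gamma> g) (d (sec g \<otimes> inv g))"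
  using lin_on_subset[OF d_lin comp_subset] sec_facts(4) by blast

lemma lin_on_lam: "lin_on (carrier A) lam"
  unfolding lam_def by (rule lin_on_lin_ext) (rule sec_d_lin)

lemma lam_homogeneous:
  assumes "g \<in> carrier G" "x \<in> \<Gamma> g"
  shows "lam x = d (sec g \<otimes> inv g) x" "lam x \<in> \<Gamma> (sec g)"
proof -
  show 1: "lam x = d (sec g \<otimes> inv g) x"
    unfolding lam_def using sec_d_lin assms by (rule lin_ext_homogeneous)
  have "d (sec g \<otimes> inv g) x \<in> \<Gamma> (sec g \<otimes> inv g \<otimes> g)"
    using centroid_compD(2)[OF d_comp assms] sec_facts(4)[OF assms(1)] by blast
  then show "lam x \<in> \<Gamma> (sec g)" using 1 assms sec_facts(1)[OF assms(1)] by (simp add: m_assoc)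
qed

lemma lam_closed: "x \<in> carrier A \<Longrightarrow> lam x \<in> carrier A"
proof (induction x rule: homogeneous_induct)
  case (homogeneous g x)
  then show ?case using lam_homogeneous(2) comp_closed sec_facts(1) by blast
next
  case (add x y)
  then show ?case using subspace_add[OF subspace_carrier] lin_on_add[OF lin_on_lam] by simp
qed

text \<open>For \<open>x\<close> of degree \<open>g\<close>, the degrees of \<open>x\<close> and
  \<open>d h x\<close> lie in one coset, and the moves to its representative combine: \<open>sec g
  \<otimes> inv (h \<otimes> g) \<otimes> h = sec g \<otimes> inv g\<close>.\<close>

lemma lam_d:
  assumes h: "h \<in> H" and x: "x \<in> carrier A"
  shows "lam (d h x) = lam x"
proof (rule lin_on_eq[OF _ lin_on_lam x])
  show "lin_on (carrier A) (\<lambda>x. lam (d h x))"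
    using lin_on_comp[OF d_lin[OF h] lin_on_lam] d_closed[OF h] by blast
  fix g x assume gx: "g \<in> carrier G" "x \<in> \<Gamma> g"
  have hg: "h \<otimes> g \<in> carrier G" "d h x \<in> \<Gamma> (h \<otimes> g)"
    using gx h H_carrier centroid_compD(2)[OF d_comp[OF h]] by auto
  have "lam (d h x) = d (sec g \<otimes> inv (h \<otimes> g)) (d h x)"
    using lam_homogeneous(1)[OF hg] sec_mult[OF h gx(1)] by simp
  also have "\<dots> = d (sec g \<otimes> inv (h \<otimes> g) \<otimes> h) x"
    using d_mult[OF _ h comp_closed[OF gx]] sec_facts(4)[OF hg(1)] sec_mult[OF h gx(1)] by simp
  also have "sec g \<otimes> inv (h \<otimes> g) \<otimes> h = sec g \<otimes> inv g"
    using sec_facts(1)[OF gx(1)] H_carrier[OF h] gx(1) by (simp add: inv_mult_group m_assoc)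
  also have "d (sec g \<otimes> inv g) x = lam x" using lam_homogeneous(1)[OF gx] by simp
  finally show "lam (d h x) = lam x" .
qed

lemma lam_fixed:
  assumes "g \<in> carrier G" "sec g = g" "x \<in> \<Gamma> g"
  shows "lam x = x"
  using lam_homogeneous(1)[OF assms(1,3)] assms(1,2) d_one[OF comp_closed[OF assms(1,3)]] by simp

lemma lam_lam:
  assumes "x \<in> carrier A"
  shows "lam (lam x) = lam x"
proof (rule lin_on_eq[OF lin_on_comp[OF lin_on_lam lin_on_lam] lin_on_lam assms])
  show "lam ` carrier A \<subseteq> carrier A" using lam_closed by blast
  show "lam (lam x) = lam x" if "g \<in> carrier G" "x \<in> \<Gamma> g" for g x
    using lam_fixed[OF _ _ lam_homogeneous(2)[OF that]] sec_facts[OF that(1)] by blast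
qed

lemma sec_inv:
  assumes "g \<in> carrier G"
  shows "g \<otimes> inv (sec g) \<in> H" "inv (sec g \<otimes> inv g) = g \<otimes> inv (sec g)"
proof -
  show "inv (sec g \<otimes> inv g) = g \<otimes> inv (sec g)"
    using sec_facts(1)[OF assms] assms by (simp add: inv_mult_group)
  then show "g \<otimes> inv (sec g) \<in> H"
    using subgroup.m_inv_closed[OF subgroup_H sec_facts(4)[OF assms]] by simp
qed

text \<open>Moving back from the representative to \<open>g\<close> inverts \<open>lam\<close> on a
  component. With \<open>lam_unlift\<close> this makes \<open>lam\<close> a bijection from
  \<open>\<Gamma> g\<close> to \<open>\<Gamma> (sec g)\<close>, although it is not injective on the
  whole carrier once \<open>H\<close> is nontrivial.\<close>

lemma lam_lift:
  assumes "g \<in> carrier G" "y \<in> \<Gamma> (sec g)"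
  shows "d (g \<otimes> inv (sec g)) y \<in> \<Gamma> g" "lam (d (g \<otimes> inv (sec g)) y) = y"
proof -
  note s = sec_facts(1)[OF assms(1)] and h = sec_inv(1)[OF assms(1)]
  have "d (g \<otimes> inv (sec g)) y \<in> \<Gamma> (g \<otimes> inv (sec g) \<otimes> sec g)"
    using centroid_compD(2)[OF d_comp[OF h] s assms(2)] .
  then show "d (g \<otimes> inv (sec g)) y \<in> \<Gamma> g" using s assms(1) by (simp add: m_assoc)
  show "lam (d (g \<otimes> inv (sec g)) y) = y"
    using lam_d[OF h comp_closed[OF s assms(2)]] lam_fixed[OF s sec_facts(3)[OF assms(1)] assms(2)] by simp
qed

lemma lam_unlift:
  assumes "g \<in> carrier G" "x \<in> \<Gamma> g"
  shows "d (g \<otimes> inv (sec g)) (lam x) = x"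
proof -
  note s = sec_facts(1)[OF assms(1)]
  have "d (g \<otimes> inv (sec g)) (lam x) = d (g \<otimes> inv (sec g) \<otimes> (sec g \<otimes> inv g)) x"
    using lam_homogeneous(1)[OF assms] d_mult[OF sec_inv(1) sec_facts(4)] assms comp_closed[OF assms] by simp
  also have "g \<otimes> inv (sec g) \<otimes> (sec g \<otimes> inv g) = \<one>"
    using sec_inv(2)[OF assms(1)] s assms(1) by (metis inv_closed l_inv m_closed)
  finally show ?thesis using d_one comp_closed[OF assms] by simp
qed

lemma lam_image: "g \<in> carrier G \<Longrightarrow> lam ` \<Gamma> g = \<Gamma> (sec g)"
  using lam_homogeneous(2) lam_lift by (metis (no_types, lifting) image_eqI image_subsetI subsetI subset_antisym)

lemma lam_inj: "g \<in> carrier G \<Longrightarrow> x \<in> \<Gamma> g \<Longrightarrow> y \<in> \<Gamma> g \<Longrightarrow> lam x = lam y \<Longrightarrow> x = y"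
  using lam_unlift by metis

text \<open>Centrality pulls \<open>d\<close> out of the product and \<open>lam\<close> absorbs it.
  With \<open>lam_mult_right\<close>, \<open>lam (x \<cdot> y)\<close> depends only on
  \<open>lam x\<close> and \<open>lam y\<close>, so the product descends to the quotient.\<close>

lemma lam_mult_left:
  assumes "x \<in> carrier A" "y \<in> carrier A"
  shows "lam (lam x \<cdot> y) = lam (x \<cdot> y)"
  using assms(1)
proof (induction x rule: homogeneous_induct)
  case (homogeneous g x)
  note h = sec_facts(4)[OF homogeneous(1)] and x = comp_closed[OF homogeneous]
  have "lam x \<cdot> y = d (sec g \<otimes> inv g) (x \<cdot> y)"
    using lam_homogeneous(1)[OF homogeneous] centroidD(5)[OF d_centroid[OF h] x assms(2)] by simp
  then show ?case using lam_d[OF h prod_closed[OF x assms(2)]] by simp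
next
  case (add x z)
  then show ?case using assms(2)
    by (simp add: lin_on_add[OF lin_on_lam] prod_add_left lam_closed prod_closed)
qed

lemma lam_mult_right:
  assumes "x \<in> carrier A" "y \<in> carrier A"
  shows "lam (x \<cdot> lam y) = lam (x \<cdot> y)"
  using assms(2)
proof (induction y rule: homogeneous_induct)
  case (homogeneous g y)
  note h = sec_facts(4)[OF homogeneous(1)] and y = comp_closed[OF homogeneous]
  have "x \<cdot> lam y = d (sec g \<otimes> inv g) (x \<cdot> y)"
    using lam_homogeneous(1)[OF homogeneous] centroidD(4)[OF d_centroid[OF h] assms(1) y] by simp
  then show ?case using lam_d[OF h prod_closed[OF assms(1) y]] by simp
next
  case (add y z)
  then show ?case using assms(1)
    by (simp add: lin_on_add[OF lin_on_lam] prod_add_right lam_closed prod_closed)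
qed

text \<open>
  The quotient of \<open>A\<close> by the relations \<open>d h x = x\<close>, realised as the sum of one component of \<open>A\<close>
  for each coset of \<open>H\<close>.
\<close>

definition Q :: "'a alg" where
  "Q = \<lparr>carrier = lam ` carrier A, aprod = \<lambda>x y. lam (x \<cdot> y)\<rparr>"

definition Qc :: "'g set \<Rightarrow> 'a set" where "Qc q = \<Gamma> (rep q)"

lemma carrier_Q: "x \<in> carrier Q \<longleftrightarrow> x \<in> carrier A \<and> lam x = x"
  using lam_lam lam_closed by (auto simp: Q_def image_iff) metis

lemma prod_Q: "x \<star>\<^bsub>Q\<^esub> y = lam (x \<cdot> y)"
  by (simp add: Q_def)

lemma lam_carrier_Q: "x \<in> carrier A \<Longrightarrow> lam x \<in> carrier Q"
  by (simp add: Q_def)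

lemma lam_prod: "x \<in> carrier A \<Longrightarrow> y \<in> carrier A \<Longrightarrow> lam (x \<cdot> y) = lam x \<star>\<^bsub>Q\<^esub> lam y"
  by (simp add: prod_Q lam_mult_left lam_mult_right lam_closed)

lemma subspace_Q: "subspace (carrier Q)"
  unfolding Q_def using subspace_lin_image[OF lin_on_lam subspace_carrier] by simp

lemma real_algebra_Q: "real_algebra Q"
proof
  show "subspace (carrier Q)" by (rule subspace_Q)
qed (auto simp: carrier_Q prod_Q lam_closed lam_lam prod_closed prod_add_left prod_add_right
    prod_scale_left prod_scale_right lin_on_add[OF lin_on_lam] lin_on_scale[OF lin_on_lam])

text \<open>Elements of \<open>Q\<close> are values of \<open>lam\<close>, hence supported on coset
  representatives. This lets cosets index the grading.\<close>

lemma hcomp_Q: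
  assumes "x \<in> carrier Q" "hcomp g x \<noteq> 0"
  shows "sec g = g"
proof (rule ccontr)
  assume ne: "sec g \<noteq> g"
  have "hcomp g (lam x) = 0" if "x \<in> carrier A" for x
    using that
  proof (induction x rule: homogeneous_induct)
    case (homogeneous k x)
    have "g \<noteq> sec k" using ne sec_facts(3)[OF homogeneous(1)] by auto
    then show ?case
      using hcomp_homogeneous[OF sec_facts(1)[OF homogeneous(1)] lam_homogeneous(2)[OF homogeneous]] by simp
  next
    case (add x y)
    then show ?case by (simp add: lin_on_add[OF lin_on_lam] hcomp_add lam_closed)
  qed
  then show False using assms by (simp add: carrier_Q) metis
qed

lemma Qc_subset: "q \<in> rcosets H \<Longrightarrow> Qc q \<subseteq> carrier Q"
  using comp_closed[OF rep_in(2)] lam_fixed[OF rep_in(2,4)] unfolding Qc_def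
  by (auto simp: carrier_Q)

lemma Qc_sec: "g \<in> carrier G \<Longrightarrow> Qc (H #> g) = \<Gamma> (sec g)"
  by (simp add: Qc_def sec_def)

definition pQ :: "'g set \<Rightarrow> 'a \<Rightarrow> 'a" where
  "pQ q x = (if q \<in> rcosets H then hcomp (rep q) x else 0)"

lemma sum_pQ:
  assumes x: "x \<in> carrier Q"
  shows "finite {q. pQ q x \<noteq> 0}" "(\<Sum>q | pQ q x \<noteq> 0. pQ q x) = x"
proof -
  have bij: "bij_betw rep {q. pQ q x \<noteq> 0} {g. hcomp g x \<noteq> 0}"
  proof (rule bij_betw_byWitness[where f'="\<lambda>g. H #> g"])
    show "\<forall>q\<in>{q. pQ q x \<noteq> 0}. H #> rep q = q"
      using rep_in(3) by (auto simp: pQ_def split: if_splits)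
    show "\<forall>g\<in>{g. hcomp g x \<noteq> 0}. rep (H #> g) = g"
      using hcomp_Q[OF x] by (auto simp: sec_def)
    show "rep ` {q. pQ q x \<noteq> 0} \<subseteq> {g. hcomp g x \<noteq> 0}"
      by (auto simp: pQ_def split: if_splits)
    show "(\<lambda>g. H #> g) ` {g. hcomp g x \<noteq> 0} \<subseteq> {q. pQ q x \<noteq> 0}"
    proof
      fix q assume "q \<in> (\<lambda>g. H #> g) ` {g. hcomp g x \<noteq> 0}"
      then obtain g where g: "hcomp g x \<noteq> 0" "q = H #> g" by blast
      then have "g \<in> carrier G" using hcomp_outside by blast
      then have "q \<in> rcosets H" using g rcosetsI[OF subgroup.subset[OF subgroup_H]] by blast
      then show "q \<in> {q. pQ q x \<noteq> 0}" using g hcomp_Q[OF x g(1)] by (simp add: pQ_def sec_def)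
    qed
  qed
  then show "finite {q. pQ q x \<noteq> 0}" using finite_hcomp bij_betw_finite by blast
  have "(\<Sum>q | pQ q x \<noteq> 0. pQ q x) = (\<Sum>q | pQ q x \<noteq> 0. hcomp (rep q) x)"
    by (rule sum.cong) (auto simp: pQ_def split: if_splits)
  also have "\<dots> = (\<Sum>g | hcomp g x \<noteq> 0. hcomp g x)" by (rule sum.reindex_bij_betw[OF bij])
  finally show "(\<Sum>q | pQ q x \<noteq> 0. pQ q x) = x" using sum_hcomp x by (simp add: carrier_Q)
qed

lemma carrier_Mod: "carrier (G Mod H) = rcosets H"
  by (simp add: FactGroup_def)

lemma Mod_mult: "g \<in> carrier G \<Longrightarrow> h \<in> carrier G \<Longrightarrow> (H #> g) \<otimes>\<^bsub>G Mod H\<^esub> (H #> h) = H #> (g \<otimes> h)"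
  using normal.rcos_sum[OF normal_H] by (simp add: FactGroup_def)

lemma Mod_mult_rep:
  assumes "q \<in> rcosets H" "r \<in> rcosets H"
  shows "q \<otimes>\<^bsub>G Mod H\<^esub> r = H #> (rep q \<otimes> rep r)"
  using Mod_mult[of "rep q" "rep r"] rep_in[OF assms(1)] rep_in[OF assms(2)] by simp

lemma pQ_homogeneous:
  assumes "q \<in> rcosets H" "r \<in> rcosets H" "x \<in> Qc q"
  shows "pQ r x = (if r = q then x else 0)"
proof -
  have "rep r = rep q \<longleftrightarrow> r = q" using rep_in(3)[OF assms(1)] rep_in(3)[OF assms(2)] by metis
  moreover have "pQ r x = (if rep r = rep q then x else 0)"
    using hcomp_homogeneous[OF rep_in(2)[OF assms(1)]] assms by (simp add: pQ_def Qc_def)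
  ultimately show ?thesis by simp
qed

lemma grading_Q: "grading (G Mod H) Q Qc"
proof (rule gradingI[where p=pQ])
  show "subspace (carrier Q)" by (rule subspace_Q)
  fix q assume q: "q \<in> carrier (G Mod H)"
  then have q': "q \<in> rcosets H" by (simp add: carrier_Mod)
  show "subspace (Qc q)" using rep_in[OF q'] subspace_comp by (simp add: Qc_def)
  show "Qc q \<subseteq> carrier Q" using Qc_subset[OF q'] .
  show "lin_on (carrier Q) (pQ q)"
    using lin_on_hcomp q' unfolding pQ_def by (auto simp: lin_on_def carrier_Q)
  show "pQ q x \<in> Qc q" if "x \<in> carrier Q" for x
    using that q' hcomp_in rep_in[OF q'] by (simp add: pQ_def Qc_def)
  fix r assume "r \<in> carrier (G Mod H)"
  then have r': "r \<in> rcosets H" by (simp add: carrier_Mod)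
  show "pQ r x = (if r = q then x else 0)" if "x \<in> Qc q" for x
    using pQ_homogeneous[OF q' r' that] .
  fix x y assume "x \<in> Qc q" "y \<in> Qc r"
  \<comment> \<open>A product of two representatives need not be a representative;
    \<open>lam\<close> moves it to that of the product coset.\<close>
  then have "lam (x \<cdot> y) \<in> \<Gamma> (sec (rep q \<otimes> rep r))"
    using rep_in[OF q'] rep_in[OF r'] by (intro lam_homogeneous(2) comp_mult) (auto simp: Qc_def)
  then show "x \<star>\<^bsub>Q\<^esub> y \<in> Qc (q \<otimes>\<^bsub>G Mod H\<^esub> r)"
    using rep_in[OF q'] rep_in[OF r'] by (simp only: prod_Q Mod_mult_rep[OF q' r'] Qc_sec m_closed)
qed (use sum_pQ in \<open>auto simp: pQ_def carrier_Mod\<close>)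

lemma graded_real_algebra_Q: "graded_real_algebra Q (G Mod H) Qc"
  using real_algebra_Q abelian_FactGroup[OF subgroup_H] grading_Q
  by (simp add: graded_real_algebra_def graded_real_algebra_axioms_def)

lemma graded_hcomp_Q:
  assumes "x \<in> carrier Q"
  shows "graded_real_algebra.hcomp Q (G Mod H) Qc q x = pQ q x"
proof -
  have "pQ r x \<in> Qc r" "r \<in> carrier (G Mod H)" if "r \<in> {r. pQ r x \<noteq> 0}" for r
    using that hcomp_in rep_in(2) by (auto simp: pQ_def Qc_def carrier_Mod split: if_splits)
  moreover have "{r. pQ r x \<noteq> 0} \<subseteq> carrier (G Mod H)" by (auto simp: pQ_def carrier_Mod)
  ultimately show ?thesis
    using graded_real_algebra.hcomp_unique[OF graded_real_algebra_Q assms sum_pQ(1)[OF assms] _ _ sum_pQ(2)[OF assms, symmetric], of q]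
    by (auto split: if_splits)
qed

end

lemma (in graded_real_algebra) homogeneous_product:
  assumes "nonzero_product A"
  obtains g h x y where "g \<in> carrier G" "h \<in> carrier G" "x \<in> \<Gamma> g" "y \<in> \<Gamma> h" "x \<cdot> y \<noteq> 0"
proof -
  have "\<exists>g h x y. g \<in> carrier G \<and> h \<in> carrier G \<and> x \<in> \<Gamma> g \<and> y \<in> \<Gamma> h \<and> x \<cdot> y \<noteq> 0"
  proof (rule ccontr)
    assume "\<not> ?thesis"
    then have zero: "x \<cdot> y = 0" if "g \<in> carrier G" "h \<in> carrier G" "x \<in> \<Gamma> g" "y \<in> \<Gamma> h" for g h x y
      using that by blast
    have "x \<cdot> y = 0" if "x \<in> carrier A" "y \<in> carrier A" for x y
      using that(1)
    proof (induction x rule: homogeneous_induct)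
      case (homogeneous g x)
      show ?case using that(2)
        by (induction y rule: homogeneous_induct)
          (use homogeneous zero comp_closed in \<open>auto simp: prod_add_right\<close>)
    qed (use that in \<open>simp add: prod_add_left\<close>)
    then show False using assms by (auto simp: nonzero_product_def)
  qed
  then show ?thesis using that by blast
qed

section \<open>Simplicity and centrality of the quotient\<close>

context split_centroid
begin

lemma graded_simple_Q: "graded_simple (G Mod H) Q Qc"
proof -
  have "nonzero_product A" using gr_simple by (simp add: graded_simple_def)
  then obtain g h x y where *: "g \<in> carrier G" "h \<in> carrier G" "x \<in> \<Gamma> g" "y \<in> \<Gamma> h" "x \<cdot> y \<noteq> 0"
    by (rule homogeneous_product)
  have xy: "x \<in> carrier A" "y \<in> carrier A" using * comp_closed by auto
  \<comment> \<open>A nonzero homogeneous product survives in the quotient because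
    \<open>lam\<close> is injective on a single component.\<close>
  have "lam (x \<cdot> y) \<noteq> lam 0"
    using lam_inj[OF _ comp_mult[OF *(1-4)] subspace_0[OF subspace_comp]] * by blast
  then have "lam x \<star>\<^bsub>Q\<^esub> lam y \<noteq> 0"
    using lam_prod[OF xy] lin_on_zero[OF lin_on_lam subspace_carrier] by simp
  then have nz: "nonzero_product Q" using lam_carrier_Q xy by (auto simp: nonzero_product_def)
  have "I = carrier Q" if gI: "graded_ideal (G Mod H) Q Qc I" and I0: "I \<noteq> {0}" for I
  proof -
    have I: "subspace I" "I \<subseteq> carrier Q"
      and Iid: "\<And>a x. a \<in> carrier Q \<Longrightarrow> x \<in> I \<Longrightarrow> a \<star>\<^bsub>Q\<^esub> x \<in> I" "\<And>a x. a \<in> carrier Q \<Longrightarrow> x \<in> I \<Longrightarrow> x \<star>\<^bsub>Q\<^esub> a \<in> I"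
      using gI by (auto simp: graded_ideal_def ideal_of_def)
    \<comment> \<open>The condition is imposed on components because the plain preimage of
      \<open>I\<close> under \<open>lam\<close> is in general not graded: it contains
      \<open>x - d h x\<close> for every \<open>x\<close>.\<close>
    define J where "J = {x \<in> carrier A. \<forall>g. lam (hcomp g x) \<in> I}"
    have lam0: "lam 0 = 0" using lin_on_zero[OF lin_on_lam subspace_carrier] .
    have J_hom: "x \<in> J \<longleftrightarrow> lam x \<in> I" if "g \<in> carrier G" "x \<in> \<Gamma> g" for g x
      using comp_closed[OF that] subspace_0[OF I(1)]
      by (auto simp: J_def hcomp_homogeneous[OF that] lam0)
    have IJ: "I \<subseteq> J"
    proof
      fix x assume x: "x \<in> I"
      then have xQ: "x \<in> carrier Q" using I by blast
      have "lam (hcomp g x) \<in> I" for g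
      proof (cases "hcomp g x = 0")
        case True
        then show ?thesis using lam0 subspace_0[OF I(1)] by simp
      next
        case False
        then have g: "g \<in> carrier G" "sec g = g" using hcomp_outside hcomp_Q[OF xQ] by auto
        then have "pQ (H #> g) x = hcomp g x"
          using rcosetsI[OF subgroup.subset[OF subgroup_H] g(1)] by (simp add: pQ_def sec_def)
        then have "hcomp g x \<in> I"
          using graded_real_algebra.graded_ideal_hcomp[OF graded_real_algebra_Q gI x, of "H #> g"]
          by (simp add: graded_hcomp_Q[OF xQ])
        then show ?thesis using I by (auto simp: carrier_Q)
      qed
      then show "x \<in> J" using xQ by (simp add: J_def carrier_Q)
    qed
    have "graded_ideal G A \<Gamma> J"
    proof (rule graded_idealI)
      show "subspace J"
        using I(1) subspace_carrier unfolding J_def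
        by (auto simp: subspace_def hcomp_zero lam0 hcomp_add hcomp_scale hcomp_closed
            lin_on_add[OF lin_on_lam] lin_on_scale[OF lin_on_lam])
      show "J \<subseteq> carrier A" by (auto simp: J_def)
      show "hcomp g x \<in> J" if "g \<in> carrier G" "x \<in> J" for g x
        using that J_hom[OF that(1) hcomp_in[OF that(1)]] by (simp add: J_def)
      fix g h a x assume *: "g \<in> carrier G" "h \<in> carrier G" "a \<in> \<Gamma> g" "x \<in> \<Gamma> h" "x \<in> J"
      have ax: "a \<in> carrier A" "x \<in> carrier A" using * comp_closed by auto
      have "lam (a \<cdot> x) \<in> I" "lam (x \<cdot> a) \<in> I"
        using lam_prod ax Iid lam_carrier_Q J_hom[OF *(2,4)] *(5) by auto
      then show "a \<cdot> x \<in> J" "x \<cdot> a \<in> J"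
        using J_hom[OF _ comp_mult[OF *(1-4)]] J_hom[OF _ comp_mult[OF *(2,1,4,3)]] *(1,2) by auto
    qed
    moreover have "J \<noteq> {0}" using I0 IJ subspace_0[OF I(1)] by blast
    ultimately have J: "J = carrier A" using gr_simple by (auto simp: graded_simple_def)
    have "x \<in> I" if "x \<in> carrier Q" for x
    proof -
      have x: "x \<in> carrier A" "lam x = x" using that by (auto simp: carrier_Q)
      have "lam (\<Sum>g | hcomp g x \<noteq> 0. hcomp g x) = (\<Sum>g | hcomp g x \<noteq> 0. lam (hcomp g x))"
        by (rule lin_on_sum[OF lin_on_lam subspace_carrier finite_hcomp hcomp_closed])
      moreover have "\<dots> \<in> I"
        by (rule subspace_sum[OF I(1)]) (use x J in \<open>auto simp: J_def\<close>)
      ultimately show ?thesis using x sum_hcomp by simp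
    qed
    then show ?thesis using I by blast
  qed
  then show ?thesis using nz by (auto simp: graded_simple_def)
qed

text \<open>\<open>c\<close> lifts to a central operator \<open>e\<close> of \<open>A\<close> of
  degree \<open>k = rep q\<close>: apply \<open>lam\<close>, then \<open>c\<close>, then return with
  \<open>d\<close> to degree \<open>k \<otimes> g\<close>. By \<open>centroid_d\<close> the lift is
  zero or a real multiple of \<open>d k\<close> with \<open>k\<close> in \<open>H\<close>, and
  modulo \<open>lam\<close> the operator \<open>d k\<close> is the identity.\<close>

lemma centroid_comp_Q:
  assumes q: "q \<in> rcosets H" and c: "c \<in> centroid_comp (G Mod H) Q Qc q"
  shows "\<exists>r. \<forall>x\<in>carrier Q. c x = r *\<^sub>R x" "q \<noteq> H \<Longrightarrow> c = 0"
proof -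
  define k where "k = rep q"
  have k: "k \<in> carrier G" "q = H #> k" using rep_in[OF q] by (auto simp: k_def)
  note cC = graded_real_algebra.centroid_compD[OF graded_real_algebra_Q c]
  note cD = graded_real_algebra.centroidD[OF graded_real_algebra_Q cC(1)]
  have lin_clam: "lin_on (carrier A) (\<lambda>x. c (lam x))"
    using lin_on_comp[OF lin_on_lam cD(1)] lam_carrier_Q by blast
  have clam: "c (lam x) \<in> \<Gamma> (sec (k \<otimes> g))" if "g \<in> carrier G" "x \<in> \<Gamma> g" for g x
  proof -
    have "lam x \<in> Qc (H #> g)" using lam_homogeneous(2)[OF that] Qc_sec[OF that(1)] by simp
    then have "c (lam x) \<in> Qc (q \<otimes>\<^bsub>G Mod H\<^esub> (H #> g))"
      using cC(2)[of "H #> g"] rcosetsI[OF subgroup.subset[OF subgroup_H] that(1)] by (simp add: carrier_Mod)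
    moreover have "q \<otimes>\<^bsub>G Mod H\<^esub> (H #> g) = H #> (k \<otimes> g)" using Mod_mult[OF k(1) that(1)] k(2) by simp
    ultimately show ?thesis using Qc_sec[of "k \<otimes> g"] k that by simp
  qed
  define F where "F g x = d (k \<otimes> g \<otimes> inv (sec (k \<otimes> g))) (c (lam x))" for g x
  have F: "F g x \<in> \<Gamma> (k \<otimes> g)" "lam (F g x) = c (lam x)" if "g \<in> carrier G" "x \<in> \<Gamma> g" for g x
    using lam_lift[OF _ clam[OF that]] that k by (auto simp: F_def)
  have F_lin: "lin_on (\<Gamma> g) (F g)" if "g \<in> carrier G" for g
  proof -
    have "lin_on (carrier A) (F g)"
      unfolding F_def using that k(1) cD(2) lam_carrier_Q
      by (intro lin_on_comp[OF lin_clam d_lin] sec_inv(1)) (auto simp: carrier_Q)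
    then show ?thesis using lin_on_subset comp_subset[OF that] by blast
  qed
  define e where "e = lin_ext F"
  have e_hom: "e x = F g x" if "g \<in> carrier G" "x \<in> \<Gamma> g" for g x
    unfolding e_def using F_lin that by (rule lin_ext_homogeneous)
  have e: "e \<in> centroid_comp G A \<Gamma> k"
    unfolding e_def
  proof (rule lin_ext_centroid_comp[OF k(1) F_lin F(1)])
    fix g h x y assume *: "g \<in> carrier G" "h \<in> carrier G" "x \<in> \<Gamma> g" "y \<in> \<Gamma> h"
    have xy: "x \<in> carrier A" "y \<in> carrier A" using * comp_closed by auto
    have F': "F g x \<in> carrier A" "F h y \<in> carrier A"
      using F(1)[OF *(1,3)] F(1)[OF *(2,4)] * k comp_closed by (meson m_closed)+
    have eqs: "k \<otimes> (g \<otimes> h) = g \<otimes> (k \<otimes> h)" "k \<otimes> (g \<otimes> h) = k \<otimes> g \<otimes> h"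
      using * k by (simp_all add: m_ac)
    have FG: "F (g \<otimes> h) (x \<cdot> y) \<in> \<Gamma> (k \<otimes> (g \<otimes> h))" "lam (F (g \<otimes> h) (x \<cdot> y)) = c (lam (x \<cdot> y))"
      using F[OF _ comp_mult[OF *]] * by auto
    \<comment> \<open>Both sides of each identity lie in one component, where \<open>lam\<close> is
      injective, so it suffices to compare their images; these agree because \<open>c\<close> is
      central in \<open>Q\<close>.\<close>
    have "lam (x \<cdot> F h y) = c (lam (x \<cdot> y))"
      using lam_prod[OF xy] lam_prod[OF xy(1) F'(2)] F(2)[OF *(2,4)] cD(4)[OF lam_carrier_Q lam_carrier_Q, OF xy] by simp
    moreover have "x \<cdot> F h y \<in> \<Gamma> (k \<otimes> (g \<otimes> h))"
      using comp_mult[OF *(1) _ *(3) F(1)[OF *(2,4)]] * k eqs(1) by simp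
    ultimately show "F (g \<otimes> h) (x \<cdot> y) = x \<cdot> F h y"
      using lam_inj[OF _ FG(1)] FG(2) * k by (metis m_closed)
    have "lam (F g x \<cdot> y) = c (lam (x \<cdot> y))"
      using lam_prod[OF xy] lam_prod[OF F'(1) xy(2)] F(2)[OF *(1,3)] cD(5)[OF lam_carrier_Q lam_carrier_Q, OF xy] by simp
    moreover have "F g x \<cdot> y \<in> \<Gamma> (k \<otimes> (g \<otimes> h))"
      using comp_mult[OF _ *(2) F(1)[OF *(1,3)] *(4)] * k eqs(2) by simp
    ultimately show "F (g \<otimes> h) (x \<cdot> y) = F g x \<cdot> y"
      using lam_inj[OF _ FG(1)] FG(2) * k by (metis m_closed)
  qed
  have c_zero: "c = 0" if "e = 0"
  proof
    fix x show "c x = 0 x"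
    proof (cases "x \<in> carrier Q")
      case True
      then have x: "x \<in> carrier A" "lam x = x" by (auto simp: carrier_Q)
      have "c (lam x) = 0"
        using x(1)
      proof (induction x rule: homogeneous_induct)
        case (homogeneous g x)
        then show ?case using F(2)[OF homogeneous] e_hom[OF homogeneous] \<open>e = 0\<close>
            lin_on_zero[OF lin_on_lam subspace_carrier] by simp
      qed (simp add: lin_on_add[OF lin_clam])
      then show ?thesis using x by simp
    qed (use cD(3) in simp)
  qed
  have c_scalar: "k \<in> H \<and> (\<exists>r. \<forall>x\<in>carrier Q. c x = r *\<^sub>R x)" if e_nz: "e \<noteq> 0"
  proof -
    obtain r where r: "k \<in> H" "\<And>x. x \<in> carrier A \<Longrightarrow> e x = r *\<^sub>R d k x"
      using centroid_d[OF k(1) e e_nz] by blast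
    have "c (lam x) = r *\<^sub>R lam x" if "x \<in> carrier A" for x
      using that
    proof (rule lin_on_eq[OF lin_clam lin_on_scaled[OF lin_on_lam]])
      fix g x assume gx: "g \<in> carrier G" "x \<in> \<Gamma> g"
      have x: "x \<in> carrier A" using comp_closed[OF gx] .
      have "c (lam x) = lam (r *\<^sub>R d k x)" using F(2)[OF gx] e_hom[OF gx] r(2)[OF x] by simp
      then show "c (lam x) = r *\<^sub>R lam x"
        using lin_on_scale[OF lin_on_lam d_closed[OF r(1) x]] lam_d[OF r(1) x] by simp
    qed
    then have "c x = r *\<^sub>R x" if "x \<in> carrier Q" for x
      using that by (metis carrier_Q)
    then show ?thesis using r(1) by blast
  qed
  show "\<exists>r. \<forall>x\<in>carrier Q. c x = r *\<^sub>R x"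
  proof (cases "e = 0")
    case True
    then have "\<forall>x\<in>carrier Q. c x = 0 *\<^sub>R x" using c_zero by simp
    then show ?thesis by blast
  next
    case False
    then show ?thesis using c_scalar by blast
  qed
  assume "q \<noteq> H"
  then have "k \<notin> H" using k subgroup.rcos_const[OF subgroup_H is_group] by blast
  then show "c = 0" using c_scalar c_zero by blast
qed

lemma central_simple_Q: "central_simple Q"
proof -
  have one: "\<one>\<^bsub>G Mod H\<^esub> = H" by (simp add: FactGroup_def)
  have "carrier (centroid Q) = scalar_operators Q"
  proof (rule graded_real_algebra.central_of_homogeneous[OF graded_real_algebra_Q])
    fix q assume "q \<in> carrier (G Mod H)" "q \<noteq> \<one>\<^bsub>G Mod H\<^esub>"
    then show "centroid_comp (G Mod H) Q Qc q \<subseteq> {0}"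
      using centroid_comp_Q(2) by (auto simp: carrier_Mod one)
  next
    show "centroid_comp (G Mod H) Q Qc \<one>\<^bsub>G Mod H\<^esub> \<subseteq> scalar_operators Q"
    proof
      fix c assume c: "c \<in> centroid_comp (G Mod H) Q Qc \<one>\<^bsub>G Mod H\<^esub>"
      have "H \<in> rcosets H" using subgroup.subgroup_in_rcosets[OF subgroup_H is_group] .
      then obtain r where "\<forall>x\<in>carrier Q. c x = r *\<^sub>R x"
        using centroid_comp_Q(1)[of H c] c one by auto
      moreover have "c x = 0" if "x \<notin> carrier Q" for x
        using graded_real_algebra.centroidD(3)[OF graded_real_algebra_Q
            graded_real_algebra.centroid_compD(1)[OF graded_real_algebra_Q c] that] .
      ultimately have "c = (\<lambda>x. if x \<in> carrier Q then r *\<^sub>R x else 0)" by auto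
      then show "c \<in> scalar_operators Q" by (auto simp: scalar_operators_def)
    qed
  qed
  then show ?thesis
    using graded_real_algebra.simple_of_graded_simple[OF graded_real_algebra_Q graded_simple_Q]
    by (simp add: central_simple_def)
qed

end

context split_centroid
begin

text \<open>The map \<open>l\<close> is multiplicative but remembers only the coset of a degree.
  Bijectivity on single components is what allows the factor \<open>u\<^sub>g\<close> to restore the
  degree later.\<close>

lemma quotient:
  "\<exists>(Q :: 'a alg) \<Delta> l. real_algebra Q \<and> central_simple Q \<and> grading (G Mod H) Q \<Delta> \<and>
    lin_on (carrier A) l \<and> (\<forall>x\<in>carrier A. \<forall>y\<in>carrier A. l (x \<cdot> y) = l x \<star>\<^bsub>Q\<^esub> l y) \<and>
    (\<forall>g\<in>carrier G. bij_betw l (\<Gamma> g) (\<Delta> (H #> g)))"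
proof -
  have "bij_betw lam (\<Gamma> g) (Qc (H #> g))" if "g \<in> carrier G" for g
    unfolding bij_betw_def using lam_inj[OF that] lam_image[OF that] Qc_sec[OF that]
    by (auto intro: inj_onI)
  then show ?thesis
    using real_algebra_Q central_simple_Q grading_Q lin_on_lam lam_prod by blast
qed

end

section \<open>Twisting by a cocycle of signs\<close>

lemma lin_on_sum_fun: "(\<And>i. i \<in> S \<Longrightarrow> lin_on V (f i)) \<Longrightarrow> lin_on V (\<lambda>x. \<Sum>i\<in>S. f i x)"
  by (auto simp: lin_on_def scaleR_sum_right simp flip: sum.distrib intro!: sum.cong)

text \<open>A symmetric 2-cocycle with values 1 and -1, which is what \<open>s_sq\<close> says. Such
  a twist undoes itself, and symmetry keeps central operators compatible with multiplication from
  both sides.\<close>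

locale twist = graded_real_algebra A G \<Gamma>
  for A :: "('a::real_vector, 'm) alg_scheme" and G :: "('g, 'n) monoid_scheme" (structure)
    and \<Gamma> :: "'g \<Rightarrow> 'a set" +
  fixes s :: "'g \<Rightarrow> 'g \<Rightarrow> real"
  assumes s_sq: "g \<in> carrier G \<Longrightarrow> h \<in> carrier G \<Longrightarrow> s g h * s g h = 1"
    and s_sym: "g \<in> carrier G \<Longrightarrow> h \<in> carrier G \<Longrightarrow> s g h = s h g"
    and s_cocycle: "g \<in> carrier G \<Longrightarrow> h \<in> carrier G \<Longrightarrow> k \<in> carrier G \<Longrightarrow>
      s g h * s (g \<otimes> h) k = s h k * s g (h \<otimes> k)"
begin

text \<open>The inner extension makes the product linear in \<open>y\<close>, the outer one in
  \<open>x\<close>; only its values on homogeneous pairs, in \<open>tw_homogeneous\<close>,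
  matter.\<close>

definition tw :: "'a \<Rightarrow> 'a \<Rightarrow> 'a" where
  "tw x y = lin_ext (\<lambda>g x'. lin_ext (\<lambda>k y'. s g k *\<^sub>R (x' \<cdot> y')) y) x"

definition T :: "'a alg" where "T = \<lparr>carrier = carrier A, aprod = tw\<rparr>"

lemma T_simps: "carrier T = carrier A" "x \<star>\<^bsub>T\<^esub> y = tw x y"
  by (simp_all add: T_def)

lemma tw_inner_lin: "x \<in> carrier A \<Longrightarrow> k \<in> carrier G \<Longrightarrow> lin_on (\<Gamma> k) (\<lambda>y'. s g k *\<^sub>R (x \<cdot> y'))"
  using lin_on_subset[OF lin_on_scaled[OF lin_on_mult_left] comp_subset] .

lemma tw_outer_lin:
  assumes "g \<in> carrier G"
  shows "lin_on (\<Gamma> g) (\<lambda>x'. lin_ext (\<lambda>k y'. s g k *\<^sub>R (x' \<cdot> y')) y)"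
  unfolding lin_ext_def
  by (intro lin_on_sum_fun lin_on_scaled lin_on_subset[OF lin_on_mult_right comp_subset[OF assms]] hcomp_closed)

lemma tw_homogeneous:
  assumes "g \<in> carrier G" "h \<in> carrier G" "x \<in> \<Gamma> g" "y \<in> \<Gamma> h"
  shows "tw x y = s g h *\<^sub>R (x \<cdot> y)"
proof -
  have "tw x y = lin_ext (\<lambda>k y'. s g k *\<^sub>R (x \<cdot> y')) y"
    unfolding tw_def using tw_outer_lin assms(1,3) by (rule lin_ext_homogeneous)
  also have "\<dots> = s g h *\<^sub>R (x \<cdot> y)"
    using tw_inner_lin[OF comp_closed[OF assms(1,3)]] assms(2,4) by (rule lin_ext_homogeneous)
  finally show ?thesis .
qed

lemma mult_tw:
  assumes "g \<in> carrier G" "h \<in> carrier G" "x \<in> \<Gamma> g" "y \<in> \<Gamma> h"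
  shows "x \<cdot> y = s g h *\<^sub>R tw x y"
  using tw_homogeneous[OF assms] s_sq[OF assms(1,2)] by simp

lemma tw_lin_left: "lin_on (carrier A) (\<lambda>x. tw x y)"
  unfolding tw_def by (rule lin_on_lin_ext[OF tw_outer_lin])

lemma tw_lin_right: "lin_on (carrier A) (\<lambda>y. tw x y)"
proof -
  have "lin_on (carrier A) (\<lambda>y. \<Sum>g | hcomp g x \<noteq> 0. lin_ext (\<lambda>k y'. s g k *\<^sub>R (hcomp g x \<cdot> y')) y)"
    by (intro lin_on_sum_fun lin_on_lin_ext tw_inner_lin hcomp_closed)
  then show ?thesis by (simp add: tw_def lin_ext_def[of _ x])
qed

lemma tw_closed: "tw x y \<in> carrier A"
proof -
  have "lin_ext (\<lambda>k y'. s g k *\<^sub>R (x' \<cdot> y')) y \<in> carrier A" if "x' \<in> carrier A" for g x'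
    using that comp_closed by (intro lin_ext_in[OF subspace_carrier] subspace_scale[OF subspace_carrier] prod_closed)
  then show ?thesis unfolding tw_def by (rule lin_ext_in[OF subspace_carrier]) (rule comp_closed)
qed

lemma graded_real_algebra_T: "graded_real_algebra T G \<Gamma>"
proof -
  have "real_algebra T"
    by standard (auto simp: T_simps tw_closed subspace_carrier lin_on_add[OF tw_lin_left]
        lin_on_add[OF tw_lin_right] lin_on_scale[OF tw_lin_left] lin_on_scale[OF tw_lin_right])
  moreover have "grading G T \<Gamma>"
  proof -
    have "tw x y \<in> \<Gamma> (g \<otimes> h)" if "g \<in> carrier G" "h \<in> carrier G" "x \<in> \<Gamma> g" "y \<in> \<Gamma> h" for g h x y
      using tw_homogeneous[OF that] comp_mult[OF that] that subspace_scale[OF subspace_comp] by simp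
    with grading[unfolded grading_def, THEN conjunct1] grading[unfolded grading_def, THEN conjunct2, THEN conjunct1]
    show ?thesis unfolding grading_def T_simps by (intro conjI) (assumption | blast)+
  qed
  ultimately show ?thesis
    using comm_group_axioms by (simp add: graded_real_algebra_def graded_real_algebra_axioms_def)
qed

text \<open>On homogeneous factors the two products differ by an invertible scalar, so graded ideals
  are the same for both. Ideals that are not graded can differ.\<close>

lemma graded_simple_T:
  assumes "graded_simple G A \<Gamma>"
  shows "graded_simple G T \<Gamma>"
proof -
  have "nonzero_product A" using assms by (simp add: graded_simple_def)
  then obtain g h x y where *: "g \<in> carrier G" "h \<in> carrier G" "x \<in> \<Gamma> g" "y \<in> \<Gamma> h" "x \<cdot> y \<noteq> 0"
    by (rule homogeneous_product)
  then have "tw x y \<noteq> 0" using mult_tw by force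
  then have "nonzero_product T" using * comp_closed by (auto simp: nonzero_product_def T_simps)
  moreover have "I = carrier A" if I: "graded_ideal G T \<Gamma> I" and nz: "I \<noteq> {0}" for I
  proof -
    have sI: "subspace I" "I \<subseteq> carrier A"
      and id: "\<And>a x. a \<in> carrier A \<Longrightarrow> x \<in> I \<Longrightarrow> tw a x \<in> I" "\<And>a x. a \<in> carrier A \<Longrightarrow> x \<in> I \<Longrightarrow> tw x a \<in> I"
      using I by (auto simp: graded_ideal_def ideal_of_def T_simps)
    \<comment> \<open>The projections depend only on the carrier and the components, which the twist
      leaves alone.\<close>
    have hc: "graded_real_algebra.hcomp T G \<Gamma> = hcomp"
      by (simp add: fun_eq_iff hcomp_def graded_real_algebra.hcomp_def[OF graded_real_algebra_T] T_simps)
    have "graded_ideal G A \<Gamma> I"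
    proof (rule graded_idealI[OF sI])
      show "hcomp g x \<in> I" if "x \<in> I" for g x
        using graded_real_algebra.graded_ideal_hcomp[OF graded_real_algebra_T I that] by (simp add: hc)
      fix g h a x assume *: "g \<in> carrier G" "h \<in> carrier G" "a \<in> \<Gamma> g" "x \<in> \<Gamma> h" "x \<in> I"
      show "a \<cdot> x \<in> I" "x \<cdot> a \<in> I"
        using mult_tw[OF *(1-4)] mult_tw[OF *(2,1,4,3)] id[OF comp_closed[OF *(1,3)] *(5)]
        by (auto intro: subspace_scale[OF sI(1)])
    qed
    then show ?thesis using assms nz by (auto simp: graded_simple_def)
  qed
  ultimately show ?thesis by (auto simp: graded_simple_def T_simps)
qed

text \<open>\<open>c\<close> is treated like multiplication by an element of degree
  \<open>k\<close>: on degree \<open>g\<close> it receives the sign that the twisted product would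
  give to such an element.\<close>

definition twist_op :: "'g \<Rightarrow> ('a \<Rightarrow> 'a) \<Rightarrow> 'a \<Rightarrow> 'a" where
  "twist_op k c = lin_ext (\<lambda>g x. s k g *\<^sub>R c x)"

text \<open>The cocycle identity with \<open>k\<close> carried past \<open>g\<close> by symmetry. It
  serves multiplication on the left, while \<open>s_cocycle\<close> as it stands serves
  multiplication on the right.\<close>

lemma s_left:
  assumes "g \<in> carrier G" "h \<in> carrier G" "k \<in> carrier G"
  shows "s k (g \<otimes> h) * s g h = s k h * s g (k \<otimes> h)"
  using s_cocycle[OF assms] s_sym[of "g \<otimes> h" k] s_sym[of h k] m_comm[of h k] assms by (simp add: mult.commute)

lemma twist_op_lin:
  assumes "lin_on (carrier A) c" "g \<in> carrier G"
  shows "lin_on (\<Gamma> g) (\<lambda>x. s k g *\<^sub>R c x)"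
  using lin_on_subset[OF lin_on_scaled[OF assms(1)] comp_subset[OF assms(2)]] .

lemma lin_on_twist_op: "lin_on (carrier A) c \<Longrightarrow> lin_on (carrier A) (twist_op k c)"
  unfolding twist_op_def by (intro lin_on_lin_ext twist_op_lin)

lemma twist_op_homogeneous:
  assumes "lin_on (carrier A) c" "g \<in> carrier G" "x \<in> \<Gamma> g"
  shows "twist_op k c x = s k g *\<^sub>R c x"
  unfolding twist_op_def using twist_op_lin[OF assms(1)] assms(2,3) by (rule lin_ext_homogeneous)

lemma centroid_comp_twist:
  assumes k: "k \<in> carrier G" and c: "c \<in> centroid_comp G A \<Gamma> k"
  shows "twist_op k c \<in> centroid_comp G T \<Gamma> k"
proof (rule graded_real_algebra.centroid_compI[OF graded_real_algebra_T k], unfold T_simps)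
  note cD = centroidD[OF centroid_compD(1)[OF c]] and deg = centroid_compD(2)[OF c]
  note hom = twist_op_homogeneous[OF cD(1)]
  show "lin_on (carrier A) (twist_op k c)" using cD(1) by (rule lin_on_twist_op)
  show "twist_op k c x = 0" if "x \<notin> carrier A" for x
    using lin_ext_outside[OF that] by (simp add: twist_op_def)
  show "twist_op k c x \<in> \<Gamma> (k \<otimes> g)" if "g \<in> carrier G" "x \<in> \<Gamma> g" for g x
    using deg[OF that] hom[OF that] subspace_scale[OF subspace_comp] k that by simp
  fix g h x y assume *: "g \<in> carrier G" "h \<in> carrier G" "x \<in> \<Gamma> g" "y \<in> \<Gamma> h"
  have xy: "x \<in> carrier A" "y \<in> carrier A" using * comp_closed by auto
  have "twist_op k c (tw x y) = s g h *\<^sub>R twist_op k c (x \<cdot> y)"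
    by (simp add: tw_homogeneous[OF *] lin_on_scale[OF lin_on_twist_op[OF cD(1)] prod_closed[OF xy]])
  also have "\<dots> = (s k (g \<otimes> h) * s g h) *\<^sub>R c (x \<cdot> y)"
    using hom[OF _ comp_mult[OF *]] * by (simp add: mult.commute)
  finally have eq: "twist_op k c (tw x y) = (s k (g \<otimes> h) * s g h) *\<^sub>R c (x \<cdot> y)" .
  have "tw x (twist_op k c y) = s k h *\<^sub>R tw x (c y)"
    using hom[OF *(2,4)] lin_on_scale[OF tw_lin_right cD(2)[OF xy(2)]] by simp
  also have "\<dots> = (s k h * s g (k \<otimes> h)) *\<^sub>R (x \<cdot> c y)"
    using tw_homogeneous[OF *(1) _ *(3) deg[OF *(2,4)]] * k by simp
  finally show "twist_op k c (tw x y) = tw x (twist_op k c y)"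
    using eq s_left[OF *(1,2) k] cD(4)[OF xy] by simp
  have "tw (twist_op k c x) y = s k g *\<^sub>R tw (c x) y"
    using hom[OF *(1,3)] lin_on_scale[OF tw_lin_left cD(2)[OF xy(1)]] by simp
  also have "\<dots> = (s k g * s (k \<otimes> g) h) *\<^sub>R (c x \<cdot> y)"
    using tw_homogeneous[OF _ *(2) deg[OF *(1,3)] *(4)] * k by simp
  finally show "twist_op k c (tw x y) = tw (twist_op k c x) y"
    using eq s_cocycle[OF k *(1,2)] cD(5)[OF xy] by (simp add: mult.commute)
qed

text \<open>Signs are their own inverses, so the same operation \<open>twist_op\<close> also leads
  back from \<open>T\<close> to \<open>A\<close>.\<close>

lemma centroid_comp_untwist:
  assumes k: "k \<in> carrier G" and c: "c \<in> centroid_comp G T \<Gamma> k"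
  shows "twist_op k c \<in> centroid_comp G A \<Gamma> k"
proof (rule centroid_compI[OF k])
  note cD = graded_real_algebra.centroidD[OF graded_real_algebra_T
      graded_real_algebra.centroid_compD(1)[OF graded_real_algebra_T c], unfolded T_simps]
    and deg = graded_real_algebra.centroid_compD(2)[OF graded_real_algebra_T c]
  note hom = twist_op_homogeneous[OF cD(1)]
  show "lin_on (carrier A) (twist_op k c)" using cD(1) by (rule lin_on_twist_op)
  show "twist_op k c x = 0" if "x \<notin> carrier A" for x
    using lin_ext_outside[OF that] by (simp add: twist_op_def)
  show "twist_op k c x \<in> \<Gamma> (k \<otimes> g)" if "g \<in> carrier G" "x \<in> \<Gamma> g" for g x
    using deg[OF that] hom[OF that] subspace_scale[OF subspace_comp] k that by simp
  fix g h x y assume *: "g \<in> carrier G" "h \<in> carrier G" "x \<in> \<Gamma> g" "y \<in> \<Gamma> h"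
  have xy: "x \<in> carrier A" "y \<in> carrier A" using * comp_closed by auto
  have "twist_op k c (x \<cdot> y) = s k (g \<otimes> h) *\<^sub>R c (x \<cdot> y)"
    using hom[OF _ comp_mult[OF *]] * by simp
  also have "\<dots> = (s k (g \<otimes> h) * s g h) *\<^sub>R c (tw x y)"
    by (simp add: mult_tw[OF *] lin_on_scale[OF cD(1) tw_closed])
  finally have eq: "twist_op k c (x \<cdot> y) = (s k (g \<otimes> h) * s g h) *\<^sub>R c (tw x y)" .
  have "x \<cdot> twist_op k c y = s k h *\<^sub>R (x \<cdot> c y)"
    using hom[OF *(2,4)] prod_scale_right[OF xy(1) cD(2)[OF xy(2)]] by simp
  also have "\<dots> = (s k h * s g (k \<otimes> h)) *\<^sub>R tw x (c y)"
    using mult_tw[OF *(1) _ *(3) deg[OF *(2,4)]] * k by simp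
  finally show "twist_op k c (x \<cdot> y) = x \<cdot> twist_op k c y"
    using eq s_left[OF *(1,2) k] cD(4)[OF xy] by simp
  have "twist_op k c x \<cdot> y = s k g *\<^sub>R (c x \<cdot> y)"
    using hom[OF *(1,3)] prod_scale_left[OF cD(2)[OF xy(1)] xy(2)] by simp
  also have "\<dots> = (s k g * s (k \<otimes> g) h) *\<^sub>R tw (c x) y"
    using mult_tw[OF _ *(2) deg[OF *(1,3)] *(4)] * k by simp
  finally show "twist_op k c (x \<cdot> y) = twist_op k c x \<cdot> y"
    using eq s_cocycle[OF k *(1,2)] cD(5)[OF xy] by (simp add: mult.commute)
qed

text \<open>When the \<open>c h\<close> multiply with the cocycle \<open>s\<close>, the twist
  absorbs it and the new operators multiply like the elements of \<open>H\<close>. A homogeneous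
  central operator of \<open>T\<close> is untwisted, compared with \<open>c k\<close>, and twisted
  back.\<close>

lemma split_centroid_T:
  assumes gs: "graded_simple G A \<Gamma>" and H: "subgroup H G"
    and s_one: "\<And>g. g \<in> carrier G \<Longrightarrow> s \<one> g = 1"
    and c: "\<And>h. h \<in> H \<Longrightarrow> c h \<in> centroid_comp G A \<Gamma> h"
    and c_mult: "\<And>h k x. h \<in> H \<Longrightarrow> k \<in> H \<Longrightarrow> x \<in> carrier A \<Longrightarrow> c h (c k x) = s h k *\<^sub>R c (h \<otimes> k) x"
    and c_one: "\<And>x. x \<in> carrier A \<Longrightarrow> c \<one> x = x"
    and cen: "\<And>k f. k \<in> carrier G \<Longrightarrow> f \<in> centroid_comp G A \<Gamma> k \<Longrightarrow> f \<noteq> 0 \<Longrightarrow>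
      k \<in> H \<and> (\<exists>r. \<forall>x\<in>carrier A. f x = r *\<^sub>R c k x)"
  shows "split_centroid T G \<Gamma> H (\<lambda>h. twist_op h (c h))"
proof -
  have HG: "h \<in> carrier G" if "h \<in> H" for h using that H subgroup.subset by blast
  have c_lin: "lin_on (carrier A) (c h)" if "h \<in> H" for h
    using centroidD(1) centroid_compD(1) c[OF that] by blast
  have c_closed: "c h x \<in> carrier A" if "h \<in> H" "x \<in> carrier A" for h x
    using centroidD(2) centroid_compD(1) c[OF that(1)] that(2) by blast
  note hom = twist_op_homogeneous[OF c_lin]
  have t_lin: "lin_on (carrier A) (twist_op h (c h))" if "h \<in> H" for h
    using lin_on_twist_op[OF c_lin[OF that]] .
  have t_closed: "twist_op h (c h) x \<in> carrier A" if "h \<in> H" "x \<in> carrier A" for h x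
    using centroid_comp_twist[OF HG[OF that(1)] c[OF that(1)]] that(2)
      graded_real_algebra.centroidD(2)[OF graded_real_algebra_T
        graded_real_algebra.centroid_compD(1)[OF graded_real_algebra_T]] by (metis T_simps(1))
  have t_mult: "twist_op h (c h) (twist_op k (c k) x) = twist_op (h \<otimes> k) (c (h \<otimes> k)) x"
    if hk: "h \<in> H" "k \<in> H" and x: "x \<in> carrier A" for h k x
  proof -
    have hkH: "h \<otimes> k \<in> H" using hk subgroup.m_closed[OF H] by blast
    show ?thesis
    proof (rule lin_on_eq[OF _ t_lin[OF hkH] x])
      show "lin_on (carrier A) (\<lambda>x. twist_op h (c h) (twist_op k (c k) x))"
        using lin_on_comp[OF t_lin[OF hk(2)] t_lin[OF hk(1)]] t_closed[OF hk(2)] by blast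
      fix g x assume gx: "g \<in> carrier G" "x \<in> \<Gamma> g"
      have xA: "x \<in> carrier A" using comp_closed[OF gx] .
      have ck: "c k x \<in> \<Gamma> (k \<otimes> g)" using centroid_compD(2)[OF c[OF hk(2)] gx] .
      have "twist_op h (c h) (twist_op k (c k) x) = s k g *\<^sub>R twist_op h (c h) (c k x)"
        using hom[OF hk(2) gx] lin_on_scale[OF t_lin[OF hk(1)] c_closed[OF hk(2) xA]] by simp
      also have "\<dots> = (s k g * s h (k \<otimes> g) * s h k) *\<^sub>R c (h \<otimes> k) x"
        using hom[OF hk(1) _ ck] HG hk gx(1) c_mult[OF hk xA] by simp
      \<comment> \<open>The cocycle identity for \<open>h\<close>, \<open>k\<close>,
        \<open>g\<close>; the remaining factor \<open>s h k\<close> then occurs twice and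
        cancels.\<close>
      also have "s k g * s h (k \<otimes> g) * s h k = s (h \<otimes> k) g"
        using s_cocycle[OF HG HG gx(1), OF hk] s_sq[OF HG HG, OF hk] by (metis mult.commute mult.left_commute mult_1)
      finally show "twist_op h (c h) (twist_op k (c k) x) = twist_op (h \<otimes> k) (c (h \<otimes> k)) x"
        using hom[OF hkH gx] by simp
    qed
  qed
  have t_one: "twist_op \<one> (c \<one>) x = x" if "x \<in> carrier A" for x
    using that
  proof (induction x rule: homogeneous_induct)
    case (homogeneous g x)
    then show ?case
      using hom[OF subgroup.one_closed[OF H] homogeneous] s_one c_one comp_closed[OF homogeneous] by simp
  qed (simp add: lin_on_add[OF t_lin[OF subgroup.one_closed[OF H]]])
  have t_cen: "k \<in> H \<and> (\<exists>r. \<forall>x\<in>carrier A. f x = r *\<^sub>R twist_op k (c k) x)"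
    if k: "k \<in> carrier G" and f: "f \<in> centroid_comp G T \<Gamma> k" and nz: "f \<noteq> 0" for k f
  proof -
    have f_centroid: "f \<in> carrier (centroid T)"
      using graded_real_algebra.centroid_compD(1)[OF graded_real_algebra_T f] .
    have f_lin: "lin_on (carrier A) f"
      using graded_real_algebra.centroidD(1)[OF graded_real_algebra_T f_centroid] by (simp add: T_simps)
    have f_hom: "f x = s k g *\<^sub>R twist_op k f x" if "g \<in> carrier G" "x \<in> \<Gamma> g" for g x
      using twist_op_homogeneous[OF f_lin that] s_sq[OF k that(1)] by simp
    have "twist_op k f \<noteq> 0"
    proof
      assume zero: "twist_op k f = 0"
      have "f x = 0" for x
      proof (cases "x \<in> carrier A")
        case True
        then show ?thesis
          by (induction x rule: homogeneous_induct) (use f_hom zero in \<open>auto simp: lin_on_add[OF f_lin]\<close>)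
      qed (use graded_real_algebra.centroidD(3)[OF graded_real_algebra_T f_centroid] in \<open>simp add: T_simps\<close>)
      then show False using nz by auto
    qed
    then obtain r where r: "k \<in> H" "\<And>x. x \<in> carrier A \<Longrightarrow> twist_op k f x = r *\<^sub>R c k x"
      using cen[OF k centroid_comp_untwist[OF k f]] by blast
    have "f x = r *\<^sub>R twist_op k (c k) x" if "x \<in> carrier A" for x
    proof (rule lin_on_eq[OF f_lin lin_on_scaled[OF t_lin[OF r(1)]] that])
      show "f x = r *\<^sub>R twist_op k (c k) x" if "g \<in> carrier G" "x \<in> \<Gamma> g" for g x
        using f_hom[OF that] r(2)[OF comp_closed[OF that]] hom[OF r(1) that] by (simp add: mult.commute)
    qed
    then show ?thesis using r(1) by blast
  qed
  show ?thesis
    unfolding split_centroid_def split_centroid_axioms_def T_simps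
    using graded_real_algebra_T graded_simple_T[OF gs] H centroid_comp_twist[OF HG c] t_mult t_one t_cen
    by blast
qed

end

section \<open>Loop algebras\<close>

context real_algebra
begin

lemma complexified_prod_zero:
  assumes "p \<in> carrier A \<times> carrier A"
  shows "complexified_prod A p 0 = 0" "complexified_prod A 0 p = 0"
  using assms by (auto simp: complexified_prod_def zero_prod_def prod_zero)

lemma complexified_prod_add:
  assumes "p \<in> carrier A \<times> carrier A" "q \<in> carrier A \<times> carrier A" "r \<in> carrier A \<times> carrier A"
  shows "complexified_prod A (p + q) r = complexified_prod A p r + complexified_prod A q r"
    "complexified_prod A r (p + q) = complexified_prod A r p + complexified_prod A r q"
  using assms by (auto simp: complexified_prod_def plus_prod_def prod_add_left prod_add_right)

text \<open>The index set of \<open>convolution\<close> depends on the supports, which change under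
  addition. Over a fixed rectangle \<open>S \<times> T\<close> additivity becomes a termwise
  statement.\<close>

lemma tensor_prod_superset:
  assumes x: "x \<in> carrier (tensor_group_algebra G A)" and y: "y \<in> carrier (tensor_group_algebra G A)"
    and S: "finite S" "{g. x g \<noteq> 0} \<subseteq> S" and T: "finite T" "{g. y g \<noteq> 0} \<subseteq> T"
  shows "(x \<star>\<^bsub>tensor_group_algebra G A\<^esub> y) k =
    (\<Sum>p\<in>S \<times> T. if fst p \<otimes>\<^bsub>G\<^esub> snd p = k then complexified_prod A (x (fst p)) (y (snd p)) else 0)"
proof -
  have xy: "x g \<in> carrier A \<times> carrier A" "y g \<in> carrier A \<times> carrier A" for g
    using x y by (auto simp: tensor_group_algebra_def)
  let ?U = "{(g, h). x g \<noteq> 0 \<and> y h \<noteq> 0 \<and> g \<otimes>\<^bsub>G\<^esub> h = k}"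
  have "(x \<star>\<^bsub>tensor_group_algebra G A\<^esub> y) k = (\<Sum>p\<in>?U. complexified_prod A (x (fst p)) (y (snd p)))"
    by (simp add: tensor_group_algebra_def convolution_def case_prod_beta)
  also have "\<dots> = (\<Sum>p\<in>?U. if fst p \<otimes>\<^bsub>G\<^esub> snd p = k then complexified_prod A (x (fst p)) (y (snd p)) else 0)"
    by (rule sum.cong) auto
  also have "\<dots> = (\<Sum>p\<in>S \<times> T. if fst p \<otimes>\<^bsub>G\<^esub> snd p = k then complexified_prod A (x (fst p)) (y (snd p)) else 0)"
  proof (rule sum.mono_neutral_left)
    show "finite (S \<times> T)" using S T by simp
    show "?U \<subseteq> S \<times> T" using S T by auto
    show "\<forall>p\<in>S \<times> T - ?U. (if fst p \<otimes>\<^bsub>G\<^esub> snd p = k then complexified_prod A (x (fst p)) (y (snd p)) else 0) = 0"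
      using complexified_prod_zero[OF xy(1)] complexified_prod_zero[OF xy(2)] by auto
  qed
  finally show ?thesis .
qed

lemma tensor_prod_add:
  assumes x: "x \<in> carrier (tensor_group_algebra G A)" and y: "y \<in> carrier (tensor_group_algebra G A)"
    and z: "z \<in> carrier (tensor_group_algebra G A)" and xy: "x + y \<in> carrier (tensor_group_algebra G A)"
  shows "(x + y) \<star>\<^bsub>tensor_group_algebra G A\<^esub> z =
      x \<star>\<^bsub>tensor_group_algebra G A\<^esub> z + y \<star>\<^bsub>tensor_group_algebra G A\<^esub> z" (is ?l)
    and "z \<star>\<^bsub>tensor_group_algebra G A\<^esub> (x + y) =
      z \<star>\<^bsub>tensor_group_algebra G A\<^esub> x + z \<star>\<^bsub>tensor_group_algebra G A\<^esub> y" (is ?r)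
proof -
  let ?S = "{g. x g \<noteq> 0} \<union> {g. y g \<noteq> 0}" and ?T = "{g. z g \<noteq> 0}"
  have fin: "finite ?S" "finite ?T" using x y z by (auto simp: tensor_group_algebra_def)
  have mem: "x g \<in> carrier A \<times> carrier A" "y g \<in> carrier A \<times> carrier A" "z g \<in> carrier A \<times> carrier A" for g
    using x y z by (auto simp: tensor_group_algebra_def)
  have sup: "{g. (x + y) g \<noteq> 0} \<subseteq> ?S" by auto
  note L = tensor_prod_superset[OF _ z fin(1) _ fin(2) subset_refl]
    and R = tensor_prod_superset[OF z _ fin(2) subset_refl fin(1)]
  show ?l
  proof
    fix k
    show "((x + y) \<star>\<^bsub>tensor_group_algebra G A\<^esub> z) k =
      (x \<star>\<^bsub>tensor_group_algebra G A\<^esub> z + y \<star>\<^bsub>tensor_group_algebra G A\<^esub> z) k"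
      unfolding plus_fun_apply[of "_ \<star>\<^bsub>_\<^esub> _"] L[OF xy sup] L[OF x Un_upper1] L[OF y Un_upper2]
      by (auto simp: complexified_prod_add mem simp flip: sum.distrib intro!: sum.cong)
  qed
  show ?r
  proof
    fix k
    show "(z \<star>\<^bsub>tensor_group_algebra G A\<^esub> (x + y)) k =
      (z \<star>\<^bsub>tensor_group_algebra G A\<^esub> x + z \<star>\<^bsub>tensor_group_algebra G A\<^esub> y) k"
      unfolding plus_fun_apply[of "_ \<star>\<^bsub>_\<^esub> _"] R[OF xy sup] R[OF x Un_upper1] R[OF y Un_upper2]
      by (auto simp: complexified_prod_add mem simp flip: sum.distrib intro!: sum.cong)
  qed
qed

lemma subspace_tensor: "subspace (carrier (tensor_group_algebra G A))"
proof (rule subspaceI)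
  have 0: "0 \<in> carrier A" by (rule subspace_0[OF subspace_carrier])
  then show "0 \<in> carrier (tensor_group_algebra G A)"
    by (auto simp: tensor_group_algebra_def zero_prod_def)
  fix x y assume xy: "x \<in> carrier (tensor_group_algebra G A)" "y \<in> carrier (tensor_group_algebra G A)"
  have "{g. (x + y) g \<noteq> 0} \<subseteq> {g. x g \<noteq> 0} \<union> {g. y g \<noteq> 0}" by auto
  moreover have "x g + y g \<in> carrier A \<times> carrier A" for g
  proof -
    have "x g \<in> carrier A \<times> carrier A" "y g \<in> carrier A \<times> carrier A"
      using xy by (auto simp: tensor_group_algebra_def)
    then show ?thesis using subspace_add[OF subspace_carrier] by (auto simp: mem_Times_iff)
  qed
  ultimately show "x + y \<in> carrier (tensor_group_algebra G A)"
    using xy by (auto simp: tensor_group_algebra_def intro: finite_subset[of _ "{g. x g \<noteq> 0} \<union> {g. y g \<noteq> 0}"])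
next
  fix r x assume x: "x \<in> carrier (tensor_group_algebra G A)"
  have "{g. (r *\<^sub>R x) g \<noteq> 0} \<subseteq> {g. x g \<noteq> 0}" by auto
  moreover have "r *\<^sub>R x g \<in> carrier A \<times> carrier A" for g
  proof -
    have "x g \<in> carrier A \<times> carrier A"
      using x by (auto simp: tensor_group_algebra_def)
    then show ?thesis using subspace_scale[OF subspace_carrier] by (auto simp: mem_Times_iff)
  qed
  ultimately show "r *\<^sub>R x \<in> carrier (tensor_group_algebra G A)"
    using x by (auto simp: tensor_group_algebra_def intro: finite_subset[of _ "{g. x g \<noteq> 0}"])
qed

lemma pure_tensor_in:
  assumes "a \<in> carrier A" "g \<in> carrier G"
  shows "pure_tensor a (monomial z g) \<in> carrier (tensor_group_algebra G A)"
proof -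
  have "{h. pure_tensor a (monomial z g) h \<noteq> 0} \<subseteq> {g}"
    by (auto simp: pure_tensor_def monomial_def zero_prod_def split: if_splits)
  moreover have "pure_tensor a (monomial z g) h \<in> carrier A \<times> carrier A" for h
    using assms subspace_scale[OF subspace_carrier] subspace_0[OF subspace_carrier]
    by (auto simp: pure_tensor_def)
  ultimately show ?thesis
    using assms by (auto simp: tensor_group_algebra_def intro: finite_subset[of _ "{g}"])
qed

end

lemma monomial_mult:
  "monomial z g \<star>\<^bsub>group_algebra G\<^esub> monomial w h = monomial (z * w) (g \<otimes>\<^bsub>G\<^esub> h)"
proof
  fix k
  have "{(a, b). monomial z g a \<noteq> 0 \<and> monomial w h b \<noteq> 0 \<and> a \<otimes>\<^bsub>G\<^esub> b = k} =
      (if z \<noteq> 0 \<and> w \<noteq> 0 \<and> g \<otimes>\<^bsub>G\<^esub> h = k then {(g, h)} else {})"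
    by (auto simp: monomial_def split: if_splits)
  then show "(monomial z g \<star>\<^bsub>group_algebra G\<^esub> monomial w h) k = monomial (z * w) (g \<otimes>\<^bsub>G\<^esub> h) k"
    by (auto simp: group_algebra_def convolution_def monomial_def)
qed

lemma monomial_in: "g \<in> carrier G \<Longrightarrow> monomial z g \<in> carrier (group_algebra G)"
  using finite_subset[of "{h. monomial z g h \<noteq> 0}" "{g}"]
  by (auto simp: group_algebra_def monomial_def split: if_splits)

lemma pure_tensor_scale: "pure_tensor (r *\<^sub>R a) v = r *\<^sub>R pure_tensor a v"
  and pure_tensor_add: "pure_tensor (a + b) v = pure_tensor a v + pure_tensor b v"
  by (auto simp: pure_tensor_def fun_eq_iff scaleR_add_right)

lemma pure_tensor_monomial_scale: "pure_tensor a (monomial (of_real r * z) g) = r *\<^sub>R pure_tensor a (monomial z g)"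
  by (auto simp: pure_tensor_def monomial_def fun_eq_iff)

text \<open>The sign \<open>z\<^sub>g z\<^sub>h / z\<^sub>g\<^sub>h\<close> of the chosen square roots, so that \<open>u\<^sub>g u\<^sub>h = root_sign \<chi> g h u\<^sub>g\<^sub>h\<close>.\<close>

definition root_sign :: "('g, 'n) monoid_scheme \<Rightarrow> ('g \<Rightarrow> complex) \<Rightarrow> 'g \<Rightarrow> 'g \<Rightarrow> real" where
  "root_sign G \<chi> g h = Re (csqrt (\<chi> g) * csqrt (\<chi> h) / csqrt (\<chi> (g \<otimes>\<^bsub>G\<^esub> h)))"

section \<open>Signs of the chosen square roots\<close>

locale unit_character = comm_group G for G :: "('g, 'n) monoid_scheme" (structure) +
  fixes \<chi> :: "'g \<Rightarrow> complex"
  assumes \<chi>: "\<chi> \<in> hom G unit_circle"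
begin

lemma \<chi>_norm: "g \<in> carrier G \<Longrightarrow> cmod (\<chi> g) = 1"
  and \<chi>_mult: "g \<in> carrier G \<Longrightarrow> h \<in> carrier G \<Longrightarrow> \<chi> (g \<otimes> h) = \<chi> g * \<chi> h"
  using \<chi> by (auto simp: hom_def unit_circle_def)

lemma root_nonzero: "g \<in> carrier G \<Longrightarrow> csqrt (\<chi> g) \<noteq> 0"
  using \<chi>_norm[of g] by auto

text \<open>The quotient of roots squares to
  \<open>\<chi> g * \<chi> h / \<chi> (g \<otimes> h) = 1\<close>, so it is 1 or -1 and the real
  part taken in \<open>root_sign\<close> loses nothing.\<close>

lemma root_mult:
  assumes "g \<in> carrier G" "h \<in> carrier G"
  shows "csqrt (\<chi> g) * csqrt (\<chi> h) = of_real (root_sign G \<chi> g h) * csqrt (\<chi> (g \<otimes> h))"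
    and "root_sign G \<chi> g h * root_sign G \<chi> g h = 1"
proof -
  let ?q = "csqrt (\<chi> g) * csqrt (\<chi> h) / csqrt (\<chi> (g \<otimes> h))"
  have nz: "csqrt (\<chi> (g \<otimes> h)) \<noteq> 0" using root_nonzero assms by simp
  have "?q\<^sup>2 = 1"
    using \<chi>_mult[OF assms] \<chi>_norm[of "g \<otimes> h"] assms by (auto simp: power_divide power_mult_distrib)
  then have q: "?q = 1 \<or> ?q = -1" by (simp add: power2_eq_1_iff)
  then have "?q = of_real (root_sign G \<chi> g h)" by (auto simp: root_sign_def)
  then show "csqrt (\<chi> g) * csqrt (\<chi> h) = of_real (root_sign G \<chi> g h) * csqrt (\<chi> (g \<otimes> h))"
    using nz by (simp add: field_simps)
  show "root_sign G \<chi> g h * root_sign G \<chi> g h = 1"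
    using q unfolding root_sign_def by auto
qed

lemma root_sign_sym: "g \<in> carrier G \<Longrightarrow> h \<in> carrier G \<Longrightarrow> root_sign G \<chi> g h = root_sign G \<chi> h g"
  by (simp add: root_sign_def m_comm mult.commute)

lemma \<chi>_one: "\<chi> \<one> = 1"
  using \<chi>_mult[of \<one> \<one>] \<chi>_norm[of \<one>] by auto

lemma root_sign_one: "g \<in> carrier G \<Longrightarrow> root_sign G \<chi> \<one> g = 1"
  using root_nonzero[of g] by (simp add: root_sign_def \<chi>_one)

text \<open>Over the complex numbers the sign is the coboundary of the chosen roots: both sides
  arise by expanding a product of three roots, and the nonzero root at
  \<open>g \<otimes> h \<otimes> k\<close> cancels.\<close>

lemma root_sign_cocycle:
  assumes "g \<in> carrier G" "h \<in> carrier G" "k \<in> carrier G"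
  shows "root_sign G \<chi> g h * root_sign G \<chi> (g \<otimes> h) k = root_sign G \<chi> h k * root_sign G \<chi> g (h \<otimes> k)"
proof -
  let ?z = "\<lambda>g. csqrt (\<chi> g)" and ?s = "root_sign G \<chi>"
  have "of_real (?s g h * ?s (g \<otimes> h) k) * ?z (g \<otimes> h \<otimes> k) = ?z g * ?z h * ?z k"
    using root_mult(1)[OF assms(1,2)] root_mult(1)[of "g \<otimes> h" k] assms by simp
  also have "\<dots> = of_real (?s h k * ?s g (h \<otimes> k)) * ?z (g \<otimes> (h \<otimes> k))"
    using root_mult(1)[OF assms(2,3)] root_mult(1)[of g "h \<otimes> k"] assms by (simp add: ac_simps)
  finally have "complex_of_real (?s g h * ?s (g \<otimes> h) k) = of_real (?s h k * ?s g (h \<otimes> k))"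
    using assms root_nonzero[of "g \<otimes> h \<otimes> k"] by (simp add: m_assoc del: of_real_mult)
  then show ?thesis by (simp only: of_real_eq_iff)
qed

end

context graded_real_algebra
begin

text \<open>The isomorphism sends \<open>x\<close> of degree \<open>g\<close> to the tensor of
  \<open>l x\<close> with \<open>u\<^sub>g\<close>. The sign in the hypothesis \<open>mult\<close>
  equals the sign of \<open>u\<^sub>g u\<^sub>h\<close> relative to
  \<open>u\<^sub>g\<^sub>h\<close>, so in the product the two cancel.\<close>

lemma loop_iso:
  fixes Q :: "('c::real_vector, 'k) alg_scheme" and \<pi> :: "'g \<Rightarrow> 'q"
  assumes \<chi>: "\<chi> \<in> hom G unit_circle" and Q: "real_algebra Q"
    and \<Delta>: "\<And>g. g \<in> carrier G \<Longrightarrow> \<Delta> (\<pi> g) \<subseteq> carrier Q"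
    and l: "lin_on (carrier A) l" and bij: "\<And>g. g \<in> carrier G \<Longrightarrow> bij_betw l (\<Gamma> g) (\<Delta> (\<pi> g))"
    and mult: "\<And>g h x y. g \<in> carrier G \<Longrightarrow> h \<in> carrier G \<Longrightarrow> x \<in> \<Gamma> g \<Longrightarrow> y \<in> \<Gamma> h \<Longrightarrow>
      l x \<star>\<^bsub>Q\<^esub> l y = root_sign G \<chi> g h *\<^sub>R l (x \<cdot> y)"
  shows "graded_isomorphic G A \<Gamma> (loop_algebra G \<pi> \<chi> Q \<Delta>) (loop_comp \<pi> \<chi> \<Delta>)"
proof -
  interpret U: unit_character G \<chi> by unfold_locales (rule \<chi>)
  let ?F = "\<lambda>g x. pure_tensor (l x) (loop_unit \<chi> g)"
  define \<phi> where "\<phi> = lin_ext ?F"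
  have F_lin: "lin_on (\<Gamma> g) (?F g)" if "g \<in> carrier G" for g
    using lin_on_subset[OF l comp_subset[OF that]]
    by (simp add: lin_on_def pure_tensor_scale pure_tensor_add)
  have \<phi>_lin: "lin_on (carrier A) \<phi>"
    unfolding \<phi>_def using F_lin by (rule lin_on_lin_ext)
  have \<phi>_hom: "\<phi> x = ?F g x" if "g \<in> carrier G" "x \<in> \<Gamma> g" for g x
    unfolding \<phi>_def using F_lin that by (rule lin_ext_homogeneous)
  have l_image: "l ` \<Gamma> g = \<Delta> (\<pi> g)" if "g \<in> carrier G" for g
    using bij[OF that] by (simp add: bij_betw_def)
  have l_in: "l x \<in> carrier Q" if "g \<in> carrier G" "x \<in> \<Gamma> g" for g x
    using l_image[OF that(1)] \<Delta>[OF that(1)] that(2) by blast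
  have comp: "\<phi> ` \<Gamma> g = loop_comp \<pi> \<chi> \<Delta> g" if "g \<in> carrier G" for g
    using \<phi>_hom[OF that] by (simp add: loop_comp_def flip: l_image[OF that]) (simp add: image_image)
  have \<phi>_tensor: "\<phi> x \<in> carrier (tensor_group_algebra G Q)" for x
    unfolding \<phi>_def loop_unit_def
    by (rule lin_ext_in[OF real_algebra.subspace_tensor[OF Q]])
      (rule real_algebra.pure_tensor_in[OF Q l_in])
  have "\<phi> ` carrier A = span (\<Union>g\<in>carrier G. loop_comp \<pi> \<chi> \<Delta> g)" (is "_ = ?span")
  proof
    have "?F g x \<in> ?span" if "g \<in> carrier G" "x \<in> \<Gamma> g" for g x
      using comp[OF that(1)] \<phi>_hom[OF that] that by (intro span_base UN_I[OF that(1)]) (metis imageI)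
    then show "\<phi> ` carrier A \<subseteq> ?span"
      unfolding \<phi>_def by (blast intro: lin_ext_in[OF subspace_span])
    show "?span \<subseteq> \<phi> ` carrier A"
      by (rule span_minimal[OF _ subspace_lin_image[OF \<phi>_lin subspace_carrier]])
        (use comp comp_subset in blast)
  qed
  moreover have "inj_on \<phi> (carrier A)"
  proof (rule inj_onI)
    fix x y assume xy: "x \<in> carrier A" "y \<in> carrier A" and eq: "\<phi> x = \<phi> y"
    \<comment> \<open>\<open>l\<close> may merge different degrees, but here each degree
      \<open>k\<close> is read off in its own coordinate, up to the nonzero factor
      \<open>csqrt (\<chi> k)\<close>.\<close>
    have eval: "\<phi> x k = (Re (csqrt (\<chi> k)) *\<^sub>R l (hcomp k x), Im (csqrt (\<chi> k)) *\<^sub>R l (hcomp k x))"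
      if k: "k \<in> carrier G" and "x \<in> carrier A" for x k
      using that(2)
    proof (induction x rule: homogeneous_induct)
      case (homogeneous g x)
      then show ?case
        by (simp add: \<phi>_hom hcomp_homogeneous[OF homogeneous] pure_tensor_def loop_unit_def monomial_def
            lin_on_zero[OF l subspace_carrier])
    next
      case (add x y)
      then show ?case
        by (simp add: lin_on_add[OF \<phi>_lin] hcomp_add lin_on_add[OF l] hcomp_closed scaleR_add_right)
    qed
    show "x = y"
    proof (rule hcomp_ext[OF xy])
      fix k assume k: "k \<in> carrier G"
      have "Re (csqrt (\<chi> k)) \<noteq> 0 \<or> Im (csqrt (\<chi> k)) \<noteq> 0"
        using U.root_nonzero[OF k] complex_eq_iff by fastforce
      moreover have "Re (csqrt (\<chi> k)) *\<^sub>R l (hcomp k x) = Re (csqrt (\<chi> k)) *\<^sub>R l (hcomp k y)"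
        "Im (csqrt (\<chi> k)) *\<^sub>R l (hcomp k x) = Im (csqrt (\<chi> k)) *\<^sub>R l (hcomp k y)"
        using eval[OF k xy(1)] eval[OF k xy(2)] eq by auto
      ultimately have "l (hcomp k x) = l (hcomp k y)" by (metis scaleR_left_imp_eq)
      then show "hcomp k x = hcomp k y"
        using bij[OF k] hcomp_in[OF k] by (meson bij_betw_def inj_onD)
    qed
  qed
  ultimately have "bij_betw \<phi> (carrier A) (carrier (loop_algebra G \<pi> \<chi> Q \<Delta>))"
    by (simp add: bij_betw_def loop_algebra_def)
  moreover have "\<phi> (x \<cdot> y) = \<phi> x \<star>\<^bsub>loop_algebra G \<pi> \<chi> Q \<Delta>\<^esub> \<phi> y" if "x \<in> carrier A" "y \<in> carrier A" for x y
  proof -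
    have "\<phi> (x \<cdot> y) = \<phi> x \<star>\<^bsub>tensor_group_algebra G Q\<^esub> \<phi> y"
      using that(1)
    proof (induction x rule: homogeneous_induct)
      case (homogeneous g x)
      show ?case using that(2)
      proof (induction y rule: homogeneous_induct)
        case h: (homogeneous h y)
        note * = homogeneous(1) h(1) homogeneous(2) h(2)
        let ?z = "\<lambda>g. csqrt (\<chi> g)" and ?s = "root_sign G \<chi> g h"
        have "\<phi> x \<star>\<^bsub>tensor_group_algebra G Q\<^esub> \<phi> y = pure_tensor (l x \<star>\<^bsub>Q\<^esub> l y) (monomial (?z g * ?z h) (g \<otimes> h))"
          using \<phi>_hom[OF *(1,3)] \<phi>_hom[OF *(2,4)]
            real_algebra.pure_tensor_prod[OF Q l_in[OF *(1,3)] l_in[OF *(2,4)] monomial_in[OF *(1)] monomial_in[OF *(2)]]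
          by (simp add: loop_unit_def monomial_mult)
        also have "\<dots> = (?s * ?s) *\<^sub>R pure_tensor (l (x \<cdot> y)) (monomial (?z (g \<otimes> h)) (g \<otimes> h))"
          by (simp add: U.root_mult(1)[OF *(1,2)] pure_tensor_monomial_scale mult[OF *] pure_tensor_scale)
        also have "\<dots> = \<phi> (x \<cdot> y)"
          using \<phi>_hom[OF _ comp_mult[OF *]] * by (simp add: U.root_mult(2) loop_unit_def)
        finally show ?case by simp
      next
        case (add y z)
        have x: "x \<in> carrier A" using homogeneous comp_closed by blast
        have e: "\<phi> (y + z) = \<phi> y + \<phi> z" using add lin_on_add[OF \<phi>_lin] by blast
        have "\<phi> (x \<cdot> (y + z)) = \<phi> (x \<cdot> y) + \<phi> (x \<cdot> z)"
          using lin_on_add[OF \<phi>_lin prod_closed prod_closed, OF x add(1) x add(2)]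
          by (simp only: prod_add_right[OF x add(1,2)])
        then show ?case
          using real_algebra.tensor_prod_add(2)[OF Q \<phi>_tensor[of y] \<phi>_tensor[of z] \<phi>_tensor[of x]] \<phi>_tensor[of "y + z"]
          by (simp only: add(3,4) e)
      qed
    next
      case (add x z)
      have e: "\<phi> (x + z) = \<phi> x + \<phi> z" using add lin_on_add[OF \<phi>_lin] by blast
      have "\<phi> ((x + z) \<cdot> y) = \<phi> (x \<cdot> y) + \<phi> (z \<cdot> y)"
        using lin_on_add[OF \<phi>_lin prod_closed prod_closed, OF add(1) that(2) add(2) that(2)]
        by (simp only: prod_add_left[OF add(1,2) that(2)])
      then show ?case
        using real_algebra.tensor_prod_add(1)[OF Q \<phi>_tensor[of x] \<phi>_tensor[of z] \<phi>_tensor[of y]] \<phi>_tensor[of "x + z"]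
        by (simp only: add(3,4) e)
    qed
    then show ?thesis by (simp add: loop_algebra_def)
  qed
  ultimately show ?thesis using \<phi>_lin comp unfolding graded_isomorphic_def by blast
qed

text \<open>The \<open>c h\<close> multiply like the \<open>u\<^sub>h\<close>, so twisting by the
  signs of the roots yields a split centroid. Its quotient map is multiplicative for the twisted
  product, which is exactly the sign condition of \<open>loop_iso\<close>.\<close>

theorem loop_realization:
  assumes \<chi>: "\<chi> \<in> hom G unit_circle" and gs: "graded_simple G A \<Gamma>" and H: "subgroup H G"
    and c: "\<And>h. h \<in> H \<Longrightarrow> c h \<in> centroid_comp G A \<Gamma> h"
    and c_mult: "\<And>h k x. h \<in> H \<Longrightarrow> k \<in> H \<Longrightarrow> x \<in> carrier A \<Longrightarrow> c h (c k x) = root_sign G \<chi> h k *\<^sub>R c (h \<otimes> k) x"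
    and c_one: "\<And>x. x \<in> carrier A \<Longrightarrow> c \<one> x = x"
    and cen: "\<And>k f. k \<in> carrier G \<Longrightarrow> f \<in> centroid_comp G A \<Gamma> k \<Longrightarrow> f \<noteq> 0 \<Longrightarrow>
      k \<in> H \<and> (\<exists>r. \<forall>x\<in>carrier A. f x = r *\<^sub>R c k x)"
  shows "\<exists>(Q :: 'a alg) \<Delta>. real_algebra Q \<and> central_simple Q \<and> grading (G Mod H) Q \<Delta> \<and>
    graded_isomorphic G A \<Gamma> (loop_algebra G (\<lambda>g. H #> g) \<chi> Q \<Delta>) (loop_comp (\<lambda>g. H #> g) \<chi> \<Delta>)"
proof -
  interpret U: unit_character G \<chi> by unfold_locales (rule \<chi>)
  interpret W: twist A G \<Gamma> "root_sign G \<chi>"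
    by unfold_locales (fact U.root_mult(2) U.root_sign_sym U.root_sign_cocycle)+
  have "split_centroid W.T G \<Gamma> H (\<lambda>h. W.twist_op h (c h))"
    by (rule W.split_centroid_T[OF gs H U.root_sign_one c c_mult c_one cen])
  from split_centroid.quotient[OF this] obtain Q :: "'a alg" and \<Delta> l where Q: "real_algebra Q" "central_simple Q"
    "grading (G Mod H) Q \<Delta>" and l: "lin_on (carrier A) l"
    and mult: "\<And>x y. x \<in> carrier A \<Longrightarrow> y \<in> carrier A \<Longrightarrow> l (W.tw x y) = l x \<star>\<^bsub>Q\<^esub> l y"
    and bij: "\<And>g. g \<in> carrier G \<Longrightarrow> bij_betw l (\<Gamma> g) (\<Delta> (H #> g))"
    unfolding W.T_simps by blast
  have "graded_isomorphic G A \<Gamma> (loop_algebra G (\<lambda>g. H #> g) \<chi> Q \<Delta>) (loop_comp (\<lambda>g. H #> g) \<chi> \<Delta>)"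
  proof (rule loop_iso[where \<pi>="\<lambda>g. H #> g" and \<Delta>=\<Delta>, OF \<chi> Q(1) _ l bij])
    show "\<Delta> (H #> g) \<subseteq> carrier Q" if "g \<in> carrier G" for g
      using Q(3) rcosetsI[OF subgroup.subset[OF H] that] by (auto simp: grading_def FactGroup_def)
    fix g h x y assume *: "g \<in> carrier G" "h \<in> carrier G" "x \<in> \<Gamma> g" "y \<in> \<Gamma> h"
    have xy: "x \<in> carrier A" "y \<in> carrier A" using * comp_closed by auto
    show "l x \<star>\<^bsub>Q\<^esub> l y = root_sign G \<chi> g h *\<^sub>R l (x \<cdot> y)"
      using mult[OF xy] W.tw_homogeneous[OF *] lin_on_scale[OF l prod_closed[OF xy]] by simp
  qed
  then show ?thesis using Q by blast
qed

end

section \<open>Extension of characters\<close>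

text \<open>Divisibility of the nonzero complex numbers in concrete form: a maximal partial
  character could otherwise be extended by one more element.\<close>

lemma (in comm_group) character_extension:
  fixes f :: "'a \<Rightarrow> complex"
  assumes K: "subgroup K G" and f_nz: "\<And>k. k \<in> K \<Longrightarrow> f k \<noteq> 0"
    and f_mult: "\<And>k l. k \<in> K \<Longrightarrow> l \<in> K \<Longrightarrow> f (k \<otimes> l) = f k * f l"
  obtains F where "\<And>g. g \<in> carrier G \<Longrightarrow> F g \<noteq> (0::complex)"
    "\<And>g h. g \<in> carrier G \<Longrightarrow> h \<in> carrier G \<Longrightarrow> F (g \<otimes> h) = F g * F h"
    "\<And>k. k \<in> K \<Longrightarrow> F k = f k"
proof -
  \<comment> \<open>Partial characters are encoded as graphs, so that extension is inclusion and
    unions of chains are bounds. Single-valuedness is required only at the identity; closure under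
    products and inverses spreads it, see \<open>M_unique\<close>.\<close>
  define good where "good R \<longleftrightarrow> R \<subseteq> carrier G \<times> (- {0}) \<and>
      (\<forall>g h z w. (g, z) \<in> R \<longrightarrow> (h, w) \<in> R \<longrightarrow> (g \<otimes> h, z * w) \<in> R) \<and>
      (\<forall>g z. (g, z) \<in> R \<longrightarrow> (inv g, inverse z) \<in> R) \<and> (\<forall>z. (\<one>, z) \<in> R \<longrightarrow> z = 1) \<and>
      (\<lambda>k. (k, f k)) ` K \<subseteq> R" for R :: "('a \<times> complex) set"
  have good_sub: "R \<subseteq> carrier G \<times> (- {0})"
    and good_mult: "(g, z) \<in> R \<Longrightarrow> (h, w) \<in> R \<Longrightarrow> (g \<otimes> h, z * w) \<in> R"
    and good_inv: "(g, z) \<in> R \<Longrightarrow> (inv g, inverse z) \<in> R"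
    and good_one: "(\<one>, z) \<in> R \<Longrightarrow> z = 1"
    and good_graph: "(\<lambda>k. (k, f k)) ` K \<subseteq> R" if "good R" for R g h z w
    using that unfolding good_def by simp_all
  have oneK: "\<one> \<in> K" using subgroup.one_closed[OF K] .
  have f_one: "f \<one> = 1" using f_mult[OF oneK oneK] f_nz[OF oneK] by simp
  have f_inv: "f (inv k) = inverse (f k)" if "k \<in> K" for k
  proof -
    have "f k * f (inv k) = 1"
      using f_mult[OF that subgroup.m_inv_closed[OF K that]] f_one subgroup.subset[OF K] that by auto
    then show ?thesis using f_nz[OF that] by (simp add: field_simps)
  qed
  have "good ((\<lambda>k. (k, f k)) ` K)"
    using subgroup.subset[OF K] subgroup.m_closed[OF K] subgroup.m_inv_closed[OF K] f_nz f_mult f_one f_inv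
    by (auto simp: good_def image_iff)
  then have "{R. good R} \<noteq> {}" by blast
  moreover have "\<Union>C \<in> {R. good R}" if C: "C \<noteq> {}" "subset.chain {R. good R} C" for C
  proof -
    have g: "good R" if "R \<in> C" for R using C that by (auto simp: subset_chain_def)
    have ch: "R \<subseteq> S \<or> S \<subseteq> R" if "R \<in> C" "S \<in> C" for R S using C that by (auto simp: subset_chain_def)
    have "(g \<otimes> h, z * w) \<in> \<Union>C" if "(g, z) \<in> \<Union>C" "(h, w) \<in> \<Union>C" for g h z w
    proof -
      obtain R S where RS: "R \<in> C" "S \<in> C" "(g, z) \<in> R" "(h, w) \<in> S" using \<open>(g, z) \<in> \<Union>C\<close> \<open>(h, w) \<in> \<Union>C\<close> by blast
      then obtain U where U: "U \<in> C" "(g, z) \<in> U" "(h, w) \<in> U" using ch[OF RS(1,2)] by (meson subsetD)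
      then have "(g \<otimes> h, z * w) \<in> U" using good_mult[OF g[OF U(1)]] by blast
      then show ?thesis using U(1) by blast
    qed
    moreover have "\<Union>C \<subseteq> carrier G \<times> (- {0})" using good_sub[OF g] by blast
    moreover have "(inv g, inverse z) \<in> \<Union>C" if "(g, z) \<in> \<Union>C" for g z using good_inv[OF g] that by blast
    moreover have "z = 1" if "(\<one>, z) \<in> \<Union>C" for z using good_one[OF g] that by blast
    moreover have "(\<lambda>k. (k, f k)) ` K \<subseteq> \<Union>C" using C(1) good_graph[OF g] by blast
    ultimately show ?thesis unfolding good_def mem_Collect_eq by (intro conjI allI impI)
  qed
  ultimately obtain M where M: "good M" and max: "\<And>R. good R \<Longrightarrow> M \<subseteq> R \<Longrightarrow> R = M"
    using subset_Zorn_nonempty[of "{R. good R}"] by blast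
  have MG: "g \<in> carrier G" "z \<noteq> 0" if "(g, z) \<in> M" for g z using good_sub[OF M] that by auto
  note M_mult = good_mult[OF M] and M_inv = good_inv[OF M] and M_one = good_one[OF M]
  have M_f: "(k, f k) \<in> M" if "k \<in> K" for k using good_graph[OF M] that by auto
  have M_one_in: "(\<one>, 1) \<in> M" using M_f[OF oneK] f_one by simp
  have M_nat: "(g [^] n, z ^ n) \<in> M" if "(g, z) \<in> M" for g z and n :: nat
    by (induction n) (use M_one_in M_mult that in \<open>auto simp: power_Suc2 simp del: power_Suc\<close>)
  have M_int: "(g [^] i, z powi i) \<in> M" if "(g, z) \<in> M" for g z and i :: int
  proof (cases i rule: int_cases2)
    case (nonneg n)
    then show ?thesis using M_nat[OF that, of n] by (simp only: int_pow_int power_int_of_nat)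
  next
    case (nonpos n)
    then show ?thesis using M_inv[OF M_nat[OF that, of n]] MG(1)[OF that]
      by (simp only: int_pow_neg_int power_int_minus power_int_of_nat)
  qed
  have M_unique: "z = w" if "(g, z) \<in> M" "(g, w) \<in> M" for g z w
    using M_one[of "z * inverse w"] M_mult[OF that(1) M_inv[OF that(2)]] MG[OF that(1)] MG[OF that(2)]
    by (simp add: field_simps)
  have "a \<in> fst ` M" if a: "a \<in> carrier G" for a
  proof (rule ccontr)
    assume nd: "a \<notin> fst ` M"
    \<comment> \<open>\<open>w\<close> is the intended value at \<open>a\<close>; it must agree with
      \<open>M\<close> on every power of \<open>a\<close> already in the domain.\<close>
    have "\<exists>w. w \<noteq> 0 \<and> (\<forall>i::int. a [^] i \<in> fst ` M \<longrightarrow> (a [^] i, w powi i) \<in> M)"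
    proof (cases "\<exists>n>0. a [^] (n::nat) \<in> fst ` M")
      case True
      \<comment> \<open>By division with remainder every power of \<open>a\<close> in the domain is
        a power of \<open>a [^] n\<close>, so it suffices that \<open>w\<close> is an
        \<open>n\<close>-th root of the value \<open>y\<close> there. The polar form supplies
        one.\<close>
      define n where "n = (LEAST n. n > 0 \<and> a [^] (n::nat) \<in> fst ` M)"
      have n: "n > 0" "a [^] n \<in> fst ` M"
        using LeastI_ex[OF True] by (auto simp: n_def)
      have least: "a [^] m \<notin> fst ` M" if "0 < m" "m < n" for m
        using that not_less_Least[of m "\<lambda>n. n > 0 \<and> a [^] (n::nat) \<in> fst ` M"] by (auto simp: n_def)
      obtain y where y: "(a [^] n, y) \<in> M" using n by auto
      define w where "w = rcis (root n (cmod y)) (Arg y / n)"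
      have wn: "w ^ n = y" using n(1) by (simp add: w_def DeMoivre2 rcis_cmod_Arg)
      have w0: "w \<noteq> 0" using wn MG(2)[OF y] n(1) by auto
      have "(a [^] i, w powi i) \<in> M" if i: "a [^] i \<in> fst ` M" for i :: int
      proof -
        obtain x where x: "(a [^] i, x) \<in> M" using i by auto
        have "(a [^] n) [^] (- (i div int n)) = a [^] (- (int n * (i div int n)))"
          using a by (simp add: int_pow_pow flip: int_pow_int)
        then have "(a [^] i \<otimes> a [^] (- (int n * (i div int n))), x * y powi (- (i div int n))) \<in> M"
          using M_mult[OF x M_int[OF y]] by metis
        moreover have "a [^] i \<otimes> a [^] (- (int n * (i div int n))) = a [^] (i mod int n)"
          using a by (simp add: int_pow_mult[symmetric] minus_mult_div_eq_mod)
        ultimately have "a [^] (i mod int n) \<in> fst ` M" by force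
        then have "a [^] nat (i mod int n) \<in> fst ` M" using n(1) by (simp add: pow_nat)
        moreover have "nat (i mod int n) < n" using n(1) by (simp add: nat_less_iff)
        ultimately have "nat (i mod int n) = 0" using least by blast
        then have "i mod int n = 0" using n(1) by (simp add: order_antisym)
        then have "i = int n * (i div int n)" using mult_div_mod_eq[of "int n" i] by simp
        then obtain q where q: "i = int n * q" by blast
        have "(a [^] n) [^] q = a [^] i" using a q by (simp add: int_pow_pow flip: int_pow_int)
        moreover have "y powi q = w powi i" using q by (simp add: power_int_mult flip: wn)
        ultimately show ?thesis using M_int[OF y, of q] by simp
      qed
      then show ?thesis using w0 by blast
    next
      case False
      have zero: "i = 0" if i: "a [^] i \<in> fst ` M" for i :: int
      proof (rule ccontr)
        assume "i \<noteq> 0"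
        obtain x where x: "(a [^] i, x) \<in> M" using i by auto
        have "a [^] (- i) \<in> fst ` M" using M_inv[OF x] int_pow_neg[OF a] by force
        then have "a [^] nat \<bar>i\<bar> \<in> fst ` M" using i by (auto simp: pow_nat abs_if)
        moreover have "nat \<bar>i\<bar> > 0" using \<open>i \<noteq> 0\<close> by simp
        ultimately show False using False by blast
      qed
      \<comment> \<open>Only the trivial power of \<open>a\<close> is in the domain, so the value at
        \<open>a\<close> is free; it is taken to be 1.\<close>
      have "(a [^] i, 1 powi i) \<in> M" if "a [^] i \<in> fst ` M" for i :: int
        using zero[OF that] M_one_in by simp
      then show ?thesis using zero_neq_one by metis
    qed
    then obtain w where w: "w \<noteq> 0" "\<And>i::int. a [^] i \<in> fst ` M \<Longrightarrow> (a [^] i, w powi i) \<in> M" by blast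
    define R where "R = {(g \<otimes> a [^] i, z * w powi i) | g z (i::int). (g, z) \<in> M}"
    have "good R"
      unfolding good_def
    proof (intro conjI allI impI)
      show "R \<subseteq> carrier G \<times> (- {0})" using MG w(1) a by (auto simp: R_def)
      show "(\<lambda>k. (k, f k)) ` K \<subseteq> R"
      proof
        fix p assume "p \<in> (\<lambda>k. (k, f k)) ` K"
        then obtain k where k: "p = (k, f k)" "k \<in> K" by blast
        then have "p = (k \<otimes> a [^] (0::int), f k * w powi 0)" using MG(1)[OF M_f] by simp
        then show "p \<in> R" using M_f[OF k(2)] unfolding R_def by blast
      qed
      fix g z assume "(g, z) \<in> R"
      then obtain g1 z1 i where 1: "g = g1 \<otimes> a [^] (i::int)" "z = z1 * w powi i" "(g1, z1) \<in> M"
        by (auto simp: R_def)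
      have "(inv g1 \<otimes> a [^] (- i), inverse z1 * w powi (- i)) \<in> R"
        using M_inv[OF 1(3)] by (auto simp: R_def)
      moreover have "inv g = inv g1 \<otimes> a [^] (- i)"
        using 1 MG[OF 1(3)] a by (simp add: inv_mult int_pow_neg)
      ultimately show "(inv g, inverse z) \<in> R" using 1 by (simp add: power_int_minus)
      fix h v assume "(h, v) \<in> R"
      then obtain g2 z2 j where 2: "h = g2 \<otimes> a [^] (j::int)" "v = z2 * w powi j" "(g2, z2) \<in> M"
        by (auto simp: R_def)
      have "(g1 \<otimes> g2 \<otimes> a [^] (i + j), z1 * z2 * w powi (i + j)) \<in> R"
        using M_mult[OF 1(3) 2(3)] unfolding R_def by blast
      moreover have "g \<otimes> h = g1 \<otimes> g2 \<otimes> a [^] (i + j)"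
        using 1 2 MG[OF 1(3)] MG[OF 2(3)] a by (simp add: int_pow_mult m_ac)
      moreover have "z * v = z1 * z2 * w powi (i + j)"
        using 1 2 w(1) by (simp add: power_int_add ac_simps)
      ultimately show "(g \<otimes> h, z * v) \<in> R" by simp
    next
      fix z assume "(\<one>, z) \<in> R"
      then obtain g1 z1 i where 1: "\<one> = g1 \<otimes> a [^] (i::int)" "z = z1 * w powi i" "(g1, z1) \<in> M"
        by (auto simp: R_def)
      \<comment> \<open>Single-valuedness of \<open>R\<close>: a relation between \<open>M\<close>
        and a power of \<open>a\<close> puts that power into the domain, where the choice of
        \<open>w\<close> already agrees with \<open>M\<close>.\<close>
      have "inv g1 = a [^] i" using 1 MG[OF 1(3)] a by (metis inv_equality int_pow_closed m_comm)
      then have "a [^] i \<in> fst ` M" using M_inv[OF 1(3)] by force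
      then have "(\<one>, z) \<in> M" using M_mult[OF 1(3) w(2)] 1 by metis
      then show "z = 1" by (rule M_one)
    qed
    moreover have "M \<subseteq> R"
    proof
      fix p assume "p \<in> M"
      then have "p = (fst p \<otimes> a [^] (0::int), snd p * w powi 0)" "(fst p, snd p) \<in> M"
        using MG(1)[of "fst p" "snd p"] by auto
      then show "p \<in> R" unfolding R_def by blast
    qed
    ultimately have "R = M" by (rule max)
    moreover have "(\<one> \<otimes> a [^] (1::int), 1 * w powi 1) \<in> R" using M_one_in unfolding R_def by blast
    ultimately show False using nd a by force
  qed
  then have ex: "\<exists>z. (a, z) \<in> M" if "a \<in> carrier G" for a using that by force
  define F where "F a = (SOME z. (a, z) \<in> M)" for a
  have F: "(a, F a) \<in> M" if "a \<in> carrier G" for a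
    unfolding F_def using someI_ex[OF ex[OF that]] .
  show ?thesis
  proof
    show "F g \<noteq> 0" if "g \<in> carrier G" for g using MG(2)[OF F[OF that]] .
    show "F (g \<otimes> h) = F g * F h" if "g \<in> carrier G" "h \<in> carrier G" for g h
      using M_unique[OF F M_mult[OF F F]] that by simp
    show "F k = f k" if "k \<in> K" for k
      using M_unique[OF F M_f[OF that]] that subgroup.subset[OF K] by blast
  qed
qed

section \<open>The centroid of a graded-central-simple algebra\<close>

locale graded_central_simple = graded_real_algebra A G \<Gamma>
  for A :: "('a::real_vector, 'm) alg_scheme" and G :: "('g, 'n) monoid_scheme" (structure)
    and \<Gamma> :: "'g \<Rightarrow> 'a set" +
  assumes gr_simple: "graded_simple G A \<Gamma>" and gr_central: "graded_central G A \<Gamma>"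
begin

abbreviation C where "C \<equiv> centroid_comp G A \<Gamma>"

lemma C_one: "C \<one> = scalar_operators A"
  using gr_central by (simp add: graded_central_def)

lemma CD:
  assumes "c \<in> C k"
  shows "lin_on (carrier A) c" "x \<in> carrier A \<Longrightarrow> c x \<in> carrier A" "x \<notin> carrier A \<Longrightarrow> c x = 0"
    "x \<in> carrier A \<Longrightarrow> y \<in> carrier A \<Longrightarrow> c (x \<cdot> y) = x \<cdot> c y"
    "x \<in> carrier A \<Longrightarrow> y \<in> carrier A \<Longrightarrow> c (x \<cdot> y) = c x \<cdot> y"
    "g \<in> carrier G \<Longrightarrow> x \<in> \<Gamma> g \<Longrightarrow> c x \<in> \<Gamma> (k \<otimes> g)" "c 0 = 0"
  using centroidD[OF centroid_compD(1)[OF assms]] centroid_compD(2)[OF assms]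
    lin_on_zero[OF _ subspace_carrier] by auto

lemma hcomp_centroid:
  assumes "k \<in> carrier G" "c \<in> C k" "g \<in> carrier G" "x \<in> carrier A"
  shows "hcomp (k \<otimes> g) (c x) = c (hcomp g x)"
  using assms(4)
proof (induction x rule: homogeneous_induct)
  case (homogeneous h x)
  have "hcomp (k \<otimes> g) (c x) = (if k \<otimes> g = k \<otimes> h then c x else 0)"
    using assms homogeneous CD(6)[OF assms(2)] by (intro hcomp_homogeneous) auto
  moreover have "k \<otimes> g = k \<otimes> h \<longleftrightarrow> g = h" using assms homogeneous by simp
  ultimately show ?case using CD(7)[OF assms(2)] by (simp add: hcomp_homogeneous[OF homogeneous])
next
  case (add x y)
  then show ?case using CD(1,2)[OF assms(2)] by (simp add: hcomp_add lin_on_add hcomp_closed)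
qed

lemma hcomp_centroid':
  assumes "k \<in> carrier G" "c \<in> C k" "g \<in> carrier G" "x \<in> carrier A"
  shows "hcomp g (c x) = c (hcomp (inv k \<otimes> g) x)"
  using hcomp_centroid[OF assms(1,2) _ assms(4), of "inv k \<otimes> g"] assms by (simp add: m_assoc[symmetric])

lemma graded_ideal_all:
  assumes "subspace I" "I \<subseteq> carrier A" "x \<in> I" "x \<noteq> 0"
    and "\<And>g x. g \<in> carrier G \<Longrightarrow> x \<in> I \<Longrightarrow> hcomp g x \<in> I"
    and "\<And>a x. a \<in> carrier A \<Longrightarrow> x \<in> I \<Longrightarrow> a \<cdot> x \<in> I"
    and "\<And>a x. a \<in> carrier A \<Longrightarrow> x \<in> I \<Longrightarrow> x \<cdot> a \<in> I"
  shows "I = carrier A"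
proof -
  have "graded_ideal G A \<Gamma> I"
    by (rule graded_idealI[OF assms(1,2,5)]) (use assms(6,7) comp_closed in auto)
  then show ?thesis using gr_simple assms(3,4) by (auto simp: graded_simple_def)
qed

text \<open>Schur's lemma: since \<open>c\<close> is homogeneous its kernel is a graded ideal, and
  it is proper because \<open>c\<close> is nonzero.\<close>

lemma centroid_injective:
  assumes k: "k \<in> carrier G" and c: "c \<in> C k" "c \<noteq> 0" and x: "x \<in> carrier A" "c x = 0"
  shows "x = 0"
proof (rule ccontr)
  assume "x \<noteq> 0"
  note D = CD[OF c(1)]
  have "{x \<in> carrier A. c x = 0} = carrier A"
  proof (rule graded_ideal_all)
    show "subspace {x \<in> carrier A. c x = 0}"
      using subspace_carrier D(7) by (auto simp: subspace_def lin_on_add[OF D(1)] lin_on_scale[OF D(1)])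
    show "x \<in> {x \<in> carrier A. c x = 0}" using x by simp
    show "x \<noteq> 0" by fact
    fix a y assume ay: "a \<in> carrier A" "y \<in> {x \<in> carrier A. c x = 0}"
    then show "a \<cdot> y \<in> {x \<in> carrier A. c x = 0}" "y \<cdot> a \<in> {x \<in> carrier A. c x = 0}"
      using D(4)[of a y] D(5)[of y a] by (simp_all add: prod_closed prod_zero)
  next
    fix g y assume "g \<in> carrier G" "y \<in> {x \<in> carrier A. c x = 0}"
    then show "hcomp g y \<in> {x \<in> carrier A. c x = 0}"
      using hcomp_centroid[OF k c(1), of g y] by (simp add: hcomp_closed hcomp_zero)
  qed auto
  then have "c = 0" using D(3) by (auto simp: fun_eq_iff)
  then show False using c by simp
qed

lemma centroid_inj_on:
  assumes "k \<in> carrier G" "c \<in> C k" "c \<noteq> 0"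
  shows "inj_on c (carrier A)"
proof (rule inj_onI)
  fix x y assume xy: "x \<in> carrier A" "y \<in> carrier A" and "c x = c y"
  then have "c (x - y) = 0"
    using lin_on_diff[OF CD(1)[OF assms(2)] subspace_carrier xy] by simp
  then have "x - y = 0"
    by (rule centroid_injective[OF assms subspace_diff[OF subspace_carrier xy]])
  then show "x = y" by simp
qed

lemma nonzero_at:
  assumes "c \<in> C k" "c \<noteq> 0"
  shows "\<exists>x\<in>carrier A. c x \<noteq> 0"
proof (rule ccontr)
  assume "\<not> ?thesis"
  then have "c x = 0" for x using CD(3)[OF assms(1)] by blast
  then show False using assms(2) by auto
qed

text \<open>The other half of Schur's lemma, with the image in place of the kernel.\<close>

lemma centroid_surj:
  assumes k: "k \<in> carrier G" and c: "c \<in> C k" "c \<noteq> 0"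
  shows "c ` carrier A = carrier A"
proof -
  note D = CD[OF c(1)]
  obtain x where x: "x \<in> carrier A" "c x \<noteq> 0" using nonzero_at[OF c] by blast
  show ?thesis
  proof (rule graded_ideal_all)
    show "subspace (c ` carrier A)" by (rule subspace_lin_image[OF D(1) subspace_carrier])
    show "c ` carrier A \<subseteq> carrier A" using D(2) by blast
    show "c x \<in> c ` carrier A" "c x \<noteq> 0" using x by auto
    show "hcomp g y \<in> c ` carrier A" if "g \<in> carrier G" "y \<in> c ` carrier A" for g y
      using that hcomp_centroid'[OF k c(1)] hcomp_closed by auto
    fix a y assume a: "a \<in> carrier A" and "y \<in> c ` carrier A"
    then obtain z where z: "z \<in> carrier A" "y = c z" by blast
    show "a \<cdot> y \<in> c ` carrier A" "y \<cdot> a \<in> c ` carrier A"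
      using D(4)[OF a z(1)] D(5)[OF z(1) a] z(2) prod_closed[OF a z(1)] prod_closed[OF z(1) a]
      by (metis imageI)+
  qed
qed

lemma centroid_comp_mult:
  assumes "k \<in> carrier G" "h \<in> carrier G" "c \<in> C k" "f \<in> C h"
  shows "c \<circ> f \<in> C (k \<otimes> h)"
proof (rule centroid_compI)
  show "lin_on (carrier A) (c \<circ> f)"
    using lin_on_comp[OF CD(1)[OF assms(4)] CD(1)[OF assms(3)]] CD(2)[OF assms(4)] by (auto simp: comp_def)
  show "(c \<circ> f) x = 0" if "x \<notin> carrier A" for x
    using CD(3)[OF assms(4) that] CD(7)[OF assms(3)] by simp
  fix g x assume g: "g \<in> carrier G" "x \<in> \<Gamma> g"
  show "(c \<circ> f) x \<in> \<Gamma> (k \<otimes> h \<otimes> g)"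
    using CD(6)[OF assms(3) _ CD(6)[OF assms(4) g]] g assms by (simp add: m_assoc)
  fix h' y assume h: "h' \<in> carrier G" "y \<in> \<Gamma> h'"
  have "x \<in> carrier A" "y \<in> carrier A" using g h comp_closed by auto
  then show "(c \<circ> f) (x \<cdot> y) = x \<cdot> (c \<circ> f) y" "(c \<circ> f) (x \<cdot> y) = (c \<circ> f) x \<cdot> y"
    using CD(2,4)[OF assms(3)] CD(2,4)[OF assms(4)] CD(2,5)[OF assms(3)] CD(2,5)[OF assms(4)] by (metis comp_apply)+
qed (use assms in simp)

text \<open>On a product each operator can be moved to its own factor, so both orders give
  \<open>c x \<cdot> f y\<close>. Hence the elements on which they commute form a graded ideal
  containing all products, and some product is nonzero.\<close>

lemma centroid_comp_commute:
  assumes k: "k \<in> carrier G" and h: "h \<in> carrier G" and c: "c \<in> C k" and f: "f \<in> C h"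
  shows "c \<circ> f = f \<circ> c"
proof -
  note D = CD[OF c] and E = CD[OF f]
  let ?K = "{x \<in> carrier A. c (f x) = f (c x)}"
  have prod: "x \<cdot> y \<in> ?K" if xy: "x \<in> carrier A" "y \<in> carrier A" for x y
  proof -
    have "c (f (x \<cdot> y)) = c x \<cdot> f y" using xy D(5) E(2,4) by simp
    moreover have "f (c (x \<cdot> y)) = c x \<cdot> f y" using xy D(2,5) E(4) by simp
    ultimately show ?thesis using xy prod_closed by simp
  qed
  have "nonzero_product A" using gr_simple by (simp add: graded_simple_def)
  then obtain x y where xy: "x \<in> carrier A" "y \<in> carrier A" "x \<cdot> y \<noteq> 0" by (auto simp: nonzero_product_def)
  have "?K = carrier A"
  proof (rule graded_ideal_all)
    show "subspace ?K"
      using subspace_carrier D(7) E(7) D(2) E(2)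
      by (auto simp: subspace_def lin_on_add[OF D(1)] lin_on_scale[OF D(1)] lin_on_add[OF E(1)] lin_on_scale[OF E(1)])
    show "x \<cdot> y \<in> ?K" using prod[OF xy(1,2)] .
    show "x \<cdot> y \<noteq> 0" by fact
    fix g x assume g: "g \<in> carrier G" and x: "x \<in> ?K"
    have "c (f (hcomp g x)) = hcomp (k \<otimes> (h \<otimes> g)) (c (f x))"
      using hcomp_centroid[OF k c, of "h \<otimes> g" "f x"] hcomp_centroid[OF h f g] g h x E(2) by simp
    moreover have "f (c (hcomp g x)) = hcomp (h \<otimes> (k \<otimes> g)) (f (c x))"
      using hcomp_centroid[OF h f, of "k \<otimes> g" "c x"] hcomp_centroid[OF k c g] g k x D(2) by simp
    moreover have "k \<otimes> (h \<otimes> g) = h \<otimes> (k \<otimes> g)" using k h g by (simp add: m_ac)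
    ultimately show "hcomp g x \<in> ?K" using x hcomp_closed by simp
  qed (use prod in auto)
  then have "c (f x) = f (c x)" for x using D(3,7) E(3,7) by (cases "x \<in> carrier A") auto
  then show ?thesis by auto
qed

lemma centroid_inverse:
  assumes k: "k \<in> carrier G" and c: "c \<in> C k" "c \<noteq> 0"
  shows "\<exists>c'\<in>C (inv k). \<forall>x\<in>carrier A. c' (c x) = x \<and> c (c' x) = x"
proof -
  note D = CD[OF c(1)]
  define c' where "c' x = (if x \<in> carrier A then inv_into (carrier A) c x else 0)" for x
  have c'_in: "c' x \<in> carrier A" and cc': "c (c' x) = x" if "x \<in> carrier A" for x
    using that centroid_surj[OF assms] inv_into_into[of x c "carrier A"] f_inv_into_f[of x c "carrier A"]
    by (simp_all add: c'_def)
  have c'c: "c' (c x) = x" if "x \<in> carrier A" for x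
    using that D(2) inv_into_f_f[OF centroid_inj_on[OF assms]] by (simp add: c'_def)
  have eqI: "c' x = y" if "x \<in> carrier A" "y \<in> carrier A" "c y = x" for x y
    using c'c[OF that(2)] that by simp
  have "c' \<in> C (inv k)"
  proof (rule centroid_compI)
    show "lin_on (carrier A) c'"
      unfolding lin_on_def
    proof (intro conjI ballI allI)
      show "c' (x + y) = c' x + c' y" if "x \<in> carrier A" "y \<in> carrier A" for x y
        using that subspace_add[OF subspace_carrier] c'_in cc' lin_on_add[OF D(1)] by (intro eqI) auto
      show "c' (r *\<^sub>R x) = r *\<^sub>R c' x" if "x \<in> carrier A" for r x
        using that subspace_scale[OF subspace_carrier] c'_in cc' lin_on_scale[OF D(1)] by (intro eqI) auto
    qed
    show "c' x = 0" if "x \<notin> carrier A" for x using that by (simp add: c'_def)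
    fix g x assume g: "g \<in> carrier G" "x \<in> \<Gamma> g"
    have x: "x \<in> carrier A" using comp_closed[OF g] .
    \<comment> \<open>The component of \<open>c' x\<close> in degree
      \<open>inv k \<otimes> g\<close> is already mapped to \<open>x\<close>, so by injectivity of
      \<open>c\<close> it is all of \<open>c' x\<close>.\<close>
    have "c (hcomp (inv k \<otimes> g) (c' x)) = x"
      using hcomp_centroid'[OF k c(1) g(1) c'_in[OF x]] cc'[OF x] hcomp_homogeneous[OF g] by simp
    then have "c' x = hcomp (inv k \<otimes> g) (c' x)" by (rule eqI[OF x hcomp_closed])
    then show "c' x \<in> \<Gamma> (inv k \<otimes> g)" using hcomp_in[of "inv k \<otimes> g" "c' x"] k g by simp
    fix h y assume h: "h \<in> carrier G" "y \<in> \<Gamma> h"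
    have y: "y \<in> carrier A" using comp_closed[OF h] .
    show "c' (x \<cdot> y) = x \<cdot> c' y" "c' (x \<cdot> y) = c' x \<cdot> y"
      using x y c'_in cc' D(4)[of x "c' y"] D(5)[of "c' x" y] by (auto intro!: eqI prod_closed)
  qed (use k in simp)
  then show ?thesis using c'c cc' by blast
qed

lemma comp_nonzero:
  assumes "k \<in> carrier G" "c \<in> C k" "c \<noteq> 0" "f \<in> C h" "f \<noteq> 0"
  shows "c \<circ> f \<noteq> 0"
proof
  assume zero: "c \<circ> f = 0"
  obtain x where x: "x \<in> carrier A" "f x \<noteq> 0" using nonzero_at[OF assms(4,5)] by blast
  have "c (f x) = 0" using zero by (auto simp: fun_eq_iff)
  then show False using centroid_injective[OF assms(1-3)] CD(2)[OF assms(4)] x by blast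
qed

text \<open>Composing \<open>f\<close> with the inverse of \<open>c\<close> gives a central operator
  of degree \<one>, and graded centrality makes it a scalar.\<close>

lemma one_dimensional:
  assumes k: "k \<in> carrier G" and c: "c \<in> C k" "c \<noteq> 0" and f: "f \<in> C k"
  obtains r where "\<And>x. x \<in> carrier A \<Longrightarrow> f x = r *\<^sub>R c x" "f = r *\<^sub>R c"
proof -
  obtain c' where c': "c' \<in> C (inv k)" "\<And>x. x \<in> carrier A \<Longrightarrow> c' (c x) = x" "\<And>x. x \<in> carrier A \<Longrightarrow> c (c' x) = x"
    using centroid_inverse[OF k c] by blast
  have "c' \<circ> f \<in> C \<one>" using centroid_comp_mult[OF _ k c'(1) f] k by simp
  then obtain r where r: "c' \<circ> f = (\<lambda>x. if x \<in> carrier A then r *\<^sub>R x else 0)"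
    unfolding C_one scalar_operators_def by blast
  have "f x = r *\<^sub>R c x" if x: "x \<in> carrier A" for x
  proof -
    have "c' (f x) = r *\<^sub>R x" using fun_cong[OF r, of x] x by simp
    then have "c (r *\<^sub>R x) = f x" using c'(3)[OF CD(2)[OF f x]] by simp
    then show ?thesis using lin_on_scale[OF CD(1)[OF c(1)] x] by simp
  qed
  moreover from this have "f = r *\<^sub>R c" using CD(3)[OF f] CD(3)[OF c(1)] by (metis (full_types) ext scaleR_fun_apply scaleR_zero_right)
  ultimately show ?thesis using that by blast
qed

lemma C_scale:
  assumes "k \<in> carrier G" "c \<in> C k"
  shows "r *\<^sub>R c \<in> C k"
proof -
  note D = CD[OF assms(2)]
  show ?thesis
  proof (rule centroid_compI[OF assms(1)])
    show "lin_on (carrier A) (r *\<^sub>R c)"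
      using lin_on_scaled[OF D(1), of r] by (simp add: lin_on_def)
    show "(r *\<^sub>R c) x = 0" if "x \<notin> carrier A" for x using D(3)[OF that] by simp
    fix g x assume g: "g \<in> carrier G" "x \<in> \<Gamma> g"
    then show "(r *\<^sub>R c) x \<in> \<Gamma> (k \<otimes> g)"
      using D(6)[OF g] assms(1) subspace_scale[OF subspace_comp] by simp
    fix h y assume "h \<in> carrier G" "y \<in> \<Gamma> h"
    then have "x \<in> carrier A" "y \<in> carrier A" using g comp_closed by auto
    then show "(r *\<^sub>R c) (x \<cdot> y) = x \<cdot> (r *\<^sub>R c) y" "(r *\<^sub>R c) (x \<cdot> y) = (r *\<^sub>R c) x \<cdot> y"
      using D(2)[of x] D(4)[of x y] D(5)[of x y] D(2)[of y] by (simp_all add: prod_scale_left prod_scale_right)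
  qed
qed

abbreviation idA :: "'a \<Rightarrow> 'a" where "idA \<equiv> (\<lambda>x. if x \<in> carrier A then x else 0)"

lemma scal_in: "r *\<^sub>R idA \<in> C \<one>"
proof -
  have "r *\<^sub>R idA = (\<lambda>x. if x \<in> carrier A then r *\<^sub>R x else 0)" by (auto simp: fun_eq_iff)
  then show ?thesis unfolding C_one scalar_operators_def by blast
qed

lemma carrier_nonzero: "\<exists>x\<in>carrier A. x \<noteq> 0"
proof -
  have "nonzero_product A" using gr_simple by (simp add: graded_simple_def)
  then show ?thesis unfolding nonzero_product_def by (metis prod_zero(1))
qed

lemma scale_idA_inject: "r *\<^sub>R idA = t *\<^sub>R idA \<longleftrightarrow> r = t"
proof
  assume eq: "r *\<^sub>R idA = t *\<^sub>R idA"
  obtain x where x: "x \<in> carrier A" "x \<noteq> 0" using carrier_nonzero by blast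
  have "r *\<^sub>R x = t *\<^sub>R x" using fun_cong[OF eq, of x] x by simp
  then show "r = t" using x by simp
qed simp

lemma idA_nonzero: "idA \<noteq> 0"
  using scale_idA_inject[of 1 0] by simp

text \<open>By Schur's lemma the nonzero homogeneous elements of the centroid are invertible. The
  neutral element \<open>idA\<close> is the identity extended by zero, as operators vanish off the
  carrier.\<close>

definition units :: "('a \<Rightarrow> 'a) monoid" where
  "units = \<lparr>carrier = {c. c \<noteq> 0 \<and> (\<exists>k\<in>carrier G. c \<in> C k)}, monoid.mult = (\<circ>), one = idA\<rparr>"

lemma units_simps: "carrier units = {c. c \<noteq> 0 \<and> (\<exists>k\<in>carrier G. c \<in> C k)}"
  "c \<otimes>\<^bsub>units\<^esub> f = c \<circ> f" "\<one>\<^bsub>units\<^esub> = idA"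
  by (simp_all add: units_def)

lemma idA_comp:
  assumes "c \<in> C k"
  shows "idA \<circ> c = c" "c \<circ> idA = c"
  using CD[OF assms] by (auto simp: fun_eq_iff)

lemma comm_group_units: "comm_group units"
proof (rule comm_groupI, unfold units_simps)
  have id: "idA \<in> C \<one>" using scal_in[of 1] by simp
  show "idA \<in> {c. c \<noteq> 0 \<and> (\<exists>k\<in>carrier G. c \<in> C k)}" using id idA_nonzero by blast
  fix c assume "c \<in> {c. c \<noteq> 0 \<and> (\<exists>k\<in>carrier G. c \<in> C k)}"
  then obtain k where c: "c \<noteq> 0" "k \<in> carrier G" "c \<in> C k" by blast
  show "idA \<circ> c = c" using idA_comp c by blast
  show "\<exists>f\<in>{c. c \<noteq> 0 \<and> (\<exists>k\<in>carrier G. c \<in> C k)}. f \<circ> c = idA"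
  proof -
    obtain f where f: "f \<in> C (inv k)" "\<And>x. x \<in> carrier A \<Longrightarrow> f (c x) = x"
      "\<And>x. x \<in> carrier A \<Longrightarrow> c (f x) = x"
      using centroid_inverse[OF c(2,3,1)] by blast
    have "f \<circ> c = idA" using f(2) CD(3)[OF c(3)] CD(7)[OF f(1)] by (auto simp: fun_eq_iff)
    moreover have "f \<noteq> 0"
    proof
      assume "f = 0"
      then have "f \<circ> c = 0" by auto
      then show False using calculation idA_nonzero by simp
    qed
    ultimately show ?thesis using f(1) c(2) by blast
  qed
  fix f assume "f \<in> {c. c \<noteq> 0 \<and> (\<exists>k\<in>carrier G. c \<in> C k)}"
  then obtain h where f: "f \<noteq> 0" "h \<in> carrier G" "f \<in> C h" by blast
  show "c \<circ> f \<in> {c. c \<noteq> 0 \<and> (\<exists>k\<in>carrier G. c \<in> C k)}"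
    using centroid_comp_mult[OF c(2) f(2) c(3) f(3)] comp_nonzero[OF c(2,3,1) f(3,1)] c f by blast
  show "c \<circ> f = f \<circ> c" using centroid_comp_commute[OF c(2) f(2) c(3) f(3)] .
qed (simp add: comp_assoc)

abbreviation H where "H \<equiv> grading_support G C"

lemma zero_in_C: "k \<in> carrier G \<Longrightarrow> 0 \<in> C k"
proof -
  assume k: "k \<in> carrier G"
  show ?thesis
  proof (rule centroid_compI[OF k])
    show "lin_on (carrier A) (0 :: 'a \<Rightarrow> 'a)" by (simp add: lin_on_def)
    fix g x assume g: "g \<in> carrier G" "x \<in> \<Gamma> g"
    show "(0 :: 'a \<Rightarrow> 'a) x \<in> \<Gamma> (k \<otimes> g)" using subspace_0[OF subspace_comp] k g by simp
    fix h y assume "h \<in> carrier G" "y \<in> \<Gamma> h"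
    then have "x \<in> carrier A" "y \<in> carrier A" using g comp_closed by auto
    then show "(0 :: 'a \<Rightarrow> 'a) (x \<cdot> y) = x \<cdot> (0 :: 'a \<Rightarrow> 'a) y" "(0 :: 'a \<Rightarrow> 'a) (x \<cdot> y) = (0 :: 'a \<Rightarrow> 'a) x \<cdot> y"
      by (simp_all add: prod_zero)
  qed simp
qed

lemma H_iff: "k \<in> H \<longleftrightarrow> k \<in> carrier G \<and> (\<exists>c\<in>C k. c \<noteq> 0)"
  using zero_in_C by (auto simp: grading_support_def)

lemma subgroup_H: "subgroup H G"
proof
  show "H \<subseteq> carrier G" using H_iff by blast
  show "x \<otimes> y \<in> H" if "x \<in> H" "y \<in> H" for x y
  proof -
    obtain c f where "c \<in> C x" "c \<noteq> 0" "f \<in> C y" "f \<noteq> 0" "x \<in> carrier G" "y \<in> carrier G"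
      using \<open>x \<in> H\<close> \<open>y \<in> H\<close> H_iff by blast
    then show ?thesis using centroid_comp_mult[of x y c f] comp_nonzero[of x c f y] H_iff by blast
  qed
  show "\<one> \<in> H" using scal_in[of 1] idA_nonzero H_iff by auto
  show "inv x \<in> H" if x: "x \<in> H" for x
  proof -
    obtain c where c: "x \<in> carrier G" "c \<in> C x" "c \<noteq> 0" using x H_iff by blast
    obtain f where f: "f \<in> C (inv x)" "\<And>y. y \<in> carrier A \<Longrightarrow> f (c y) = y"
      "\<And>y. y \<in> carrier A \<Longrightarrow> c (f y) = y"
      using centroid_inverse[OF c] by blast
    obtain y where "y \<in> carrier A" "y \<noteq> 0" using carrier_nonzero by blast
    then have "f (c y) \<noteq> 0" using f(2)[of y] by simp
    then have "f \<noteq> 0" by auto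
    then show ?thesis using f c(1) H_iff by blast
  qed
qed

lemma realization:
  assumes \<chi>: "\<chi> \<in> hom G unit_circle"
    and c: "\<And>h. h \<in> H \<Longrightarrow> c h \<in> C h" "\<And>h. h \<in> H \<Longrightarrow> c h \<noteq> 0"
    and mult: "\<And>h k. h \<in> H \<Longrightarrow> k \<in> H \<Longrightarrow> c h \<circ> c k = root_sign G \<chi> h k *\<^sub>R c (h \<otimes> k)"
  shows "\<exists>(Q :: 'a alg) \<Delta>. real_algebra Q \<and> central_simple Q \<and> grading (G Mod H) Q \<Delta> \<and>
    graded_isomorphic G A \<Gamma> (loop_algebra G (\<lambda>g. H #> g) \<chi> Q \<Delta>) (loop_comp (\<lambda>g. H #> g) \<chi> \<Delta>)"
proof (rule loop_realization[OF \<chi> gr_simple subgroup_H c(1)])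
  interpret U: unit_character G \<chi> by unfold_locales (rule \<chi>)
  have one: "\<one> \<in> H" using subgroup.one_closed[OF subgroup_H] .
  show "c h (c k x) = root_sign G \<chi> h k *\<^sub>R c (h \<otimes> k) x" if "h \<in> H" "k \<in> H" for h k x
    using fun_cong[OF mult[OF that], of x] by simp
  \<comment> \<open>The sign at the identity is 1, so \<open>c \<one>\<close> is idempotent; being
    injective as well, it is the identity on the carrier.\<close>
  have "c \<one> \<circ> c \<one> = c \<one>" using mult[OF one one] U.root_sign_one[of \<one>] by simp
  then have "c \<one> (c \<one> x) = c \<one> x" for x by (metis comp_apply)
  then show "c \<one> x = x" if "x \<in> carrier A" for x
    using inj_onD[OF centroid_inj_on[OF one_closed c[OF one]] _ CD(2)[OF c(1)[OF one] that] that] by simp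
  fix k f assume "k \<in> carrier G" "f \<in> C k" "f \<noteq> 0"
  then have k: "k \<in> H" using H_iff by blast
  then show "k \<in> H \<and> (\<exists>r. \<forall>x\<in>carrier A. f x = r *\<^sub>R c k x)"
    using one_dimensional[OF \<open>k \<in> carrier G\<close> c[OF k] \<open>f \<in> C k\<close>] by metis
qed

end

section \<open>The character \<chi> and the matching basis of the centroid\<close>

context graded_central_simple
begin

text \<open>The inclusion of the nonzero reals into the nonzero complex numbers is extended from the
  scalars to all homogeneous units. Since components are one-dimensional, the values on units of one
  degree lie on one real line through 0.\<close>

lemma units_character:
  obtains f :: "('a \<Rightarrow> 'a) \<Rightarrow> complex"
  where "\<And>c. c \<in> carrier units \<Longrightarrow> f c \<noteq> 0"
    "\<And>c c'. c \<in> carrier units \<Longrightarrow> c' \<in> carrier units \<Longrightarrow> f (c \<circ> c') = f c * f c'"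
    "\<And>c r. c \<in> carrier units \<Longrightarrow> r \<noteq> 0 \<Longrightarrow> f (r *\<^sub>R c) = of_real r * f c"
proof -
  interpret U: comm_group units by (rule comm_group_units)
  let ?K = "(\<lambda>r. r *\<^sub>R idA) ` (- {0})"
  define f0 where "f0 c = complex_of_real (THE r. c = r *\<^sub>R idA)" for c
  have f0: "f0 (r *\<^sub>R idA) = of_real r" for r
    unfolding f0_def scale_idA_inject by simp
  have comp: "(r *\<^sub>R idA) \<circ> (t *\<^sub>R idA) = (r * t) *\<^sub>R idA" for r t
    using subspace_scale[OF subspace_carrier] by (auto simp: fun_eq_iff)
  have K_in: "r *\<^sub>R idA \<in> carrier units" if "r \<noteq> 0" for r
    using scal_in[of r] that scale_idA_inject[of r 0] by (auto simp: units_simps intro!: bexI[of _ \<one>])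
  have sub: "subgroup ?K units"
  proof (rule U.subgroupI)
    show "?K \<subseteq> carrier units" using K_in by blast
    have "1 *\<^sub>R idA \<in> ?K" by (rule imageI) simp
    then show "?K \<noteq> {}" by blast
    show "inv\<^bsub>units\<^esub> c \<in> ?K" if c: "c \<in> ?K" for c
    proof -
      obtain r where r: "r \<noteq> 0" "c = r *\<^sub>R idA" using c by blast
      have "inv\<^bsub>units\<^esub> c = (1 / r) *\<^sub>R idA"
        using r K_in[of r] K_in[of "1 / r"] comp[of "1 / r" r] by (intro U.inv_equality) (auto simp: units_simps)
      then show ?thesis using r by auto
    qed
    show "c \<otimes>\<^bsub>units\<^esub> c' \<in> ?K" if "c \<in> ?K" "c' \<in> ?K" for c c'
      using that comp by (auto simp: units_simps)
  qed
  obtain f where f: "\<And>c. c \<in> carrier units \<Longrightarrow> f c \<noteq> (0::complex)"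
    "\<And>c c'. c \<in> carrier units \<Longrightarrow> c' \<in> carrier units \<Longrightarrow> f (c \<otimes>\<^bsub>units\<^esub> c') = f c * f c'"
    "\<And>c. c \<in> ?K \<Longrightarrow> f c = f0 c"
  proof (rule U.character_extension[OF sub, of f0])
    show "f0 c \<noteq> 0" if "c \<in> ?K" for c using that f0 by auto
    show "f0 (c \<otimes>\<^bsub>units\<^esub> c') = f0 c * f0 c'" if "c \<in> ?K" "c' \<in> ?K" for c c'
      using that f0 comp by (auto simp: units_simps)
  qed (use that in blast)
  have "f (r *\<^sub>R c) = of_real r * f c" if c: "c \<in> carrier units" and r: "r \<noteq> 0" for c r
  proof -
    obtain k where k: "c \<in> C k" using c by (auto simp: units_simps)
    have "r *\<^sub>R c = (r *\<^sub>R idA) \<circ> c"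
      using CD(2)[OF k] CD(3)[OF k] by (auto simp: fun_eq_iff)
    moreover have "f (r *\<^sub>R idA) = of_real r" using f(3)[of "r *\<^sub>R idA"] f0 r by auto
    ultimately show ?thesis using f(2)[OF K_in[OF r] c] by (simp add: units_simps)
  qed
  with f(1) f(2)[unfolded units_simps(2)] show ?thesis by (rule that)
qed

text \<open>
  A character \<open>f\<close> of the group of homogeneous units that is the identity on the scalars gives the
  character \<open>h \<mapsto> (f c / |f c|)\<^sup>2\<close> of \<open>H\<close>, where \<open>c\<close> is any nonzero element of degree \<open>h\<close>. The
  square removes the dependence on the choice of \<open>c\<close>, which is only a sign after normalisation.
\<close>

lemma exists_realizing_character:
  obtains \<chi> c where "\<chi> \<in> hom G unit_circle" "\<And>h. h \<in> H \<Longrightarrow> c h \<in> C h" "\<And>h. h \<in> H \<Longrightarrow> c h \<noteq> 0"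
    "\<And>h k. h \<in> H \<Longrightarrow> k \<in> H \<Longrightarrow> c h \<circ> c k = root_sign G \<chi> h k *\<^sub>R c (h \<otimes> k)"
proof -
  obtain f :: "('a \<Rightarrow> 'a) \<Rightarrow> complex" where f: "\<And>c. c \<in> carrier units \<Longrightarrow> f c \<noteq> 0"
    "\<And>c c'. c \<in> carrier units \<Longrightarrow> c' \<in> carrier units \<Longrightarrow> f (c \<circ> c') = f c * f c'"
    "\<And>c r. c \<in> carrier units \<Longrightarrow> r \<noteq> 0 \<Longrightarrow> f (r *\<^sub>R c) = of_real r * f c"
    using units_character by blast
  have HG: "h \<in> carrier G" if "h \<in> H" for h using that H_iff by blast
  have Hm: "h \<otimes> k \<in> H" if "h \<in> H" "k \<in> H" for h k using subgroup.m_closed[OF subgroup_H that] .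
  have unit: "c \<in> carrier units" if "h \<in> H" "c \<in> C h" "c \<noteq> 0" for h c
    using that HG by (auto simp: units_simps)
  have "\<forall>h\<in>H. \<exists>c. c \<in> C h \<and> c \<noteq> 0" using H_iff by blast
  then obtain b where b: "\<And>h. h \<in> H \<Longrightarrow> b h \<in> C h" "\<And>h. h \<in> H \<Longrightarrow> b h \<noteq> 0" by metis
  have b_unit: "b h \<in> carrier units" if "h \<in> H" for h using unit b that by blast
  \<comment> \<open>Structure constants between homogeneous units are real, and \<open>f\<close>
    carries them over unchanged to complex numbers.\<close>
  have scal: "\<exists>r. r \<noteq> 0 \<and> c \<circ> c' = r *\<^sub>R c'' \<and> f c * f c' = of_real r * f c''"
    if *: "h \<in> H" "k \<in> H" "c \<in> C h" "c \<noteq> 0" "c' \<in> C k" "c' \<noteq> 0" "c'' \<in> C (h \<otimes> k)" "c'' \<noteq> 0" for h k c c' c''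
  proof -
    have cc: "c \<circ> c' \<in> C (h \<otimes> k)" "c \<circ> c' \<noteq> 0"
      using centroid_comp_mult[OF HG HG, of h k c c'] comp_nonzero[OF HG, of h c c' k] * by auto
    obtain r where r: "c \<circ> c' = r *\<^sub>R c''"
      using one_dimensional[OF HG[OF Hm[OF *(1,2)]] *(7,8) cc(1)] by blast
    have "r \<noteq> 0" using r cc(2) by auto
    moreover have "f c * f c' = of_real r * f c''"
      using f(2)[OF unit unit, OF *(1,3,4) *(2,5,6)] f(3)[OF unit[OF Hm[OF *(1,2)] *(7,8)] \<open>r \<noteq> 0\<close>] r by simp
    ultimately show ?thesis using r by blast
  qed
  define \<chi>0 where "\<chi>0 h = (sgn (f (b h)))\<^sup>2" for h
  have \<chi>0_norm: "cmod (\<chi>0 h) = 1" if "h \<in> H" for h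
    using f(1)[OF b_unit[OF that]] by (simp add: \<chi>0_def norm_power norm_sgn)
  have \<chi>0_mult: "\<chi>0 (h \<otimes> k) = \<chi>0 h * \<chi>0 k" if hk: "h \<in> H" "k \<in> H" for h k
  proof -
    obtain r where r: "r \<noteq> 0" "f (b h) * f (b k) = of_real r * f (b (h \<otimes> k))"
      using scal[OF hk b[OF hk(1)] b[OF hk(2)] b[OF Hm[OF hk]]] by blast
    have "sgn (f (b h)) * sgn (f (b k)) = of_real (sgn r) * sgn (f (b (h \<otimes> k)))"
      using arg_cong[OF r(2), of sgn] by (simp add: sgn_mult sgn_of_real)
    then have "\<chi>0 h * \<chi>0 k = (of_real (sgn r))\<^sup>2 * \<chi>0 (h \<otimes> k)"
      by (simp add: \<chi>0_def flip: power_mult_distrib)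
    then show ?thesis using r(1) by (simp add: sgn_if split: if_splits)
  qed
  \<comment> \<open>The extension from \<open>H\<close> to \<open>G\<close> need not be unimodular.
    Replacing it by its \<open>sgn\<close> makes it so and changes nothing on \<open>H\<close>,
    where \<open>\<chi>0\<close> is unimodular already.\<close>
  obtain F where F: "\<And>g. g \<in> carrier G \<Longrightarrow> F g \<noteq> (0::complex)"
    "\<And>g h. g \<in> carrier G \<Longrightarrow> h \<in> carrier G \<Longrightarrow> F (g \<otimes> h) = F g * F h"
    "\<And>h. h \<in> H \<Longrightarrow> F h = \<chi>0 h"
  proof (rule character_extension[OF subgroup_H, of \<chi>0])
    show "\<chi>0 h \<noteq> 0" if "h \<in> H" for h using \<chi>0_norm[OF that] by auto
    show "\<chi>0 (h \<otimes> k) = \<chi>0 h * \<chi>0 k" if "h \<in> H" "k \<in> H" for h k using \<chi>0_mult[OF that] .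
  qed (use that in blast)
  define \<chi> where "\<chi> g = sgn (F g)" for g
  have \<chi>: "\<chi> \<in> hom G unit_circle"
    using F(1,2) by (auto simp: hom_def unit_circle_def \<chi>_def norm_sgn sgn_mult)
  have \<chi>_H: "\<chi> h = \<chi>0 h" if "h \<in> H" for h
    using F(3)[OF that] \<chi>0_norm[OF that] by (simp add: \<chi>_def sgn_div_norm)
  interpret U: unit_character G \<chi> by unfold_locales (rule \<chi>)
  have "\<exists>c. c \<in> C h \<and> c \<noteq> 0 \<and> f c = csqrt (\<chi> h)" if h: "h \<in> H" for h
  proof -
    let ?w = "f (b h)"
    have w: "?w \<noteq> 0" using f(1)[OF b_unit[OF h]] .
    have "(csqrt (\<chi> h))\<^sup>2 = (sgn ?w)\<^sup>2" using \<chi>_H[OF h] by (simp add: \<chi>0_def)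
    then have "csqrt (\<chi> h) = sgn ?w \<or> csqrt (\<chi> h) = - sgn ?w" by (simp only: power2_eq_iff)
    \<comment> \<open>The chosen root is a real multiple of \<open>f (b h)\<close>, with factor plus
      or minus the inverse of its modulus. Rescaling \<open>b h\<close> by this factor gives a unit
      on which \<open>f\<close> takes exactly the value \<open>csqrt (\<chi> h)\<close>.\<close>
    then obtain r where "r \<noteq> 0" "csqrt (\<chi> h) = of_real r * ?w"
    proof
      assume "csqrt (\<chi> h) = sgn ?w"
      then show ?thesis using that[of "1 / cmod ?w"] w by (simp add: sgn_div_norm scaleR_conv_of_real divide_inverse)
    next
      assume "csqrt (\<chi> h) = - sgn ?w"
      then show ?thesis using that[of "- (1 / cmod ?w)"] w by (simp add: sgn_div_norm scaleR_conv_of_real divide_inverse)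
    qed
    then show ?thesis
      using f(3)[OF b_unit[OF h]] C_scale[OF HG[OF h] b(1)[OF h]] b(2)[OF h]
      by (intro exI[of _ "r *\<^sub>R b h"]) (auto simp: scaleR_eq_0_iff fun_eq_iff)
  qed
  then obtain c where c: "\<And>h. h \<in> H \<Longrightarrow> c h \<in> C h" "\<And>h. h \<in> H \<Longrightarrow> c h \<noteq> 0"
    "\<And>h. h \<in> H \<Longrightarrow> f (c h) = csqrt (\<chi> h)" by metis
  have "c h \<circ> c k = root_sign G \<chi> h k *\<^sub>R c (h \<otimes> k)" if hk: "h \<in> H" "k \<in> H" for h k
  proof -
    obtain r where r: "c h \<circ> c k = r *\<^sub>R c (h \<otimes> k)" "f (c h) * f (c k) = of_real r * f (c (h \<otimes> k))"
      using scal[OF hk c(1,2)[OF hk(1)] c(1,2)[OF hk(2)] c(1,2)[OF Hm[OF hk]]] by blast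
    \<comment> \<open>Under \<open>f\<close> the units become the chosen roots, so the real
      structure constant is the sign of these roots.\<close>
    have "csqrt (\<chi> h) * csqrt (\<chi> k) = of_real r * csqrt (\<chi> (h \<otimes> k))"
      using r(2) c(3) hk Hm[OF hk] by simp
    then have "complex_of_real r = of_real (root_sign G \<chi> h k)"
      using U.root_mult(1)[OF HG HG, OF hk] U.root_nonzero[OF HG[OF Hm[OF hk]]] by simp
    then show ?thesis using r(1) by simp
  qed
  then show ?thesis using that[OF \<chi> c(1,2)] by blast
qed

text \<open>The basis is the image of the \<open>u\<^sub>h\<close> under the given isomorphism. With
  the reals trivially graded, \<open>u\<^sub>h\<close> lies in the loop algebra for \<open>h\<close>
  in \<open>H\<close> because \<open>H #> h\<close> is then the identity coset.\<close>

lemma centroid_loop_basis: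
  assumes \<chi>: "\<chi> \<in> hom G unit_circle"
    and iso: "graded_isomorphic G
      (loop_algebra G (\<lambda>g. H #> g) \<chi> real_line (trivial_grading (G Mod H) real_line))
      (loop_comp (\<lambda>g. H #> g) \<chi> (trivial_grading (G Mod H) real_line)) (centroid A) C"
  obtains c where "\<And>h. h \<in> H \<Longrightarrow> c h \<in> C h" "\<And>h. h \<in> H \<Longrightarrow> c h \<noteq> 0"
    "\<And>h k. h \<in> H \<Longrightarrow> k \<in> H \<Longrightarrow> c h \<circ> c k = root_sign G \<chi> h k *\<^sub>R c (h \<otimes> k)"
proof -
  interpret U: unit_character G \<chi> by unfold_locales (rule \<chi>)
  let ?\<Delta> = "trivial_grading (G Mod H) real_line"
  let ?L = "loop_algebra G (\<lambda>g. H #> g) \<chi> real_line ?\<Delta>"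
  obtain \<psi> where \<psi>: "bij_betw \<psi> (carrier ?L) (carrier (centroid A))" "lin_on (carrier ?L) \<psi>"
    and \<psi>_mult: "\<And>x y. x \<in> carrier ?L \<Longrightarrow> y \<in> carrier ?L \<Longrightarrow> \<psi> (x \<star>\<^bsub>?L\<^esub> y) = \<psi> x \<circ> \<psi> y"
    and \<psi>_comp: "\<And>g. g \<in> carrier G \<Longrightarrow> \<psi> ` loop_comp (\<lambda>g. H #> g) \<chi> ?\<Delta> g = C g"
    using iso by (auto simp: graded_isomorphic_def centroid_def)
  have rl: "real_algebra real_line"
    by standard (auto simp: real_line_def algebra_simps)
  have L: "subspace (carrier ?L)" by (simp add: loop_algebra_def)
  define u where "u h = pure_tensor (1::real) (loop_unit \<chi> h)" for h
  have HG: "h \<in> carrier G" if "h \<in> H" for h using that H_iff by blast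
  have u_comp: "u h \<in> loop_comp (\<lambda>g. H #> g) \<chi> ?\<Delta> h" if "h \<in> H" for h
    using subgroup.rcos_const[OF subgroup_H is_group that]
    by (auto simp: u_def loop_comp_def trivial_grading_def FactGroup_def real_line_def)
  have u_in: "u h \<in> carrier ?L" if "h \<in> H" for h
    using u_comp[OF that] HG[OF that] by (auto simp: loop_algebra_def intro!: span_base)
  have u_nz: "u h \<noteq> 0" if "h \<in> H" for h
  proof
    assume "u h = 0"
    then have "u h h = 0" by simp
    then have "csqrt (\<chi> h) = 0"
      by (simp add: u_def pure_tensor_def loop_unit_def monomial_def zero_prod_def complex_eq_iff del: csqrt.sel)
    then show False using U.root_nonzero[OF HG[OF that]] by simp
  qed
  have u_mult: "u h \<star>\<^bsub>?L\<^esub> u k = root_sign G \<chi> h k *\<^sub>R u (h \<otimes> k)" if "h \<in> H" "k \<in> H" for h k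
  proof -
    have "u h \<star>\<^bsub>?L\<^esub> u k = pure_tensor (1::real) (monomial (csqrt (\<chi> h) * csqrt (\<chi> k)) (h \<otimes> k))"
      using real_algebra.pure_tensor_prod[OF rl _ _ monomial_in[OF HG[OF that(1)]] monomial_in[OF HG[OF that(2)]], of 1 1]
      by (simp add: u_def loop_unit_def loop_algebra_def monomial_mult real_line_def)
    then show ?thesis
      by (simp add: U.root_mult(1)[OF HG HG, OF that] pure_tensor_monomial_scale u_def loop_unit_def)
  qed
  show ?thesis
  proof (rule that[of "\<lambda>h. \<psi> (u h)"])
    show "\<psi> (u h) \<in> C h" if "h \<in> H" for h using \<psi>_comp[OF HG[OF that]] u_comp[OF that] by blast
    show "\<psi> (u h) \<noteq> 0" if "h \<in> H" for h
      using inj_onD[OF bij_betw_imp_inj_on[OF \<psi>(1)] _ u_in[OF that] subspace_0[OF L]] u_nz[OF that]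
        lin_on_zero[OF \<psi>(2) L] by auto
    show "\<psi> (u h) \<circ> \<psi> (u k) = root_sign G \<chi> h k *\<^sub>R \<psi> (u (h \<otimes> k))" if "h \<in> H" "k \<in> H" for h k
      using \<psi>_mult[OF u_in u_in, OF that] u_mult[OF that]
        lin_on_scale[OF \<psi>(2) u_in[OF subgroup.m_closed[OF subgroup_H that]]] by simp
  qed
qed

end

theorem theorem3p3:
  fixes G :: "('g, 'n) monoid_scheme"
    and B :: "('b::real_vector, 'm) alg_scheme"
    and \<Gamma> :: "'g \<Rightarrow> 'b set"
    and H :: "'g set"
    and \<pi> :: "'g \<Rightarrow> 'g set"
  assumes "comm_group G"
    and "real_algebra B"
    and "grading G B \<Gamma>"
    and "graded_simple G B \<Gamma>"
    and "graded_central G B \<Gamma>"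
  defines "H \<equiv> grading_support G (centroid_comp G B \<Gamma>)"
    and "\<pi> \<equiv> (\<lambda>g. H #>\<^bsub>G\<^esub> g)"
  shows
    "(\<exists>\<chi> \<in> hom G unit_circle. \<exists>(A :: 'b alg) (\<Delta> :: 'g set \<Rightarrow> 'b set).
        real_algebra A \<and> central_simple A \<and> grading (G Mod H) A \<Delta> \<and>
        graded_isomorphic G B \<Gamma> (loop_algebra G \<pi> \<chi> A \<Delta>) (loop_comp \<pi> \<chi> \<Delta>)) \<and>
     (\<forall>\<chi> \<in> hom G unit_circle.
        graded_isomorphic G
          (loop_algebra G \<pi> \<chi> real_line (trivial_grading (G Mod H) real_line))
          (loop_comp \<pi> \<chi> (trivial_grading (G Mod H) real_line))
          (centroid B) (centroid_comp G B \<Gamma>) \<longrightarrow>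
        (\<exists>(A :: 'b alg) (\<Delta> :: 'g set \<Rightarrow> 'b set).
          real_algebra A \<and> central_simple A \<and> grading (G Mod H) A \<Delta> \<and>
          graded_isomorphic G B \<Gamma> (loop_algebra G \<pi> \<chi> A \<Delta>) (loop_comp \<pi> \<chi> \<Delta>)))"
proof -
  interpret graded_central_simple B G \<Gamma>
    using assms(1-5)
    by (simp add: graded_central_simple_def graded_central_simple_axioms_def graded_real_algebra_def
        graded_real_algebra_axioms_def)
  \<comment> \<open>From here both claims only require nonzero central operators \<open>c h\<close>
    of degree \<open>h\<close> that multiply like the \<open>u\<^sub>h\<close>: for a constructed
    \<chi> in the first claim, for the given one in the second.\<close>
  note real = realization[folded H_def \<pi>_def]
  obtain \<chi> c where "\<chi> \<in> hom G unit_circle" "\<And>h. h \<in> H \<Longrightarrow> c h \<in> C h" "\<And>h. h \<in> H \<Longrightarrow> c h \<noteq> 0"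
    "\<And>h k. h \<in> H \<Longrightarrow> k \<in> H \<Longrightarrow> c h \<circ> c k = root_sign G \<chi> h k *\<^sub>R c (h \<otimes>\<^bsub>G\<^esub> k)"
    by (rule exists_realizing_character[folded H_def]) (use that in blast)
  from real[OF this] \<open>\<chi> \<in> hom G unit_circle\<close>
  have "\<exists>\<chi> \<in> hom G unit_circle. \<exists>(A :: 'b alg) (\<Delta> :: 'g set \<Rightarrow> 'b set).
        real_algebra A \<and> central_simple A \<and> grading (G Mod H) A \<Delta> \<and>
        graded_isomorphic G B \<Gamma> (loop_algebra G \<pi> \<chi> A \<Delta>) (loop_comp \<pi> \<chi> \<Delta>)"
    by blast
  moreover have "\<exists>(A :: 'b alg) (\<Delta> :: 'g set \<Rightarrow> 'b set).
        real_algebra A \<and> central_simple A \<and> grading (G Mod H) A \<Delta> \<and>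
        graded_isomorphic G B \<Gamma> (loop_algebra G \<pi> \<chi> A \<Delta>) (loop_comp \<pi> \<chi> \<Delta>)"
    if \<chi>: "\<chi> \<in> hom G unit_circle"
      and iso: "graded_isomorphic G
          (loop_algebra G \<pi> \<chi> real_line (trivial_grading (G Mod H) real_line))
          (loop_comp \<pi> \<chi> (trivial_grading (G Mod H) real_line))
          (centroid B) (centroid_comp G B \<Gamma>)" for \<chi>
  proof -
    obtain c where "\<And>h. h \<in> H \<Longrightarrow> c h \<in> C h" "\<And>h. h \<in> H \<Longrightarrow> c h \<noteq> 0"
      "\<And>h k. h \<in> H \<Longrightarrow> k \<in> H \<Longrightarrow> c h \<circ> c k = root_sign G \<chi> h k *\<^sub>R c (h \<otimes>\<^bsub>G\<^esub> k)"
      by (rule centroid_loop_basis[folded H_def \<pi>_def, OF \<chi> iso]) (use that in blast)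
    from real[OF \<chi> this] show ?thesis .
  qed
  ultimately show ?thesis by blast
qed


end
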